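(* Let $\mathcal{G}$ be a finite $2$-player game and let $X(t)$ be a solution orbit of the stochastically perturbed reinforcement learning process $$dY_{k\alpha}=v_{k\alpha}(X)\,dt+\sigma_{k\alpha}(X)\,dW_{k\alpha},\qquad X_k=Q_k(\eta_kY_k)\qquad(k=1,2,\ \alpha\in\mathcal{A}_k).\tag{SRL}$$ Then, almost surely, the $\omega$-limit set of the time average $\bar X(t)=\frac1t\int_0^tX(s)\,ds$ is internally chain transitive under the deterministic best response dynamics $$\dot x_k\in\operatorname{br}_k(x)-x_k,\qquad k=1,2,\tag{BRD}$$ where $\operatorname{br}_k(x)=\arg\max_{x_k'\in\mathcal{X}_k}\langle v_k(x),x_k'\rangle$.
   Context: Game: $\mathcal{N}=\{1,2\}$ is the set of players, $\mathcal{A}_k$ the finite action set of player $k$, $\mathcal{A}=\mathcal{A}_1\times\mathcal{A}_2$, $u_k:\mathcal{A}\to\mathbb{R}$ the payoff functions, extended multilinearly to $\mathcal{X}=\mathcal{X}_1\times\mathcal{X}_2$ with $\mathcal{X}_k=\Delta(\mathcal{A}_k)$ the simplex of mixed strategies. $v_{k\alpha}(x)=u_k(\alpha;x_{-k})$ and $v_k(x)=(v_{k\alpha}(x))_{\alpha\in\mathcal{A}_k}$. (SRL): the $W_{k\alpha}$ are independent standard Wiener processes (across players and strategies) and the diffusion coefficients $\sigma_{k\alpha}:\mathcal{X}\to\mathbb{R}$ are Lipschitz. The choice maps are $Q_k(y_k)=\arg\max_{x_k\in\mathcal{X}_k}\{\langle y_k,x_k\rangle-h_k(x_k)\}$, where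 the penalty function $h_k:\mathcal{X}_k\to\mathbb{R}$ is continuous on $\mathcal{X}_k$, smooth on the relative interior of every face of $\mathcal{X}_k$, and strongly convex: there is $K>0$ with $h_k(tx_k+(1-t)x_k')\le th_k(x_k)+(1-t)h_k(x_k')-\frac12Kt(1-t)\|x_k'-x_k\|^2$ for all $x_k,x_k'\in\mathcal{X}_k$, $t\in[0,1]$. Each learning parameter $\eta_k:[0,\infty)\to(0,\infty)$ is $C^1$-smooth, nonincreasing, with $\lim_{t\to\infty}t\eta_k(t)=+\infty$. Internal chain transitivity: a solution of (BRD) is an absolutely continuous curve satisfying the inclusion for almost every $t$. A compact set $L\subseteq\mathcal{X}$ is internally chain transitive under (BRD) if for all $x,y\in L$, all $\varepsilon>0$ and all $T>0$ there exist an integer $n\ge1$, solutions $x^1,\dots,x^n$ of (BRD) and times $t_1,\dots,t_n>T$ such that $x^i(s)\in L$ for all $0\le s\le t_i$ and all $i$; $\|x^i(t_i)-x^{i+1}(0)\|\le\varepsilon$ for $i=1,\dots,n-1$; $\|x^1(0)-x\|\le\varepsilon$ and $\|x^n(t_n)-y\|\le\varepsilon$. *)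

theory Defs
  imports "HOL-Probability.Probability"
begin

section \<open>Finite two-player games\<close>

text \<open>
  The finite types \<open>'a\<close> and \<open>'b\<close> are the action sets of players 1 and 2. A strategy
  profile is a pair \<open>x\<close> in \<open>(real^'a) \<times> (real^'b)\<close>, and the pairs \<open>(k, \<alpha>)\<close> of a
  player and one of its actions are the elements of \<open>'a + 'b\<close>.
\<close>

type_synonym ('a, 'b) profile = "(real^'a) \<times> (real^'b)"

definition mixed :: "(real^'a::finite) set" where
  "mixed = {x. (\<forall>i. 0 \<le> x $ i) \<and> (\<Sum>i\<in>UNIV. x $ i) = 1}"

definition profiles :: "('a::finite, 'b::finite) profile set" where
  "profiles = mixed \<times> mixed"

definition coord :: "'a + 'b \<Rightarrow> ('a::finite, 'b::finite) profile \<Rightarrow> real" where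
  "coord i x = (case i of Inl \<alpha> \<Rightarrow> fst x $ \<alpha> | Inr \<beta> \<Rightarrow> snd x $ \<beta>)"

definition expected_payoff ::
    "('a::finite \<times> 'b::finite \<Rightarrow> real) \<Rightarrow> ('a, 'b) profile \<Rightarrow> real" where
  "expected_payoff u x = (\<Sum>\<alpha>\<in>UNIV. \<Sum>\<beta>\<in>UNIV. fst x $ \<alpha> * snd x $ \<beta> * u (\<alpha>, \<beta>))"

definition payoff_vec ::
    "('a::finite \<times> 'b::finite \<Rightarrow> real) \<Rightarrow> ('a \<times> 'b \<Rightarrow> real) \<Rightarrow> ('a, 'b) profile \<Rightarrow> ('a, 'b) profile"
  where
  "payoff_vec u1 u2 x =
     ((\<chi> \<alpha>. expected_payoff u1 (axis \<alpha> 1, snd x)), (\<chi> \<beta>. expected_payoff u2 (fst x, axis \<beta> 1)))"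

section \<open>Penalty functions, choice maps, learning parameters\<close>

text \<open>\<open>Ck_on k f U\<close> is \<open>C^k\<close>-smoothness on \<open>U\<close>; it is only meaningful for open \<open>U\<close>.\<close>

primrec Ck_on :: "nat \<Rightarrow> ('v::euclidean_space \<Rightarrow> real) \<Rightarrow> 'v set \<Rightarrow> bool" where
  "Ck_on 0 f U \<longleftrightarrow> continuous_on U f"
| "Ck_on (Suc k) f U \<longleftrightarrow>
     f differentiable_on U \<and> (\<forall>v. Ck_on k (\<lambda>x. frechet_derivative f (at x) v) U)"

text \<open>
  Smoothness on a relatively open subset of an affine subspace, which need not be open in
  the ambient space: locally, the function is the restriction of an ambient smooth function.
\<close>

definition smooth_rel :: "('v::euclidean_space \<Rightarrow> real) \<Rightarrow> 'v set \<Rightarrow> bool" where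
  "smooth_rel f S \<longleftrightarrow>
     (\<forall>x\<in>S. \<exists>U g. open U \<and> x \<in> U \<and> (\<forall>k. Ck_on k g U) \<and> (\<forall>y\<in>U \<inter> S. g y = f y))"

definition strongly_convex_on :: "'v::real_normed_vector set \<Rightarrow> ('v \<Rightarrow> real) \<Rightarrow> bool" where
  "strongly_convex_on S f \<longleftrightarrow>
     (\<exists>K>0. \<forall>x\<in>S. \<forall>x'\<in>S. \<forall>t\<in>{0..1}.
        f (t *\<^sub>R x + (1 - t) *\<^sub>R x')
          \<le> t * f x + (1 - t) * f x' - 1/2 * K * t * (1 - t) * (norm (x' - x))\<^sup>2)"

definition penalty :: "(real^'a::finite \<Rightarrow> real) \<Rightarrow> bool" where
  "penalty h \<longleftrightarrow>
     continuous_on mixed h \<and>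
     (\<forall>C. C face_of mixed \<longrightarrow> smooth_rel h (rel_interior C)) \<and>
     strongly_convex_on mixed h"

text \<open>For a penalty function \<open>h\<close> the maximizer exists and is unique.\<close>

definition choice_map :: "(real^'a::finite \<Rightarrow> real) \<Rightarrow> real^'a \<Rightarrow> real^'a" where
  "choice_map h y = arg_max_on (\<lambda>x. y \<bullet> x - h x) mixed"

definition learning_param :: "(real \<Rightarrow> real) \<Rightarrow> bool" where
  "learning_param \<eta> \<longleftrightarrow>
     (\<forall>t\<ge>0. 0 < \<eta> t) \<and>
     (\<exists>\<eta>'. continuous_on {0..} \<eta>' \<and>
        (\<forall>t\<ge>0. (\<eta> has_real_derivative \<eta>' t) (at t within {0..}))) \<and>
     antimono_on {0..} \<eta> \<and>
     filterlim (\<lambda>t. t * \<eta> t) at_top at_top"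

section \<open>Wiener processes and the Ito integral\<close>

text \<open>
  Time is \<open>real\<close>, but processes are only constrained for \<open>t \<ge> 0\<close>. The filtration is
  neither assumed to be complete nor to be right-continuous.
\<close>

definition filtered_prob_space :: "'w measure \<Rightarrow> (real \<Rightarrow> 'w measure) \<Rightarrow> bool" where
  "filtered_prob_space M F \<longleftrightarrow>
     prob_space M \<and> filtration (space M) F \<and> (\<forall>t. subalgebra M (F t))"

definition adapted ::
    "(real \<Rightarrow> 'w measure) \<Rightarrow> (real \<Rightarrow> 'w \<Rightarrow> 'v::topological_space) \<Rightarrow> bool" where
  "adapted F H \<longleftrightarrow> (\<forall>t\<ge>0. H t \<in> borel_measurable (F t))"

definition continuous_paths ::
    "'w measure \<Rightarrow> (real \<Rightarrow> 'w \<Rightarrow> 'v::topological_space) \<Rightarrow> bool" where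
  "continuous_paths M H \<longleftrightarrow> (AE \<omega> in M. continuous_on {0..} (\<lambda>t. H t \<omega>))"

text \<open>
  A family of independent standard Wiener processes relative to \<open>F\<close>: the vector of
  increments over \<open>[s, t]\<close> is independent of \<open>F s\<close> and its components are independent
  and normal with variance \<open>t - s\<close>.
\<close>

definition wiener_family ::
    "'w measure \<Rightarrow> (real \<Rightarrow> 'w measure) \<Rightarrow> ('i::finite \<Rightarrow> real \<Rightarrow> 'w \<Rightarrow> real) \<Rightarrow> bool" where
  "wiener_family M F W \<longleftrightarrow>
     (\<forall>i. adapted F (W i) \<and> continuous_paths M (W i) \<and> (AE \<omega> in M. W i 0 \<omega> = 0)) \<and>
     (\<forall>s t. 0 \<le> s \<and> s < t \<longrightarrow>
        (\<forall>i. distributed M lborel (\<lambda>\<omega>. W i t \<omega> - W i s \<omega>) (normal_density 0 (sqrt (t - s)))) \<and>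
        prob_space.indep_vars M (\<lambda>_. borel) (\<lambda>i \<omega>. W i t \<omega> - W i s \<omega>) UNIV \<and>
        prob_space.indep_set M (sets (F s))
          (sets (vimage_algebra (space M) (\<lambda>\<omega>. \<lambda>i\<in>UNIV. W i t \<omega> - W i s \<omega>)
                   (Pi\<^sub>M UNIV (\<lambda>_. borel)))))"

text \<open>
  The elementary process \<open>\<Sum>j<n. \<xi> j * 1_(\<tau> j, \<tau> (j+1)]\<close>, where \<open>\<xi> j\<close> is bounded
  and measurable with respect to \<open>F (\<tau> j)\<close>, and its stochastic integral over \<open>[0, t]\<close>.
\<close>

definition elementary ::
    "'w measure \<Rightarrow> (real \<Rightarrow> 'w measure) \<Rightarrow> nat \<Rightarrow> (nat \<Rightarrow> real) \<Rightarrow> (nat \<Rightarrow> 'w \<Rightarrow> real) \<Rightarrow> bool" where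
  "elementary M F n \<tau> \<xi> \<longleftrightarrow>
     0 \<le> \<tau> 0 \<and> (\<forall>j<n. \<tau> j \<le> \<tau> (Suc j)) \<and>
     (\<forall>j<n. \<xi> j \<in> borel_measurable (F (\<tau> j)) \<and> (\<exists>B. \<forall>\<omega>\<in>space M. \<bar>\<xi> j \<omega>\<bar> \<le> B))"

definition elementary_process ::
    "nat \<Rightarrow> (nat \<Rightarrow> real) \<Rightarrow> (nat \<Rightarrow> 'w \<Rightarrow> real) \<Rightarrow> real \<Rightarrow> 'w \<Rightarrow> real" where
  "elementary_process n \<tau> \<xi> t \<omega> = (\<Sum>j<n. \<xi> j \<omega> * indicat_real {\<tau> j<..\<tau> (Suc j)} t)"

definition elementary_integral ::
    "(real \<Rightarrow> 'w \<Rightarrow> real) \<Rightarrow> nat \<Rightarrow> (nat \<Rightarrow> real) \<Rightarrow> (nat \<Rightarrow> 'w \<Rightarrow> real) \<Rightarrow> real \<Rightarrow> 'w \<Rightarrow> real" where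
  "elementary_integral W n \<tau> \<xi> t \<omega> =
     (\<Sum>j<n. \<xi> j \<omega> * (W (min t (\<tau> (Suc j))) \<omega> - W (min t (\<tau> j)) \<omega>))"

text \<open>
  \<open>Z\<close> is (a continuous version of) the Ito integral process \<open>\<integral>\<^sub>0\<^sup>t H dW\<close>: elementary
  processes approximate \<open>H\<close> in \<open>L\<^sup>2([0,T] \<times> \<Omega>)\<close> and their integrals converge to \<open>Z T\<close>
  in \<open>L\<^sup>2(\<Omega>)\<close>, for every \<open>T\<close>. Only adapted integrands with continuous paths that are
  square-integrable on every \<open>[0,T] \<times> \<Omega>\<close> are covered; by the Ito isometry, \<open>Z\<close> does
  not depend on the approximating sequence. Since the filtration need not be complete,
  \<open>Z\<close> is only required to be measurable with respect to \<open>M\<close>.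
\<close>

definition ito_integral ::
    "'w measure \<Rightarrow> (real \<Rightarrow> 'w measure) \<Rightarrow> (real \<Rightarrow> 'w \<Rightarrow> real) \<Rightarrow> (real \<Rightarrow> 'w \<Rightarrow> real)
      \<Rightarrow> (real \<Rightarrow> 'w \<Rightarrow> real) \<Rightarrow> bool" where
  "ito_integral M F W H Z \<longleftrightarrow>
     adapted F H \<and> continuous_paths M H \<and>
     (\<forall>t\<ge>0. Z t \<in> borel_measurable M) \<and> continuous_paths M Z \<and>
     (\<exists>n \<tau> \<xi>. (\<forall>m. elementary M F (n m) (\<tau> m) (\<xi> m)) \<and>
        (\<forall>T\<ge>0.
          (\<lambda>m::nat. \<integral>\<^sup>+\<omega>. (\<integral>\<^sup>+s\<in>{0..T}.
              ennreal ((elementary_process (n m) (\<tau> m) (\<xi> m) s \<omega> - H s \<omega>)\<^sup>2) \<partial>lborel) \<partial>M)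
            \<longlonglongrightarrow> 0 \<and>
          (\<lambda>m. \<integral>\<^sup>+\<omega>.
              ennreal ((elementary_integral W (n m) (\<tau> m) (\<xi> m) T \<omega> - Z T \<omega>)\<^sup>2) \<partial>M)
            \<longlonglongrightarrow> 0))"

section \<open>Stochastically perturbed reinforcement learning\<close>

definition srl_solution ::
    "'w measure \<Rightarrow> (real \<Rightarrow> 'w measure) \<Rightarrow> ('a + 'b \<Rightarrow> real \<Rightarrow> 'w \<Rightarrow> real)
      \<Rightarrow> ('a::finite \<times> 'b::finite \<Rightarrow> real) \<Rightarrow> ('a \<times> 'b \<Rightarrow> real)
      \<Rightarrow> ('a + 'b \<Rightarrow> ('a, 'b) profile \<Rightarrow> real)
      \<Rightarrow> (real^'a \<Rightarrow> real) \<Rightarrow> (real^'b \<Rightarrow> real) \<Rightarrow> (real \<Rightarrow> real) \<Rightarrow> (real \<Rightarrow> real)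
      \<Rightarrow> (real \<Rightarrow> 'w \<Rightarrow> ('a, 'b) profile) \<Rightarrow> (real \<Rightarrow> 'w \<Rightarrow> ('a, 'b) profile) \<Rightarrow> bool" where
  "srl_solution M F W u1 u2 \<sigma> h1 h2 \<eta>1 \<eta>2 X Y \<longleftrightarrow>
     adapted F Y \<and> continuous_paths M Y \<and>
     (\<forall>i. \<exists>Z. ito_integral M F (W i) (\<lambda>t \<omega>. \<sigma> i (X t \<omega>)) Z \<and>
        (AE \<omega> in M. \<forall>t\<ge>0. coord i (Y t \<omega>) =
           coord i (Y 0 \<omega>) + integral {0..t} (\<lambda>s. coord i (payoff_vec u1 u2 (X s \<omega>))) + Z t \<omega>)) \<and>
     (\<forall>t\<ge>0. \<forall>\<omega>\<in>space M. X t \<omega> =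
        (choice_map h1 (\<eta>1 t *\<^sub>R fst (Y t \<omega>)), choice_map h2 (\<eta>2 t *\<^sub>R snd (Y t \<omega>))))"

definition time_average :: "(real \<Rightarrow> 'v::euclidean_space) \<Rightarrow> real \<Rightarrow> 'v" where
  "time_average x t = (1 / t) *\<^sub>R integral {0..t} x"

definition omega_limit_set :: "(real \<Rightarrow> 'v::topological_space) \<Rightarrow> 'v set" where
  "omega_limit_set x = (\<Inter>t\<in>{0<..}. closure (x ` {t..}))"

section \<open>Best response dynamics and internal chain transitivity\<close>

definition best_responses ::
    "('a::finite \<times> 'b::finite \<Rightarrow> real) \<Rightarrow> ('a \<times> 'b \<Rightarrow> real)
      \<Rightarrow> ('a, 'b) profile \<Rightarrow> ('a, 'b) profile set" where
  "best_responses u1 u2 x =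
     {x1. is_arg_max (\<lambda>x'. fst (payoff_vec u1 u2 x) \<bullet> x') (\<lambda>x'. x' \<in> mixed) x1} \<times>
     {x2. is_arg_max (\<lambda>x'. snd (payoff_vec u1 u2 x) \<bullet> x') (\<lambda>x'. x' \<in> mixed) x2}"

text \<open>The elements of a division are compact intervals with disjoint interiors.\<close>

definition abs_continuous_on :: "real set \<Rightarrow> (real \<Rightarrow> 'v::real_normed_vector) \<Rightarrow> bool" where
  "abs_continuous_on I x \<longleftrightarrow>
     (\<forall>\<epsilon>>0. \<exists>\<delta>>0. \<forall>D S. D division_of S \<and> S \<subseteq> I \<and> (\<Sum>K\<in>D. Sup K - Inf K) < \<delta> \<longrightarrow>
        (\<Sum>K\<in>D. norm (x (Sup K) - x (Inf K))) < \<epsilon>)"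

text \<open>
  Solutions are curves \<open>[0,\<infinity>) \<rightarrow> profiles\<close>, absolutely continuous on compact intervals.
\<close>

definition brd_solution ::
    "('a::finite \<times> 'b::finite \<Rightarrow> real) \<Rightarrow> ('a \<times> 'b \<Rightarrow> real) \<Rightarrow> (real \<Rightarrow> ('a, 'b) profile) \<Rightarrow> bool"
  where
  "brd_solution u1 u2 x \<longleftrightarrow>
     (\<forall>t\<ge>0. x t \<in> profiles) \<and>
     (\<forall>T\<ge>0. abs_continuous_on {0..T} x) \<and>
     (AE t in lborel. 0 \<le> t \<longrightarrow>
        (\<exists>d. (x has_vector_derivative d) (at t) \<and>
             d \<in> (\<lambda>b. b - x t) ` best_responses u1 u2 (x t)))"

definition internally_chain_transitive ::
    "('a::finite \<times> 'b::finite \<Rightarrow> real) \<Rightarrow> ('a \<times> 'b \<Rightarrow> real) \<Rightarrow> ('a, 'b) profile set \<Rightarrow> bool" where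
  "internally_chain_transitive u1 u2 L \<longleftrightarrow>
     compact L \<and> L \<subseteq> profiles \<and>
     (\<forall>x\<in>L. \<forall>y\<in>L. \<forall>\<epsilon>>0. \<forall>T>0.
        \<exists>(n::nat) (c :: nat \<Rightarrow> real \<Rightarrow> ('a, 'b) profile) (t :: nat \<Rightarrow> real).
          n \<ge> 1 \<and>
          (\<forall>i\<in>{1..n}. brd_solution u1 u2 (c i) \<and> t i > T \<and> (\<forall>s\<in>{0..t i}. c i s \<in> L)) \<and>
          (\<forall>i\<in>{1..<n}. norm (c i (t i) - c (Suc i) 0) \<le> \<epsilon>) \<and>
          norm (c 1 0 - x) \<le> \<epsilon> \<and> norm (c n (t n) - y) \<le> \<epsilon>)"

end

(*
  The Ito integrals in the scores Y have bounded integrands, so Kolmogorov's maximal inequality on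
  dyadic grids and the Borel-Cantelli lemma show that they are o(t) almost surely. The payoffs of a
  player are linear in the opponent's strategy, hence Y(t) / t = v(xbar(t)) + o(1). As t * eta(t) tends
  to infinity, the penalty becomes negligible and X(t) is an eps(t)-best response to xbar(t) with
  eps(t) -> 0. In logarithmic time the average z(s) = xbar(exp s) satisfies z' = X(exp s) - z, a
  vanishing perturbation of (BRD).

  Limits of translates of z are Lipschitz, hence differentiable almost everywhere, and at each point
  of differentiability their velocity satisfies the best response inclusion. They take all their
  values in the limit set. So by compactness z is shadowed, uniformly over windows of fixed length
  far out in time, by solutions of (BRD) inside the limit set; cutting z into windows of equal length
  between visits close to x and to y gives the required chain.
*)

theory Submission
  imports Defs "HOL-Complex_Analysis.Great_Picard"
begin

section \<open>Lipschitz functions of a real variable are differentiable almost everywhere\<close>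

text \<open>A solution of (BRD) must have a genuine derivative at almost every time, while a limit
  of translates comes only with a Lipschitz constant. Differentiability almost everywhere is
  obtained by continuous induction along an interval: a measure is compared with the increment of a
  function through arbitrarily small steps, which replaces a covering argument.

  The integral processes are tied to elementary integrals only by mean square limits at fixed times,
  over a filtration that need not be complete. The maximal inequality is therefore proved for
  elementary integrals at finitely many times, passed to the limit there, and extended to all times
  by path continuity. Second moments up to time T are of order T, so exceeding a level proportional
  to T has probability of order 1/T, which is summable along powers of two.

  Strong convexity of the penalties makes the choice maps continuous. The strategies are then
  continuous in time, the curve z is differentiable at every logarithmic time, and its difference
  quotients can be handled by the mean value theorem.\<close>

lemma le_of_right_steps:
  fixes f :: "real \<Rightarrow> real"
  assumes "c \<le> d" and cont: "continuous_on {c..d} f"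
    and step: "\<And>x \<delta>. c \<le> x \<Longrightarrow> x < d \<Longrightarrow> 0 < \<delta> \<Longrightarrow> \<exists>h. 0 < h \<and> h < \<delta> \<and> f x \<le> f (x + h)"
  shows "f c \<le> f d"
proof -
  \<comment> \<open>Continuous induction: \<open>S\<close> is closed, so it contains its supremum,
    and a right step from a supremum below \<open>d\<close> would produce a larger element.\<close>
  define S where "S = {t \<in> {c..d}. f c \<le> f t}"
  have "closed S" unfolding S_def
    by (intro continuous_closed_preimage_constant continuous_on_closed_Collect_le cont) auto
  moreover have "S \<noteq> {}" "bdd_above S" using assms(1) by (auto simp: S_def)
  ultimately have m: "Sup S \<in> S" by (rule closed_contains_Sup[rotated 2])
  show ?thesis
  proof (cases "Sup S = d")
    case True then show ?thesis using m by (auto simp: S_def)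
  next
    case False
    then have "c \<le> Sup S" "Sup S < d" using m by (auto simp: S_def)
    from step[OF this, of "d - Sup S"] this obtain h where h: "0 < h" "h < d - Sup S" "f (Sup S) \<le> f (Sup S + h)"
      by auto
    then have "Sup S + h \<in> S" using m by (auto simp: S_def)
    then have "Sup S + h \<le> Sup S" by (rule cSup_upper) fact
    then show ?thesis using h by simp
  qed
qed

text \<open>Left steps become right steps for the reflected function
  \<open>x \<mapsto> - f (- x)\<close>. Slopes over intervals to the left of a point
  (\<open>s = -1\<close>) call for this version.\<close>

lemma le_of_left_steps:
  fixes f :: "real \<Rightarrow> real"
  assumes "c \<le> d" and cont: "continuous_on {c..d} f"
    and step: "\<And>x \<delta>. c < x \<Longrightarrow> x \<le> d \<Longrightarrow> 0 < \<delta> \<Longrightarrow> \<exists>h. 0 < h \<and> h < \<delta> \<and> f (x - h) \<le> f x"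
  shows "f c \<le> f d"
proof -
  have "- f (- (- d)) \<le> - f (- (- c))"
  proof (rule le_of_right_steps[where f = "\<lambda>x. - f (- x)"])
    show "continuous_on {- d..- c} (\<lambda>x. - f (- x))"
      by (rule continuous_on_minus, rule continuous_on_compose2[OF cont])
        (auto intro!: continuous_intros)
    show "\<exists>h>0. h < \<delta> \<and> - f (- x) \<le> - f (- (x + h))" if x: "- d \<le> x" "x < - c" "0 < \<delta>" for x \<delta>
    proof -
      obtain h where "0 < h" "h < \<delta>" "f (- x - h) \<le> f (- x)" using step[of "- x" \<delta>] x by auto
      moreover have "- (x + h) = - x - h" by simp
      ultimately show ?thesis by (intro exI[of _ h]) (simp only: neg_le_iff_le simp_thms)
    qed
  qed (use assms in auto)
  then show ?thesis by simp
qed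

text \<open>For \<open>s = 1\<close> (\<open>s = -1\<close>) some difference quotients of \<open>f\<close> over arbitrarily short intervals to the
  right (left) of \<open>x\<close> exceed \<open>q\<close>. Quotients below \<open>p\<close> are quotients of \<open>- f\<close> above \<open>- p\<close>.\<close>

definition upper_slope :: "real \<Rightarrow> (real \<Rightarrow> real) \<Rightarrow> real \<Rightarrow> real \<Rightarrow> bool" where
  "upper_slope s f q x \<longleftrightarrow> (\<forall>\<delta>>0. \<exists>h. 0 < h \<and> h < \<delta> \<and> q * h < s * (f (x + s * h) - f x))"

section \<open>Measure of a set up to a moving endpoint, compared with the growth of a
  function\<close>

lemma emeasure_interval_finite:
  fixes a b :: real
  shows "emeasure lborel {a..b} < \<infinity>" "emeasure lborel {a<..b} < \<infinity>"
  by (cases "a \<le> b"; simp)+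

lemma measure_Int_diff:
  fixes A :: "real set"
  assumes "A \<in> sets borel" "a \<le> x" "x \<le> y"
  shows "measure lborel (A \<inter> {a..y}) - measure lborel (A \<inter> {a..x}) = measure lborel (A \<inter> {x<..y})"
proof -
  have [measurable]: "A \<in> sets borel" by fact
  have fin: "emeasure lborel (A \<inter> {b..c}) \<noteq> \<infinity>" for b c
  proof -
    have "emeasure lborel (A \<inter> {b..c}) \<le> emeasure lborel {b..c}" by (intro emeasure_mono) auto
    also have "\<dots> < \<infinity>" by (rule emeasure_interval_finite)
    finally show ?thesis by simp
  qed
  have "A \<inter> {x<..y} = (A \<inter> {a..y}) - (A \<inter> {a..x})" using assms by auto
  moreover have "measure lborel ((A \<inter> {a..y}) - (A \<inter> {a..x})) = measure lborel (A \<inter> {a..y}) - measure lborel (A \<inter> {a..x})"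
    by (rule measure_Diff[OF fin]) (use assms in auto)
  ultimately show ?thesis by simp
qed

lemma measure_Int_le:
  fixes A :: "real set"
  assumes "A \<in> sets borel" "x \<le> y"
  shows "measure lborel (A \<inter> {x<..y}) \<le> y - x"
proof -
  have "measure lborel (A \<inter> {x<..y}) \<le> measure lborel {x<..y}"
    by (rule measure_mono_fmeasurable)
      (use assms emeasure_interval_finite in \<open>auto simp: fmeasurable_def\<close>)
  then show ?thesis using assms by simp
qed

lemma continuous_measure_Int:
  fixes A :: "real set"
  assumes [measurable]: "A \<in> sets borel"
  shows "continuous_on {a..b} (\<lambda>x. measure lborel (A \<inter> {a..x}))"
proof -
  have "1-lipschitz_on {a..b} (\<lambda>x. measure lborel (A \<inter> {a..x}))"
  proof (rule lipschitz_onI)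
    fix x y assume "x \<in> {a..b}" "y \<in> {a..b}"
    then show "dist (measure lborel (A \<inter> {a..x})) (measure lborel (A \<inter> {a..y})) \<le> 1 * dist x y"
    proof (induction x y rule: linorder_wlog)
      case (le x y)
      have "measure lborel (A \<inter> {a..y}) - measure lborel (A \<inter> {a..x}) = measure lborel (A \<inter> {x<..y})"
        by (rule measure_Int_diff) (use le in auto)
      moreover have "measure lborel (A \<inter> {x<..y}) \<le> y - x"
        by (rule measure_Int_le) (use le in auto)
      moreover have "0 \<le> measure lborel (A \<inter> {x<..y})" by simp
      moreover have "1 * dist x y = y - x" using le by (simp add: dist_real_def)
      ultimately show ?case unfolding dist_real_def by linarith
    qed (simp add: dist_commute)
  qed simp
  then show ?thesis by (rule lipschitz_on_continuous_on)
qed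

text \<open>The function \<open>\<psi> x = f x - q * measure lborel (K \<inter> {c..x})\<close>
  admits nondecreasing steps everywhere. At a point of \<open>K\<close> some short step raises
  \<open>f\<close> by more than \<open>q * h\<close> and the measure by at most \<open>h\<close>;
  off \<open>K\<close>, which is closed, short intervals miss \<open>K\<close> and monotonicity of
  \<open>f\<close> suffices.\<close>

lemma slope_measure_le:
  fixes f :: "real \<Rightarrow> real"
  assumes "mono f" and cont: "continuous_on UNIV f" and K: "compact K" and q: "0 \<le> q"
    and s: "s = 1 \<or> s = -1" and up: "\<And>x. x \<in> K \<Longrightarrow> upper_slope s f q x" and "c \<le> d"
  shows "q * measure lborel (K \<inter> {c..d}) \<le> f d - f c"
proof -
  have [measurable]: "K \<in> sets borel" using K by (simp add: borel_compact)
  define \<psi> where "\<psi> x = f x - q * measure lborel (K \<inter> {c..x})" for x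
  have cont: "continuous_on {c..d} \<psi>" unfolding \<psi>_def
    by (intro continuous_intros continuous_measure_Int continuous_on_subset[OF cont]) auto
  have diff: "\<psi> y - \<psi> x = (f y - f x) - q * measure lborel (K \<inter> {x<..y})" if "c \<le> x" "x \<le> y" for x y
    using measure_Int_diff[of K c x y] that by (simp add: \<psi>_def algebra_simps)
  have away: "\<exists>h. 0 < h \<and> h < \<delta> \<and> K \<inter> {x - h .. x + h} = {}" if "x \<notin> K" "0 < \<delta>" for x \<delta>
  proof -
    have "x \<in> - K" "open (- K)" using K compact_imp_closed that by auto
    then obtain r where r: "r > 0" "cball x r \<subseteq> - K" unfolding open_contains_cball by blast
    show ?thesis
    proof (intro exI[of _ "min r (\<delta>/2)"] conjI)
      have "{x - min r (\<delta>/2)..x + min r (\<delta>/2)} \<subseteq> cball x r"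
        by (auto simp: cball_eq_atLeastAtMost)
      then show "K \<inter> {x - min r (\<delta>/2)..x + min r (\<delta>/2)} = {}" using r by blast
    qed (use r that in auto)
  qed
  have inK: "q * measure lborel (K \<inter> {x<..x+h}) \<le> q * h" if "0 < h" for x h
    using measure_Int_le[of K x "x + h"] that q by (intro mult_left_mono) auto
  have "\<psi> c \<le> \<psi> d"
    using s
  proof
    assume s1: "s = 1"
    show ?thesis
    proof (rule le_of_right_steps[OF \<open>c \<le> d\<close> cont])
      fix x \<delta> :: real assume x: "c \<le> x" "x < d" "0 < \<delta>"
      show "\<exists>h>0. h < \<delta> \<and> \<psi> x \<le> \<psi> (x + h)"
      proof (cases "x \<in> K")
        case True
        then obtain h where h: "0 < h" "h < \<delta>" "q * h < f (x + h) - f x"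
          using up[OF True] x s1 by (auto simp: upper_slope_def)
        then have "\<psi> x \<le> \<psi> (x + h)" using diff[of x "x + h"] inK[of h x] x by auto
        then show ?thesis using h by auto
      next
        case False
        then obtain h where h: "0 < h" "h < \<delta>" "K \<inter> {x - h .. x + h} = {}" using away x by blast
        then have "K \<inter> {x<..x + h} = {}" by auto
        moreover have "f x \<le> f (x + h)" using \<open>mono f\<close> h by (simp add: monoD)
        ultimately have "\<psi> x \<le> \<psi> (x + h)" using diff[of x "x + h"] x h by auto
        then show ?thesis using h by auto
      qed
    qed
  next
    assume s1: "s = -1"
    show ?thesis
    proof (rule le_of_left_steps[OF \<open>c \<le> d\<close> cont])
      fix x \<delta> :: real assume x: "c < x" "x \<le> d" "0 < \<delta>"
      show "\<exists>h>0. h < \<delta> \<and> \<psi> (x - h) \<le> \<psi> x"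
      proof (cases "x \<in> K")
        case True
        \<comment> \<open>The step is kept shorter than \<open>x - c\<close> because
          \<open>diff\<close> compares only points that are not left of \<open>c\<close>.\<close>
        then obtain h where h: "0 < h" "h < min \<delta> (x - c)" "q * h < f x - f (x - h)"
          using up[OF True, unfolded upper_slope_def, rule_format, of "min \<delta> (x - c)"] x s1 by auto
        then have "\<psi> (x - h) \<le> \<psi> x" using diff[of "x - h" x] inK[of h "x - h"] x by auto
        then show ?thesis using h by auto
      next
        case False
        then obtain h where h: "0 < h" "h < min \<delta> (x - c)" "K \<inter> {x - h .. x + h} = {}"
          using away[of x "min \<delta> (x - c)"] x by auto
        then have "K \<inter> {x - h<..x} = {}" by auto
        moreover have "f (x - h) \<le> f x" using \<open>mono f\<close> h by (simp add: monoD)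
        ultimately have "\<psi> (x - h) \<le> \<psi> x" using diff[of "x - h" x] x h by auto
        then show ?thesis using h by auto
      qed
    qed
  qed
  moreover have "measure lborel (K \<inter> {c}) = 0"
    by (cases "c \<in> K") auto
  ultimately show ?thesis by (simp add: \<psi>_def)
qed

text \<open>A density argument in integrated form. By outer regularity an open \<open>V\<close>
  exceeds \<open>K\<close> by arbitrarily little, and \<open>main\<close> bounds the measure of
  \<open>K\<close> by \<open>\<theta>\<close> times that of \<open>V\<close> inside
  \<open>{-r..r}\<close>. Hence the measure of \<open>K\<close> is at most
  \<open>\<theta> < 1\<close> times itself.\<close>

lemma measure_zero_if_uniformly_sparse:
  fixes K :: "real set"
  assumes K: "compact K" and \<theta>: "0 \<le> \<theta>" "\<theta> < 1"
    and sparse: "\<And>c d. c \<le> d \<Longrightarrow> measure lborel (K \<inter> {c..d}) \<le> \<theta> * (d - c)"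
  shows "emeasure lborel K = 0"
proof -
  have [measurable]: "K \<in> sets borel" using K by (simp add: borel_compact)
  obtain r where r: "r > 0" "K \<subseteq> {- r..r}"
    using K compact_imp_bounded bounded_pos by (force simp: abs_le_iff)
  have fin: "emeasure lborel (A \<inter> {-r..r}) < \<infinity>" for A
  proof -
    have "emeasure lborel (A \<inter> {-r..r}) \<le> emeasure lborel {-r..r}" by (intro emeasure_mono) auto
    also have "\<dots> < \<infinity>" by (rule emeasure_interval_finite)
    finally show ?thesis .
  qed
  have Kfin: "emeasure lborel K < \<infinity>" using fin[of K] r by (simp add: Int_absorb2)
  have main: "measure lborel K \<le> \<theta> * measure lborel (V \<inter> {-r..r})" if V: "open V" "K \<subseteq> V" for V
  proof -
    have [measurable]: "V \<in> sets borel" using V by simp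
    \<comment> \<open>Steps for this \<open>\<psi>\<close>: around a point of \<open>V\<close> a
      short interval lies inside \<open>V\<close> and \<open>sparse\<close> applies to it; around a
      point outside \<open>V\<close> a short interval misses \<open>K\<close>, which is closed and
      contained in \<open>V\<close>.\<close>
    define \<psi> where "\<psi> x = \<theta> * measure lborel (V \<inter> {-r..x}) - measure lborel (K \<inter> {-r..x})" for x
    have "\<psi> (-r) \<le> \<psi> r"
    proof (rule le_of_right_steps[of "-r" r \<psi>])
      show "continuous_on {-r..r} \<psi>" unfolding \<psi>_def
        by (intro continuous_intros continuous_measure_Int) auto
      fix x \<delta> :: real assume x: "- r \<le> x" "x < r" "0 < \<delta>"
      have diff: "\<psi> y - \<psi> x = \<theta> * measure lborel (V \<inter> {x<..y}) - measure lborel (K \<inter> {x<..y})" if "x \<le> y" for y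
        using measure_Int_diff[of K "-r" x y] measure_Int_diff[of V "-r" x y] that x
        by (simp add: \<psi>_def algebra_simps)
      have "\<exists>e>0. {x - e .. x + e} \<subseteq> V \<or> K \<inter> {x - e .. x + e} = {}"
      proof (cases "x \<in> V")
        case True
        then show ?thesis using V open_contains_cball[of V] by (auto simp: cball_eq_atLeastAtMost)
      next
        case False
        then have "x \<in> - K" "open (- K)" using V K compact_imp_closed by auto
        then obtain e where "e > 0" "cball x e \<subseteq> - K" unfolding open_contains_cball by blast
        then show ?thesis by (auto simp: cball_eq_atLeastAtMost)
      qed
      then obtain e where e: "e > 0" "{x - e .. x + e} \<subseteq> V \<or> K \<inter> {x - e .. x + e} = {}" by blast
      define h where "h = min e (\<delta> / 2)"
      have h: "0 < h" "h < \<delta>" "h \<le> e" using e x by (auto simp: h_def)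
      have "measure lborel (K \<inter> {x<..x+h}) \<le> \<theta> * measure lborel (V \<inter> {x<..x+h})"
        using e(2)
      proof
        assume "{x - e .. x + e} \<subseteq> V"
        then have "V \<inter> {x<..x+h} = {x<..x+h}" using h by auto
        moreover have "measure lborel (K \<inter> {x<..x+h}) \<le> measure lborel (K \<inter> {x..x+h})"
        proof (rule measure_mono_fmeasurable)
          have "emeasure lborel (K \<inter> {x..x+h}) \<le> emeasure lborel {x..x+h}" by (intro emeasure_mono) auto
          also have "\<dots> < \<infinity>" by (rule emeasure_interval_finite)
          finally show "K \<inter> {x..x+h} \<in> fmeasurable lborel" by (simp add: fmeasurable_def)
        qed auto
        moreover have "measure lborel (K \<inter> {x..x+h}) \<le> \<theta> * h" using sparse[of x "x + h"] h by simp
        ultimately show ?thesis using h by simp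
      next
        assume "K \<inter> {x - e .. x + e} = {}"
        then have "K \<inter> {x<..x+h} = {}" using h by auto
        then show ?thesis using \<theta> by simp
      qed
      then have "\<psi> x \<le> \<psi> (x + h)" using diff[of "x + h"] h by simp
      then show "\<exists>h>0. h < \<delta> \<and> \<psi> x \<le> \<psi> (x + h)" using h by blast
    qed (use r in simp)
    moreover have "measure lborel (A \<inter> {-r}) = 0" for A
      by (cases "-r \<in> A") auto
    ultimately show ?thesis using r by (simp add: \<psi>_def Int_absorb2)
  qed
  have "measure lborel K \<le> \<theta> * measure lborel K + e" if e: "e > 0" for e
  proof -
    obtain V where V: "open V" "K \<subseteq> V" "emeasure lborel (V - K) \<le> ennreal e"
      by (rule outer_regular_lborel_le[of K e]) (use e in auto)
    have [measurable]: "V \<in> sets borel" using V by simp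
    have "V \<inter> {-r..r} = K \<union> ((V - K) \<inter> {-r..r})" using V r by auto
    then have "measure lborel (V \<inter> {-r..r}) \<le> measure lborel K + measure lborel ((V - K) \<inter> {-r..r})"
      using measure_Un_le[of K lborel "(V - K) \<inter> {-r..r}"] by simp
    moreover have "measure lborel ((V - K) \<inter> {-r..r}) \<le> e"
    proof -
      have "emeasure lborel ((V - K) \<inter> {-r..r}) \<le> emeasure lborel (V - K)" by (intro emeasure_mono) auto
      then have "emeasure lborel ((V - K) \<inter> {-r..r}) \<le> ennreal e" using V by simp
      then show ?thesis using that by (simp add: measure_def enn2real_leI)
    qed
    ultimately have "\<theta> * measure lborel (V \<inter> {-r..r}) \<le> \<theta> * (measure lborel K + e)"
      using \<theta> by (intro mult_left_mono) auto
    also have "\<dots> \<le> \<theta> * measure lborel K + e"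
      using \<theta> that by (simp add: distrib_left mult_left_le_one_le)
    finally show ?thesis using main[OF V(1,2)] by simp
  qed
  then have "measure lborel K \<le> \<theta> * measure lborel K" by (rule field_le_epsilon)
  then have "(1 - \<theta>) * measure lborel K \<le> 0" by (simp add: algebra_simps)
  then have "measure lborel K = 0" using \<theta> by (simp add: mult_le_0_iff measure_le_0_iff)
  then show ?thesis using Kfin by (simp add: emeasure_eq_ennreal_measure)
qed
text \<open>A quotient exceeding \<open>q\<close> is itself at most \<open>L\<close>. Applied to
  \<open>f\<close> and to \<open>- f\<close>, this gives \<open>q < L\<close> and
  \<open>- p < L\<close>, which together with \<open>p < q\<close> makes the rates
  \<open>L + q\<close> and \<open>L - p\<close> nonnegative.\<close>

lemma slope_bounds:
  fixes f :: "real \<Rightarrow> real"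
  assumes L: "L-lipschitz_on UNIV f" and s: "s = 1 \<or> s = -1" and u: "upper_slope s f q x"
  shows "q < L"
proof -
  obtain h where h: "0 < h" "h < 1" "q * h < s * (f (x + s * h) - f x)"
    using u by (auto simp: upper_slope_def dest!: spec[of _ 1])
  have "s * (f (x + s * h) - f x) \<le> \<bar>f (x + s * h) - f x\<bar>" using s by auto
  also have "\<dots> \<le> L * \<bar>s * h\<bar>"
    using lipschitz_onD[OF L, of "x + s * h" x] by (simp add: dist_real_def)
  also have "\<bar>s * h\<bar> = h" using s h by auto
  finally have "q * h < L * h" using h by linarith
  then show ?thesis using h by (simp add: mult_less_cancel_right)
qed

text \<open>The growth estimate is for monotone functions and nonnegative rates; adding
  \<open>L * x\<close> provides both at the cost of shifting every slope by
  \<open>L\<close>.\<close>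

lemma mono_add_lipschitz:
  fixes f :: "real \<Rightarrow> real"
  assumes L: "L-lipschitz_on UNIV f"
  shows "mono (\<lambda>x. L * x + f x)"
proof (rule monoI)
  fix x y :: real assume "x \<le> y"
  then have "\<bar>f x - f y\<bar> \<le> L * (y - x)"
    using lipschitz_onD[OF L, of x y] by (simp add: dist_real_def)
  then show "L * x + f x \<le> L * y + f y" by (simp add: algebra_simps abs_le_iff)
qed

lemma upper_slope_add_linear:
  assumes "s = 1 \<or> s = -1" "upper_slope s f q x"
  shows "upper_slope s (\<lambda>x. L * x + f x) (L + q) x"
proof -
  have "(q * h < s * (f (x + s * h) - f x)) = ((L + q) * h < s * (L * (x + s * h) + f (x + s * h) - (L * x + f x)))" for h
    using assms(1) by (auto simp: algebra_simps)
  then show ?thesis using assms(2) unfolding upper_slope_def by simp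
qed

text \<open>For fixed \<open>h\<close> the inequality is an open condition on \<open>x\<close>, so
  allowing every positive \<open>h\<close> below \<open>1 / real (Suc n)\<close> gives an open set,
  although the union is uncountable. The set in question is the intersection of these over
  \<open>n\<close>.\<close>

lemma measurable_upper_slope:
  fixes f :: "real \<Rightarrow> real"
  assumes "continuous_on UNIV f"
  shows "Measurable.pred borel (upper_slope s f q)"
proof -
  have "upper_slope s f q x \<longleftrightarrow> (\<forall>n. x \<in> (\<Union>h\<in>{0<..<1 / real (Suc n)}. {x. q * h < s * (f (x + s * h) - f x)}))" for x
  proof
    assume "upper_slope s f q x"
    then show "\<forall>n. x \<in> (\<Union>h\<in>{0<..<1 / real (Suc n)}. {x. q * h < s * (f (x + s * h) - f x)})"
      unfolding upper_slope_def by (force dest: spec[of _ "1 / real (Suc _)"])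
  next
    assume R: "\<forall>n. x \<in> (\<Union>h\<in>{0<..<1 / real (Suc n)}. {x. q * h < s * (f (x + s * h) - f x)})"
    show "upper_slope s f q x" unfolding upper_slope_def
    proof (intro allI impI)
      fix \<delta> :: real assume "0 < \<delta>"
      then obtain n where "1 / real (Suc n) < \<delta>" using nat_approx_posE by auto
      moreover obtain h where "h\<in>{0<..<1 / real (Suc n)}" "q * h < s * (f (x + s * h) - f x)"
        using R by blast
      ultimately show "\<exists>h. 0 < h \<and> h < \<delta> \<and> q * h < s * (f (x + s * h) - f x)" by force
    qed
  qed
  then have "upper_slope s f q = (\<lambda>x. \<forall>n. x \<in> (\<Union>h\<in>{0<..<1 / real (Suc n)}. {x. q * h < s * (f (x + s * h) - f x)}))"
    by (rule ext)
  moreover have [measurable]: "(\<Union>h\<in>I. {x. q * h < s * (f (x + s * h) - f x)}) \<in> sets borel" for I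
    by (intro borel_open open_UN ballI open_Collect_less continuous_intros continuous_on_compose2[OF assms]) auto
  ultimately show ?thesis by (simp only:) measurable
qed

text \<open>On a compact set \<open>K\<close> of such points, \<open>L x + f x\<close> grows at rate \<open>L + q\<close> and \<open>L x - f x\<close> at rate
  \<open>L - p\<close>. As both together grow at rate \<open>2 L\<close>, the density of \<open>K\<close> in every interval is at most
  \<open>2 L / (2 L + q - p) < 1\<close>, which forces \<open>K\<close> to be null.\<close>

lemma null_slope_gap:
  fixes f :: "real \<Rightarrow> real"
  assumes L: "L-lipschitz_on UNIV f" and s: "s = 1 \<or> s = -1" "s' = 1 \<or> s' = -1" and pq: "p < q"
  shows "AE x in lborel. \<not> (upper_slope s f q x \<and> upper_slope s' (\<lambda>x. - f x) (- p) x)"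
proof -
  define E where "E = {x. upper_slope s f q x \<and> upper_slope s' (\<lambda>x. - f x) (- p) x}"
  have L': "L-lipschitz_on UNIV (\<lambda>x. - f x)" using L by (simp add: lipschitz_on_def)
  note cont = lipschitz_on_continuous_on[OF L]
  have [measurable]: "Measurable.pred borel (upper_slope s f q)"
     "Measurable.pred borel (upper_slope s' (\<lambda>x. - f x) (- p))"
    by (intro measurable_upper_slope continuous_intros cont)+
  have E[measurable]: "E \<in> sets borel" unfolding E_def by measurable
  have compact_null: "emeasure lborel K = 0" if K: "compact K" "K \<subseteq> E" for K
  proof (cases "K = {}")
    case False
    then obtain x where "x \<in> E" using K by auto
    then have b: "q < L" "- p < L"
      using slope_bounds[OF L s(1)] slope_bounds[OF L' s(2)] by (auto simp: E_def)
    show ?thesis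
    proof (rule measure_zero_if_uniformly_sparse[OF K(1)])
      show "0 \<le> 2 * L / (2 * L + (q - p))" "2 * L / (2 * L + (q - p)) < 1"
        using b pq by (auto simp: field_simps)
      fix c d :: real assume cd: "c \<le> d"
      let ?m = "measure lborel (K \<inter> {c..d})"
      have "(L + q) * ?m \<le> (L * d + f d) - (L * c + f c)"
        by (rule slope_measure_le[OF mono_add_lipschitz[OF L] _ K(1) _ s(1) _ cd])
          (use K b pq s in \<open>auto simp: E_def intro!: upper_slope_add_linear continuous_intros cont\<close>)
      moreover have "(L + - p) * ?m \<le> (L * d + - f d) - (L * c + - f c)"
        by (rule slope_measure_le[OF mono_add_lipschitz[OF L'] _ K(1) _ s(2) _ cd])
          (use K b pq s in \<open>auto simp: E_def simp del: add_uminus_conv_diff intro!: upper_slope_add_linear continuous_intros cont\<close>)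
      ultimately have "(2 * L + (q - p)) * ?m \<le> 2 * L * (d - c)" by (simp add: algebra_simps)
      then show "?m \<le> 2 * L / (2 * L + (q - p)) * (d - c)"
        using b pq by (simp add: pos_le_divide_eq mult.commute)
    qed
  qed simp
  have "emeasure lborel E \<le> 0"
  proof (rule ennreal_le_epsilon)
    fix e :: real assume "0 < e"
    \<comment> \<open>Only compact subsets have been treated so far; inner regularity by closed
      sets, exhausted by balls, carries the conclusion to the Borel set \<open>E\<close>.\<close>
    obtain T where T: "closed T" "T \<subseteq> E" "emeasure lebesgue (E - T) < ennreal e"
      by (rule sets_lebesgue_inner_closed[of E e]) (use \<open>0 < e\<close> in auto)
    have [measurable]: "T \<in> sets borel" using T by simp
    have "T = (\<Union>n. T \<inter> cball 0 (real n))"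
      by (auto simp: real_arch_simple)
    moreover have "(\<Union>n. T \<inter> cball 0 (real n)) \<in> null_sets lborel"
      by (rule null_sets_UN) (use T in \<open>auto intro!: null_setsI compact_null closed_Int_compact\<close>)
    ultimately have "emeasure lborel T = 0" by auto
    moreover have "emeasure lborel E = emeasure lborel T + emeasure lborel (E - T)"
      using T by (subst plus_emeasure) (auto simp: Un_absorb1)
    ultimately show "emeasure lborel E \<le> 0 + ennreal e" using T by simp
  qed
  then have "E \<in> null_sets lborel" by (intro null_setsI) auto
  then show ?thesis by (rule AE_I') (auto simp: E_def)
qed

text \<open>What happens frequently on both sides together happens frequently on one of them. For
  \<open>y = x - h\<close> numerator and denominator both change sign, which accounts for the factor
  \<open>s\<close> in \<open>upper_slope\<close>.\<close>

lemma upper_slope_frequently: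
  assumes fr: "\<exists>\<^sub>F y in at x. q < (f y - f x) / (y - x)"
  shows "\<exists>s\<in>{1, -1}. upper_slope s f q x"
proof (rule ccontr)
  assume "\<not> ?thesis"
  then obtain a b where ab: "0 < a" "0 < b" "\<And>h. 0 < h \<Longrightarrow> h < a \<Longrightarrow> \<not> q * h < f (x + h) - f x"
    "\<And>h. 0 < h \<Longrightarrow> h < b \<Longrightarrow> \<not> q * h < f x - f (x - h)"
    by (auto simp: upper_slope_def)
  have "\<forall>\<^sub>F y in at x. dist y x < min a b"
    unfolding eventually_at by (rule exI[of _ "min a b"]) (use ab in auto)
  moreover have "\<forall>\<^sub>F y in at x. y \<noteq> x" by (simp add: eventually_at_filter)
  ultimately have "\<forall>\<^sub>F y in at x. \<not> q < (f y - f x) / (y - x)"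
  proof eventually_elim
    case (elim y)
    show ?case
    proof (cases "x < y")
      case True
      with ab(3)[of "y - x"] elim show ?thesis by (simp add: dist_real_def pos_less_divide_eq)
    next
      case False
      with ab(4)[of "x - y"] elim show ?thesis by (simp add: dist_real_def neg_less_divide_eq algebra_simps)
    qed
  qed
  then show False using fr by (simp add: frequently_def)
qed

text \<open>Off a null set no rational gap separates quotients that are frequently large from
  quotients that are frequently small: there are only countably many pairs of rationals and pairs of
  sides. Hence the lower and upper limits agree, and the Lipschitz bound makes the common value
  finite.\<close>

theorem lipschitz_AE_differentiable_real:
  fixes f :: "real \<Rightarrow> real"
  assumes L: "L-lipschitz_on UNIV f"
  shows "AE x in lborel. \<exists>D. (f has_real_derivative D) (at x)"
proof -
  have "AE x in lborel. \<forall>p\<in>\<rat>. \<forall>q\<in>\<rat>. \<forall>s\<in>{1,-1}. \<forall>s'\<in>{1,-1}. p < q \<longrightarrow>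
      \<not> (upper_slope s f q x \<and> upper_slope s' (\<lambda>x. - f x) (- p) x)"
    by (intro AE_ball_countable' AE_impI null_slope_gap[OF L] countable_rat) auto
  then show ?thesis
  proof (eventually_elim)
    fix x assume gap: "\<forall>p\<in>\<rat>. \<forall>q\<in>\<rat>. \<forall>s\<in>{1,-1}. \<forall>s'\<in>{1,-1}. p < q \<longrightarrow>
      \<not> (upper_slope s f q x \<and> upper_slope s' (\<lambda>x. - f x) (- p) x)"
    define Q where "Q y = (f y - f x) / (y - x)" for y
    have bnd: "\<bar>Q y\<bar> \<le> L" for y
    proof (cases "y = x")
      case False
      then show ?thesis using lipschitz_onD[OF L, of y x]
        by (simp add: Q_def dist_real_def abs_divide pos_divide_le_eq)
    qed (use lipschitz_on_nonneg[OF L] in \<open>simp add: Q_def\<close>)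
    \<comment> \<open>Two rationals are fitted between \<open>p\<close> and \<open>q\<close>:
      quotients frequently above \<open>q'\<close> exclude quotients frequently below
      \<open>p'\<close>, which is the eventual bound.\<close>
    have ev: "\<forall>\<^sub>F y in at x. p \<le> Q y" if fr: "\<exists>\<^sub>F y in at x. q < Q y" and "p < q" for p q
    proof -
      obtain q' where q': "q' \<in> \<rat>" "p < q'" "q' < q" using Rats_dense_in_real \<open>p < q\<close> by blast
      obtain p' where p': "p' \<in> \<rat>" "p < p'" "p' < q'" using Rats_dense_in_real \<open>p < q'\<close> by blast
      have "\<exists>\<^sub>F y in at x. q' < Q y" using fr by (rule frequently_elim1) (use q' in auto)
      then obtain s where s: "s \<in> {1,-1}" "upper_slope s f q' x"
        using upper_slope_frequently[of q' f x] unfolding Q_def by blast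
      then have "\<not> (\<exists>s'\<in>{1,-1}. upper_slope s' (\<lambda>x. - f x) (- p') x)"
        using gap p' q' by blast
      then have "\<not> (\<exists>\<^sub>F y in at x. - p' < (- f y - - f x) / (y - x))"
        using upper_slope_frequently[of "- p'" "\<lambda>x. - f x" x] by blast
      moreover have "(- f y - - f x) / (y - x) = - Q y" for y
        unfolding Q_def minus_divide_left by simp
      ultimately have "\<forall>\<^sub>F y in at x. p' \<le> Q y" by (simp add: frequently_def not_less)
      then show ?thesis by eventually_elim (use p' in auto)
    qed
    \<comment> \<open>\<open>Sup S\<close> is the upper limit of the quotients. By \<open>ev\<close>
      the quotients eventually stay above every number below it.\<close>
    define S where "S = {r. \<exists>\<^sub>F y in at x. r < Q y}"
    have ne: "at x \<noteq> bot" by simp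
    have "- L - 1 \<in> S" unfolding S_def mem_Collect_eq
      by (rule eventually_frequently[OF ne]) (rule always_eventually, use bnd in \<open>smt (verit)\<close>)
    have bdd: "bdd_above S"
    proof (rule bdd_aboveI[of _ L])
      fix r assume "r \<in> S"
      then obtain y where "r < Q y" by (auto simp: S_def dest: frequently_ex)
      then show "r \<le> L" using bnd[of y] by linarith
    qed
    have "(Q \<longlongrightarrow> Sup S) (at x)"
    proof (rule tendstoI)
      fix e :: real assume "0 < e"
      have "Sup S + e / 2 \<notin> S" using cSup_upper[OF _ bdd, of "Sup S + e/2"] \<open>0 < e\<close> by auto
      then have "\<forall>\<^sub>F y in at x. Q y \<le> Sup S + e / 2" by (simp add: S_def frequently_def not_less)
      moreover obtain r where r: "r \<in> S" "Sup S - e / 2 < r"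
        using less_cSupD[of S "Sup S - e/2"] \<open>- L - 1 \<in> S\<close> \<open>0 < e\<close> by auto
      then have "\<forall>\<^sub>F y in at x. Sup S - e / 2 \<le> Q y" by (intro ev[of r]) (auto simp: S_def)
      ultimately show "\<forall>\<^sub>F y in at x. dist (Q y) (Sup S) < e"
        by eventually_elim (use \<open>0 < e\<close> in \<open>auto simp: dist_real_def\<close>)
    qed
    then show "\<exists>D. (f has_real_derivative D) (at x)"
      unfolding has_field_derivative_iff Q_def by blast
  qed
qed

section \<open>Sublinear growth of Ito integrals with bounded integrands\<close>

text \<open>Each score carries its own scalar integral, so the noise is studied for a single
  process, and the finitely many almost sure statements are intersected at the end.\<close>

locale wiener = prob_space M for M :: "'w measure" +
  fixes F :: "real \<Rightarrow> 'w measure" and W :: "real \<Rightarrow> 'w \<Rightarrow> real"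
  assumes space_F: "space (F t) = space M"
    and sets_F: "sets (F t) \<subseteq> sets M"
    and sets_F_mono: "s \<le> t \<Longrightarrow> sets (F s) \<subseteq> sets (F t)"
    and W_adapted: "0 \<le> t \<Longrightarrow> W t \<in> borel_measurable (F t)"
    and W_normal: "0 \<le> s \<Longrightarrow> s < t \<Longrightarrow>
      distributed M lborel (\<lambda>\<omega>. W t \<omega> - W s \<omega>) (normal_density 0 (sqrt (t - s)))"
    and W_indep: "0 \<le> s \<Longrightarrow> s < t \<Longrightarrow>
      indep_set (sets (F s)) (sets (vimage_algebra (space M) (\<lambda>\<omega>. W t \<omega> - W s \<omega>) borel))"

text \<open>Independence of the past is given for the whole vector of increments. It descends to one
  component because the sigma-algebra generated by the component is contained in that generated by
  the vector.\<close>

lemma wiener_familyD: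
  assumes "filtered_prob_space M F" and "wiener_family M F W"
  shows "wiener M F (W i)"
proof -
  have ps: "prob_space M" using assms(1) by (simp add: filtered_prob_space_def)
  interpret prob_space M by (rule ps)
  interpret filtration "space M" F using assms(1) by (simp add: filtered_prob_space_def)
  show ?thesis
  proof
    fix s t :: real
    show "space (F t) = space M" by (rule space_F)
    show "sets (F t) \<subseteq> sets M" using assms(1) by (auto simp: filtered_prob_space_def subalgebra_def)
    show "s \<le> t \<Longrightarrow> sets (F s) \<subseteq> sets (F t)" by (rule sets_F_mono)
    show "0 \<le> t \<Longrightarrow> W i t \<in> borel_measurable (F t)"
      using assms(2) by (simp add: wiener_family_def adapted_def)
    assume st: "0 \<le> s" "s < t"
    show "distributed M lborel (\<lambda>\<omega>. W i t \<omega> - W i s \<omega>) (normal_density 0 (sqrt (t - s)))"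
      using assms(2) st by (simp add: wiener_family_def)
    let ?V = "\<lambda>\<omega>. \<lambda>i\<in>UNIV. W i t \<omega> - W i s \<omega>"
    let ?A = "vimage_algebra (space M) ?V (Pi\<^sub>M UNIV (\<lambda>_. borel))"
    have ind: "indep_set (sets (F s)) (sets ?A)"
      using assms(2) st by (simp add: wiener_family_def)
    have V: "?V \<in> ?A \<rightarrow>\<^sub>M Pi\<^sub>M UNIV (\<lambda>_. borel)"
      by (rule measurable_vimage_algebra1) (auto simp: space_PiM)
    have "(\<lambda>x. x i) \<circ> ?V \<in> ?A \<rightarrow>\<^sub>M borel"
      by (rule measurable_comp[OF V]) (rule measurable_component_singleton, simp)
    then have "(\<lambda>\<omega>. W i t \<omega> - W i s \<omega>) \<in> ?A \<rightarrow>\<^sub>M borel" by (simp add: comp_def)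
    then have "sets (vimage_algebra (space M) (\<lambda>\<omega>. W i t \<omega> - W i s \<omega>) borel) \<subseteq> sets ?A"
      by (auto simp: sets_vimage_algebra2 dest: measurable_sets)
    with ind show "indep_set (sets (F s)) (sets (vimage_algebra (space M) (\<lambda>\<omega>. W i t \<omega> - W i s \<omega>) borel))"
      unfolding indep_sets2_eq by blast
  qed
qed

context wiener
begin

lemma measurable_F:
  assumes "f \<in> F s \<rightarrow>\<^sub>M N" "s \<le> t"
  shows "f \<in> F t \<rightarrow>\<^sub>M N"
  using assms space_F sets_F_mono[of s t] by (auto simp: measurable_def)

lemma measurable_F_M:
  assumes "f \<in> F s \<rightarrow>\<^sub>M N"
  shows "f \<in> M \<rightarrow>\<^sub>M N"
  using assms space_F sets_F[of s] by (auto simp: measurable_def)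

lemma W_measurable: "0 \<le> t \<Longrightarrow> random_variable borel (W t)"
  by (rule measurable_F_M[OF W_adapted])

lemma increment_moments:
  assumes "0 \<le> s" "s \<le> t"
  shows "integrable M (\<lambda>\<omega>. W t \<omega> - W s \<omega>)" "expectation (\<lambda>\<omega>. W t \<omega> - W s \<omega>) = 0"
    "integrable M (\<lambda>\<omega>. (W t \<omega> - W s \<omega>)\<^sup>2)" "expectation (\<lambda>\<omega>. (W t \<omega> - W s \<omega>)\<^sup>2) = t - s"
proof -
  have "integrable M (\<lambda>\<omega>. W t \<omega> - W s \<omega>) \<and> expectation (\<lambda>\<omega>. W t \<omega> - W s \<omega>) = 0 \<and>
    integrable M (\<lambda>\<omega>. (W t \<omega> - W s \<omega>)\<^sup>2) \<and> expectation (\<lambda>\<omega>. (W t \<omega> - W s \<omega>)\<^sup>2) = t - s"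
  proof (cases "s = t")
    case False
    then have "0 < sqrt (t - s)" "s < t" using assms by auto
    note D = W_normal[OF assms(1) \<open>s < t\<close>]
    have int1: "integrable lborel (\<lambda>x. normal_density 0 (sqrt (t - s)) x * x)"
      using integrable_normal_moment[OF \<open>0 < sqrt (t - s)\<close>, of 0 1] by simp
    have int2: "integrable lborel (\<lambda>x. normal_density 0 (sqrt (t - s)) x * x\<^sup>2)"
      using integrable_normal_moment[OF \<open>0 < sqrt (t - s)\<close>, of 0 2] by simp
    have i1: "integrable M (\<lambda>\<omega>. W t \<omega> - W s \<omega>)"
      using int1 distributed_integrable[OF D, of "\<lambda>x. x"] by simp
    moreover have i2: "integrable M (\<lambda>\<omega>. (W t \<omega> - W s \<omega>)\<^sup>2)"
      using int2 distributed_integrable[OF D, of "\<lambda>x. x\<^sup>2"] by simp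
    moreover have e1: "expectation (\<lambda>\<omega>. W t \<omega> - W s \<omega>) = 0"
      by (rule normal_distributed_expectation[OF \<open>0 < sqrt (t - s)\<close> D])
    moreover have "expectation (\<lambda>\<omega>. (W t \<omega> - W s \<omega>)\<^sup>2) = t - s"
      using normal_distributed_variance[OF \<open>0 < sqrt (t - s)\<close> D] e1 \<open>s < t\<close> by simp
    ultimately show ?thesis by simp
  qed simp
  then show "integrable M (\<lambda>\<omega>. W t \<omega> - W s \<omega>)" "expectation (\<lambda>\<omega>. W t \<omega> - W s \<omega>) = 0"
    "integrable M (\<lambda>\<omega>. (W t \<omega> - W s \<omega>)\<^sup>2)" "expectation (\<lambda>\<omega>. (W t \<omega> - W s \<omega>)\<^sup>2) = t - s"
    by blast+
qed

text \<open>The map \<open>g\<close> lets one statement serve both the increment and its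
  square.\<close>

lemma indep_increment:
  assumes "0 \<le> s" "s < t" and Y: "Y \<in> borel_measurable (F s)" and g: "g \<in> borel_measurable borel"
  shows "indep_var borel Y borel (\<lambda>\<omega>. g (W t \<omega> - W s \<omega>) :: real)"
proof -
  have [measurable]: "random_variable borel (W t)" "random_variable borel (W s)" "random_variable borel Y"
    using assms W_measurable measurable_F_M by auto
  have A: "sigma_sets (space M) {Y -` A \<inter> space M |A. A \<in> sets borel} \<subseteq> sets (F s)"
    using Y space_F[of s] by (intro sets.sigma_sets_subset'[of _ "F s", unfolded space_F]) (auto dest: measurable_sets)
  let ?D = "\<lambda>\<omega>. W t \<omega> - W s \<omega>"
  let ?V = "vimage_algebra (space M) ?D borel"
  have "?D \<in> ?V \<rightarrow>\<^sub>M borel" by (rule measurable_vimage_algebra1) auto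
  then have "(\<lambda>\<omega>. g (?D \<omega>)) \<in> ?V \<rightarrow>\<^sub>M borel" using g by measurable
  then have B: "sigma_sets (space M) {(\<lambda>\<omega>. g (?D \<omega>)) -` A \<inter> space M |A. A \<in> sets borel} \<subseteq> sets ?V"
    by (intro sets.sigma_sets_subset'[of _ ?V, simplified]) (auto dest: measurable_sets)
  have "random_variable borel (\<lambda>\<omega>. g (?D \<omega>))" using g by measurable
  moreover have "indep_set (sigma_sets (space M) {Y -` A \<inter> space M |A. A \<in> sets borel})
      (sigma_sets (space M) {(\<lambda>\<omega>. g (?D \<omega>)) -` A \<inter> space M |A. A \<in> sets borel})"
    unfolding indep_sets2_eq
  proof (intro conjI ballI)
    note WI = W_indep[OF assms(1,2), unfolded indep_sets2_eq]
    show "sigma_sets (space M) {Y -` A \<inter> space M |A. A \<in> sets borel} \<subseteq> events"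
      using A WI by (meson subset_trans)
    show "sigma_sets (space M) {(\<lambda>\<omega>. g (?D \<omega>)) -` A \<inter> space M |A. A \<in> sets borel} \<subseteq> events"
      using B WI by (meson subset_trans)
    fix a b assume a: "a \<in> sigma_sets (space M) {Y -` A \<inter> space M |A. A \<in> sets borel}"
      and b: "b \<in> sigma_sets (space M) {(\<lambda>\<omega>. g (?D \<omega>)) -` A \<inter> space M |A. A \<in> sets borel}"
    show "prob (a \<inter> b) = prob a * prob b"
      using WI subsetD[OF A a] subsetD[OF B b] by blast
  qed
  ultimately show ?thesis unfolding indep_var_eq by simp
qed

text \<open>Independence factorises both expectations. The first is the martingale property and
  removes all cross terms below; the second is the isometry for a single increment.\<close>

lemma expectation_mult_increment:
  assumes "0 \<le> s" "s \<le> t" and Y: "Y \<in> borel_measurable (F s)" "integrable M Y"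
  shows "integrable M (\<lambda>\<omega>. Y \<omega> * (W t \<omega> - W s \<omega>))" "expectation (\<lambda>\<omega>. Y \<omega> * (W t \<omega> - W s \<omega>)) = 0"
    "integrable M (\<lambda>\<omega>. Y \<omega> * (W t \<omega> - W s \<omega>)\<^sup>2)"
    "expectation (\<lambda>\<omega>. Y \<omega> * (W t \<omega> - W s \<omega>)\<^sup>2) = expectation Y * (t - s)"
proof -
  have "integrable M (\<lambda>\<omega>. Y \<omega> * (W t \<omega> - W s \<omega>)) \<and> expectation (\<lambda>\<omega>. Y \<omega> * (W t \<omega> - W s \<omega>)) = 0 \<and>
    integrable M (\<lambda>\<omega>. Y \<omega> * (W t \<omega> - W s \<omega>)\<^sup>2) \<and>
    expectation (\<lambda>\<omega>. Y \<omega> * (W t \<omega> - W s \<omega>)\<^sup>2) = expectation Y * (t - s)"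
  proof (cases "s = t")
    case False
    then have st: "s < t" using assms by simp
    note m = increment_moments[OF assms(1,2)]
    have 1: "indep_var borel Y borel (\<lambda>\<omega>. W t \<omega> - W s \<omega>)"
      using indep_increment[OF assms(1) st Y(1), of "\<lambda>x. x"] by simp
    have 2: "indep_var borel Y borel (\<lambda>\<omega>. (W t \<omega> - W s \<omega>)\<^sup>2)"
      using indep_increment[OF assms(1) st Y(1), of "\<lambda>x. x\<^sup>2"] by simp
    show ?thesis
      using indep_var_lebesgue_integral[OF 1 Y(2) m(1)] indep_var_integrable[OF 1 Y(2) m(1)]
        indep_var_lebesgue_integral[OF 2 Y(2) m(3)] indep_var_integrable[OF 2 Y(2) m(3)] m
      by simp
  qed simp
  then show "integrable M (\<lambda>\<omega>. Y \<omega> * (W t \<omega> - W s \<omega>))" "expectation (\<lambda>\<omega>. Y \<omega> * (W t \<omega> - W s \<omega>)) = 0"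
    "integrable M (\<lambda>\<omega>. Y \<omega> * (W t \<omega> - W s \<omega>)\<^sup>2)"
    "expectation (\<lambda>\<omega>. Y \<omega> * (W t \<omega> - W s \<omega>)\<^sup>2) = expectation Y * (t - s)"
    by blast+
qed

section \<open>Ito isometry and orthogonal increments for elementary integrals\<close>

lemma elementary_Suc: "elementary M F (Suc n) \<tau> \<xi> \<Longrightarrow> elementary M F n \<tau> \<xi>"
  by (simp add: elementary_def)

lemma elementary_mono: "elementary M F n \<tau> \<xi> \<Longrightarrow> i \<le> j \<Longrightarrow> j \<le> n \<Longrightarrow> \<tau> i \<le> \<tau> j"
  by (induction j) (auto simp: elementary_def le_Suc_eq intro: order_trans)

lemma elementary_nonneg: "elementary M F n \<tau> \<xi> \<Longrightarrow> j \<le> n \<Longrightarrow> 0 \<le> \<tau> j"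
  using elementary_mono[of n \<tau> \<xi> 0 j] by (auto simp: elementary_def)

lemma elementary_coeff:
  assumes "elementary M F n \<tau> \<xi>" "j < n"
  shows "\<xi> j \<in> borel_measurable (F (\<tau> j))" "random_variable borel (\<xi> j)"
    "\<exists>B. \<forall>\<omega>\<in>space M. \<bar>\<xi> j \<omega>\<bar> \<le> B"
proof -
  show 1: "\<xi> j \<in> borel_measurable (F (\<tau> j))" "\<exists>B. \<forall>\<omega>\<in>space M. \<bar>\<xi> j \<omega>\<bar> \<le> B"
    using assms by (auto simp: elementary_def)
  show "random_variable borel (\<xi> j)" by (rule measurable_F_M) (rule 1)
qed

lemma integrable_mult_coeff:
  assumes "elementary M F n \<tau> \<xi>" "j < n" "integrable M Y"
  shows "integrable M (\<lambda>\<omega>. \<xi> j \<omega> * Y \<omega>)"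
proof -
  obtain B where B: "\<forall>\<omega>\<in>space M. \<bar>\<xi> j \<omega>\<bar> \<le> B" using elementary_coeff(3)[OF assms(1,2)] by blast
  have [measurable]: "random_variable borel (\<xi> j)" "random_variable borel Y"
    using elementary_coeff[OF assms(1,2)] assms(3) by auto
  show ?thesis
  proof (rule Bochner_Integration.integrable_bound)
    show "integrable M (\<lambda>\<omega>. B * Y \<omega>)" using assms by simp
    show "AE \<omega> in M. norm (\<xi> j \<omega> * Y \<omega>) \<le> norm (B * Y \<omega>)"
    proof (rule AE_I2)
      fix \<omega> assume "\<omega> \<in> space M"
      then have "\<bar>\<xi> j \<omega>\<bar> \<le> \<bar>B\<bar>" using B by fastforce
      then show "norm (\<xi> j \<omega> * Y \<omega>) \<le> norm (B * Y \<omega>)" by (simp add: abs_mult mult_right_mono)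
    qed
  qed measurable
qed

text \<open>The time \<open>min t (\<tau> n)\<close> is sharper than \<open>t\<close>: when one more
  interval is added in the isometry, the earlier part of the integral has to be known where the next
  increment starts.\<close>

lemma elementary_integral_measurable:
  assumes E: "elementary M F n \<tau> \<xi>" and t: "0 \<le> t"
  shows "elementary_integral W n \<tau> \<xi> t \<in> borel_measurable (F (min t (\<tau> n)))"
proof -
  have "(\<lambda>\<omega>. \<xi> j \<omega> * (W (min t (\<tau> (Suc j))) \<omega> - W (min t (\<tau> j)) \<omega>)) \<in> borel_measurable (F (min t (\<tau> n)))"
    if j: "j < n" for j
  proof (cases "\<tau> j < t")
    case True
    have le: "\<tau> j \<le> \<tau> (Suc j)" "\<tau> (Suc j) \<le> \<tau> n" "0 \<le> \<tau> j"
      using elementary_mono[OF E] elementary_nonneg[OF E] j by auto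
    have [measurable]: "\<xi> j \<in> borel_measurable (F (min t (\<tau> n)))"
      using measurable_F[OF elementary_coeff(1)[OF E j]] True le by simp
    have [measurable]: "W (min t (\<tau> (Suc j))) \<in> borel_measurable (F (min t (\<tau> n)))"
        "W (min t (\<tau> j)) \<in> borel_measurable (F (min t (\<tau> n)))"
      using le t by (auto intro!: measurable_F[OF W_adapted])
    show ?thesis by measurable
  next
    case False
    \<comment> \<open>Here \<open>\<xi> j\<close> need not be known at time \<open>t\<close>, but
      the increment that it multiplies vanishes.\<close>
    then have "min t (\<tau> (Suc j)) = min t (\<tau> j)" using elementary_mono[OF E, of j "Suc j"] j by auto
    then show ?thesis by simp
  qed
  then show ?thesis unfolding elementary_integral_def[abs_def] by (intro borel_measurable_sum) auto
qed

text \<open>Ito isometry, by induction on the number of intervals: the product of the old integral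
  and the new term is a quantity known at \<open>?a\<close> times an increment after
  \<open>?a\<close>, so its expectation is zero.\<close>

lemma elementary_integral_square:
  assumes "elementary M F n \<tau> \<xi>" and t: "0 \<le> t"
  shows "integrable M (\<lambda>\<omega>. (elementary_integral W n \<tau> \<xi> t \<omega>)\<^sup>2) \<and>
    expectation (\<lambda>\<omega>. (elementary_integral W n \<tau> \<xi> t \<omega>)\<^sup>2) =
      (\<Sum>j<n. expectation (\<lambda>\<omega>. (\<xi> j \<omega>)\<^sup>2) * (min t (\<tau> (Suc j)) - min t (\<tau> j)))"
  using assms(1)
proof (induction n)
  case 0
  then show ?case by (simp add: elementary_integral_def)
next
  case (Suc n)
  note E = Suc.prems and E' = elementary_Suc[OF Suc.prems]
  let ?I = "elementary_integral W n \<tau> \<xi> t" and ?a = "min t (\<tau> n)" and ?b = "min t (\<tau> (Suc n))"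
  let ?D = "\<lambda>\<omega>. W ?b \<omega> - W ?a \<omega>"
  have IH: "integrable M (\<lambda>\<omega>. (?I \<omega>)\<^sup>2)" "expectation (\<lambda>\<omega>. (?I \<omega>)\<^sup>2) =
      (\<Sum>j<n. expectation (\<lambda>\<omega>. (\<xi> j \<omega>)\<^sup>2) * (min t (\<tau> (Suc j)) - min t (\<tau> j)))"
    using Suc.IH[OF E'] by auto
  have ab: "0 \<le> ?a" "?a \<le> ?b" using t elementary_nonneg[OF E, of n] elementary_mono[OF E, of n "Suc n"] by auto
  have I: "elementary_integral W (Suc n) \<tau> \<xi> t \<omega> = ?I \<omega> + \<xi> n \<omega> * ?D \<omega>" for \<omega>
    by (simp add: elementary_integral_def)
  have meas: "?I \<in> borel_measurable (F ?a)" by (rule elementary_integral_measurable[OF E' t])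
  have [measurable]: "random_variable borel (\<xi> n)" "random_variable borel ?I"
    "random_variable borel (W ?a)" "random_variable borel (W ?b)"
    using elementary_coeff(2)[OF E] measurable_F_M[OF meas] W_measurable[of ?a] W_measurable[of ?b] ab by auto
  show ?case
  proof (cases "\<tau> n < t")
    case False
    then have "?b = ?a" using elementary_mono[OF E, of n "Suc n"] by auto
    then show ?thesis using IH by (simp add: I)
  next
    case True
    then have xi: "\<xi> n \<in> borel_measurable (F ?a)"
      using measurable_F[OF elementary_coeff(1)[OF E, of n]] by simp
    have xi2: "integrable M (\<lambda>\<omega>. (\<xi> n \<omega>)\<^sup>2)"
      using integrable_mult_coeff[OF E, of n "\<xi> n"] integrable_mult_coeff[OF E, of n "\<lambda>_. 1"]
      by (simp add: power2_eq_square)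
    have Iint: "integrable M ?I"
      using square_integrable_imp_integrable[OF _ IH(1)] by simp
    have 1: "integrable M (\<lambda>\<omega>. (\<xi> n \<omega> * ?I \<omega>) * ?D \<omega>)" "expectation (\<lambda>\<omega>. (\<xi> n \<omega> * ?I \<omega>) * ?D \<omega>) = 0"
      using xi meas by (intro expectation_mult_increment[OF ab] integrable_mult_coeff[OF E] Iint; simp)+
    have 2: "integrable M (\<lambda>\<omega>. (\<xi> n \<omega>)\<^sup>2 * (?D \<omega>)\<^sup>2)"
      "expectation (\<lambda>\<omega>. (\<xi> n \<omega>)\<^sup>2 * (?D \<omega>)\<^sup>2) = expectation (\<lambda>\<omega>. (\<xi> n \<omega>)\<^sup>2) * (?b - ?a)"
      using xi by (intro expectation_mult_increment[OF ab] xi2; simp)+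
    have sq: "(elementary_integral W (Suc n) \<tau> \<xi> t \<omega>)\<^sup>2 =
        (?I \<omega>)\<^sup>2 + 2 * ((\<xi> n \<omega> * ?I \<omega>) * ?D \<omega>) + (\<xi> n \<omega>)\<^sup>2 * (?D \<omega>)\<^sup>2" for \<omega>
      unfolding I by (simp add: power2_sum power_mult_distrib)
    show ?thesis unfolding sq using IH 1 2 by simp
  qed
qed

text \<open>Later increments of the integral are orthogonal to the past. Clamping each partition
  point to \<open>[s, t]\<close> turns the difference of two integrals into a sum of increments that
  start no earlier than \<open>s\<close>, where \<open>Y\<close> is already known.\<close>

lemma elementary_integral_increment:
  assumes E: "elementary M F n \<tau> \<xi>" and st: "0 \<le> s" "s \<le> t"
    and Y: "Y \<in> borel_measurable (F s)" "integrable M Y"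
  shows "integrable M (\<lambda>\<omega>. Y \<omega> * (elementary_integral W n \<tau> \<xi> t \<omega> - elementary_integral W n \<tau> \<xi> s \<omega>))"
    "expectation (\<lambda>\<omega>. Y \<omega> * (elementary_integral W n \<tau> \<xi> t \<omega> - elementary_integral W n \<tau> \<xi> s \<omega>)) = 0"
proof -
  let ?a = "\<lambda>j. max s (min t (\<tau> j))"
  let ?X = "\<lambda>j \<omega>. (\<xi> j \<omega> * Y \<omega>) * (W (?a (Suc j)) \<omega> - W (?a j) \<omega>)"
  have clamp: "W (min t r) \<omega> - W (min s r) \<omega> = W (max s (min t r)) \<omega> - W s \<omega>" for r \<omega>
    using st by (cases "r \<le> s"; cases "r \<le> t") (auto simp: min_def max_def)
  have eq: "Y \<omega> * (elementary_integral W n \<tau> \<xi> t \<omega> - elementary_integral W n \<tau> \<xi> s \<omega>) = (\<Sum>j<n. ?X j \<omega>)" for \<omega>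
    unfolding elementary_integral_def sum_subtractf[symmetric] sum_distrib_left
  proof (rule sum.cong[OF refl])
    fix j
    have "W (min t (\<tau> (Suc j))) \<omega> - W (min t (\<tau> j)) \<omega> - (W (min s (\<tau> (Suc j))) \<omega> - W (min s (\<tau> j)) \<omega>)
       = W (?a (Suc j)) \<omega> - W (?a j) \<omega>"
      using clamp[of "\<tau> (Suc j)" \<omega>] clamp[of "\<tau> j" \<omega>] by simp
    then show "Y \<omega> * (\<xi> j \<omega> * (W (min t (\<tau> (Suc j))) \<omega> - W (min t (\<tau> j)) \<omega>) -
            \<xi> j \<omega> * (W (min s (\<tau> (Suc j))) \<omega> - W (min s (\<tau> j)) \<omega>)) = ?X j \<omega>"
      by (simp add: right_diff_distrib[symmetric] mult.assoc mult.left_commute)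
  qed
  have X: "integrable M (?X j) \<and> expectation (?X j) = 0" if j: "j < n" for j
  proof (cases "\<tau> j < t")
    case True
    have "?a j \<le> ?a (Suc j)" using elementary_mono[OF E, of j "Suc j"] j by auto
    moreover have "\<xi> j \<in> borel_measurable (F (?a j))"
      by (rule measurable_F[OF elementary_coeff(1)[OF E j]]) (use True in auto)
    moreover have "Y \<in> borel_measurable (F (?a j))" by (rule measurable_F[OF Y(1)]) auto
    ultimately show ?thesis
      using st by (intro conjI expectation_mult_increment integrable_mult_coeff[OF E j] Y) auto
  next
    case False
    then have "?a (Suc j) = ?a j" using elementary_mono[OF E, of j "Suc j"] j by auto
    then show ?thesis by simp
  qed
  show "integrable M (\<lambda>\<omega>. Y \<omega> * (elementary_integral W n \<tau> \<xi> t \<omega> - elementary_integral W n \<tau> \<xi> s \<omega>))"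
    unfolding eq using X by auto
  show "expectation (\<lambda>\<omega>. Y \<omega> * (elementary_integral W n \<tau> \<xi> t \<omega> - elementary_integral W n \<tau> \<xi> s \<omega>)) = 0"
    unfolding eq using X by (subst Bochner_Integration.integral_sum) auto
qed

end

text \<open>The integral may be infinite: for a single approximation the squared distance to
  \<open>Z\<close> is not given to be finite, only its limit is given to be zero.\<close>

lemma ennreal_square_chebyshev:
  fixes f :: "'a \<Rightarrow> real"
  assumes [measurable]: "f \<in> borel_measurable M" and "0 < l"
  shows "emeasure M {\<omega> \<in> space M. l \<le> \<bar>f \<omega>\<bar>} \<le> (\<integral>\<^sup>+\<omega>. ennreal ((f \<omega>)\<^sup>2) \<partial>M) / ennreal (l\<^sup>2)"
proof -
  have "{\<omega> \<in> space M. l \<le> \<bar>f \<omega>\<bar>} = {\<omega> \<in> space M. 1 \<le> ennreal (1 / l\<^sup>2) * ennreal ((f \<omega>)\<^sup>2)}"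
  proof -
    have "l \<le> \<bar>x\<bar> \<longleftrightarrow> 1 \<le> ennreal (1 / l\<^sup>2) * ennreal (x\<^sup>2)" for x
    proof -
      have "l \<le> \<bar>x\<bar> \<longleftrightarrow> l\<^sup>2 \<le> x\<^sup>2" using \<open>0 < l\<close> by (simp add: abs_le_square_iff[symmetric])
      also have "\<dots> \<longleftrightarrow> 1 \<le> 1 / l\<^sup>2 * x\<^sup>2" using \<open>0 < l\<close> by (simp add: field_simps)
      also have "\<dots> \<longleftrightarrow> 1 \<le> ennreal (1 / l\<^sup>2 * x\<^sup>2)" by simp
      finally show ?thesis by (subst (asm) ennreal_mult) simp_all
    qed
    then show ?thesis by simp
  qed
  also have "emeasure M \<dots> \<le> ennreal (1 / l\<^sup>2) * (\<integral>\<^sup>+\<omega>. ennreal ((f \<omega>)\<^sup>2) * indicator (space M) \<omega> \<partial>M)"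
    using nn_integral_Markov_inequality[of "\<lambda>\<omega>. ennreal ((f \<omega>)\<^sup>2)" "space M" M "ennreal (1 / l\<^sup>2)"]
    by simp
  also have "\<dots> = (\<integral>\<^sup>+\<omega>. ennreal ((f \<omega>)\<^sup>2) \<partial>M) * ennreal (1 / l\<^sup>2)"
    by (subst mult.commute) (auto intro!: arg_cong2[where f="(*)"] nn_integral_cong)
  also have "ennreal (1 / l\<^sup>2) = inverse (ennreal (l\<^sup>2))"
    using \<open>0 < l\<close> by (simp add: inverse_ennreal inverse_eq_divide)
  finally show ?thesis by (simp add: divide_ennreal_def)
qed

section \<open>Maximal inequalities, from elementary integrals to Ito integrals\<close>

context wiener
begin

text \<open>The event is split according to the first index \<open>k\<close> at which the level
  \<open>l\<close> is reached. There
  \<open>(S N)\<^sup>2 \<ge> (S k)\<^sup>2 + 2 * (S k * (S N - S k))\<close>, and the last term has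
  mean zero because the event \<open>A k\<close> and \<open>S k\<close> belong to the past of the
  increment.\<close>

lemma elementary_integral_maximal:
  fixes t :: "nat \<Rightarrow> real"
  assumes E: "elementary M F n \<tau> \<xi>" and t: "0 \<le> t 0" "mono t" and l: "0 < l"
  shows "prob {\<omega>\<in>space M. \<exists>k\<le>N. l \<le> \<bar>elementary_integral W n \<tau> \<xi> (t k) \<omega>\<bar>}
    \<le> expectation (\<lambda>\<omega>. (elementary_integral W n \<tau> \<xi> (t N) \<omega>)\<^sup>2) / l\<^sup>2"
proof -
  define S where "S k = elementary_integral W n \<tau> \<xi> (t k)" for k
  have t0: "0 \<le> t k" for k using t monoD[OF t(2), of 0 k] by simp
  have SF: "S j \<in> borel_measurable (F (t k))" if "j \<le> k" for j k
    unfolding S_def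
    by (rule measurable_F[OF elementary_integral_measurable[OF E t0]])
      (use monoD[OF t(2) that] in auto)
  have [measurable]: "random_variable borel (S k)" for k by (rule measurable_F_M[OF SF[OF order_refl]])
  have S2: "integrable M (\<lambda>\<omega>. (S k \<omega>)\<^sup>2)" for k
    using elementary_integral_square[OF E t0] by (simp add: S_def)
  have S1: "integrable M (S k)" for k by (rule square_integrable_imp_integrable[OF _ S2]) simp
  define A where "A k = {\<omega>\<in>space M. l \<le> \<bar>S k \<omega>\<bar> \<and> (\<forall>j<k. \<bar>S j \<omega>\<bar> < l)}" for k
  have AF: "A k \<in> sets (F (t k))" for k
  proof -
    \<comment> \<open>The index \<open>min j k\<close> equals \<open>j\<close> in the range of the
      quantifier and makes every value measurable at time \<open>t k\<close>, so that
      \<open>j\<close> may range over all natural numbers.\<close>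
    have [measurable]: "S (min j k) \<in> borel_measurable (F (t k))" for j by (rule SF) simp
    have "{\<omega>\<in>space (F (t k)). l \<le> \<bar>S (min k k) \<omega>\<bar> \<and> (\<forall>j. j < k \<longrightarrow> \<bar>S (min j k) \<omega>\<bar> < l)} \<in> sets (F (t k))"
      by measurable
    then show ?thesis by (simp add: A_def space_F cong: conj_cong)
  qed
  then have [measurable]: "A k \<in> events" for k using sets_F by blast
  have U: "{\<omega>\<in>space M. \<exists>k\<le>N. l \<le> \<bar>S k \<omega>\<bar>} = (\<Union>k\<le>N. A k)"
  proof safe
    fix \<omega> k assume *: "\<omega> \<in> space M" "k \<le> N" "l \<le> \<bar>S k \<omega>\<bar>"
    let ?k = "LEAST k. l \<le> \<bar>S k \<omega>\<bar>"
    have "l \<le> \<bar>S ?k \<omega>\<bar>" by (rule LeastI) fact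
    moreover have "?k \<le> k" by (rule Least_le) fact
    moreover have "\<bar>S j \<omega>\<bar> < l" if "j < ?k" for j using not_less_Least[OF that] by simp
    ultimately show "\<omega> \<in> (\<Union>k\<le>N. A k)" using * by (auto simp: A_def intro!: bexI[of _ ?k])
  qed (auto simp: A_def)
  have disj: "disjoint_family_on A {..N}"
  proof -
    have "A i \<inter> A j = {}" if "i < j" for i j using that by (force simp: A_def)
    then show ?thesis unfolding disjoint_family_on_def by (metis Int_commute linorder_neqE_nat)
  qed
  have I1: "integrable M (\<lambda>\<omega>. indicator (A k) \<omega> * (S k \<omega>)\<^sup>2)" for k
    using integrable_real_mult_indicator[OF _ S2[of k], of "A k"] by (simp add: mult.commute)
  have YF: "(\<lambda>\<omega>. indicator (A k) \<omega> * S k \<omega>) \<in> borel_measurable (F (t k))" for k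
    using AF[of k] SF[of k k] by measurable
  have Y1: "integrable M (\<lambda>\<omega>. indicator (A k) \<omega> * S k \<omega>)" for k
    using integrable_real_mult_indicator[OF _ S1[of k], of "A k"] by (simp add: mult.commute)
  have I2: "integrable M (\<lambda>\<omega>. (indicator (A k) \<omega> * S k \<omega>) * (S N \<omega> - S k \<omega>))"
    "expectation (\<lambda>\<omega>. (indicator (A k) \<omega> * S k \<omega>) * (S N \<omega> - S k \<omega>)) = 0" if "k \<le> N" for k
    unfolding S_def
    using elementary_integral_increment[OF E t0 monoD[OF t(2) that] YF Y1] by (simp_all add: S_def)
  have "l\<^sup>2 * prob {\<omega>\<in>space M. \<exists>k\<le>N. l \<le> \<bar>S k \<omega>\<bar>} = (\<Sum>k\<le>N. l\<^sup>2 * prob (A k))"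
    unfolding U by (subst finite_measure_finite_Union[OF _ _ disj]) (auto simp: sum_distrib_left)
  also have "\<dots> \<le> (\<Sum>k\<le>N. expectation (\<lambda>\<omega>. indicator (A k) \<omega> * (S k \<omega>)\<^sup>2))"
  proof (rule sum_mono)
    fix k
    have "l\<^sup>2 * prob (A k) = expectation (\<lambda>\<omega>. l\<^sup>2 * indicator (A k) \<omega>)" by simp
    also have "\<dots> \<le> expectation (\<lambda>\<omega>. indicator (A k) \<omega> * (S k \<omega>)\<^sup>2)"
    proof (rule integral_mono[OF _ I1])
      fix \<omega> show "l\<^sup>2 * indicator (A k) \<omega> \<le> indicator (A k) \<omega> * (S k \<omega>)\<^sup>2"
        using l by (auto simp: indicator_def A_def abs_le_square_iff[symmetric])
    qed (auto simp: integrable_real_mult_indicator less_top[symmetric])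
    finally show "l\<^sup>2 * prob (A k) \<le> expectation (\<lambda>\<omega>. indicator (A k) \<omega> * (S k \<omega>)\<^sup>2)" .
  qed
  \<comment> \<open>Terms of mean zero are added so that the sum can be compared pointwise with the
    square of \<open>S N\<close>.\<close>
  also have "\<dots> = (\<Sum>k\<le>N. expectation (\<lambda>\<omega>. indicator (A k) \<omega> * (S k \<omega>)\<^sup>2
      + 2 * ((indicator (A k) \<omega> * S k \<omega>) * (S N \<omega> - S k \<omega>))))"
    using I1 I2 by (intro sum.cong) simp_all
  also have "\<dots> = expectation (\<lambda>\<omega>. \<Sum>k\<le>N. indicator (A k) \<omega> * (S k \<omega>)\<^sup>2
      + 2 * ((indicator (A k) \<omega> * S k \<omega>) * (S N \<omega> - S k \<omega>)))"
    using I1 I2 by (intro Bochner_Integration.integral_sum[symmetric]) simp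
  also have "\<dots> \<le> expectation (\<lambda>\<omega>. (S N \<omega>)\<^sup>2)"
  proof (rule integral_mono[OF _ S2])
    show "integrable M (\<lambda>\<omega>. \<Sum>k\<le>N. indicator (A k) \<omega> * (S k \<omega>)\<^sup>2
        + 2 * ((indicator (A k) \<omega> * S k \<omega>) * (S N \<omega> - S k \<omega>)))"
      using I1 I2 by (intro Bochner_Integration.integrable_sum Bochner_Integration.integrable_add) simp_all
    fix \<omega>
    have "(\<Sum>k\<le>N. indicator (A k) \<omega> * (S k \<omega>)\<^sup>2
        + 2 * ((indicator (A k) \<omega> * S k \<omega>) * (S N \<omega> - S k \<omega>))) \<le> (\<Sum>k\<le>N. indicator (A k) \<omega> * (S N \<omega>)\<^sup>2)"
    proof (rule sum_mono)
      fix k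
      have "(S k \<omega>)\<^sup>2 + 2 * (S k \<omega> * (S N \<omega> - S k \<omega>)) \<le> (S N \<omega>)\<^sup>2"
        using zero_le_power2[of "S N \<omega> - S k \<omega>"] by (simp add: power2_eq_square algebra_simps)
      then show "indicator (A k) \<omega> * (S k \<omega>)\<^sup>2
        + 2 * ((indicator (A k) \<omega> * S k \<omega>) * (S N \<omega> - S k \<omega>)) \<le> indicator (A k) \<omega> * (S N \<omega>)\<^sup>2"
        by (auto simp: indicator_def)
    qed
    also have "\<dots> = indicator (\<Union>k\<le>N. A k) \<omega> * (S N \<omega>)\<^sup>2"
      by (subst indicator_UN_disjoint[OF _ disj]) (auto simp: sum_distrib_right)
    also have "\<dots> \<le> (S N \<omega>)\<^sup>2" by (simp add: indicator_def)
    finally show "(\<Sum>k\<le>N. indicator (A k) \<omega> * (S k \<omega>)\<^sup>2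
        + 2 * ((indicator (A k) \<omega> * S k \<omega>) * (S N \<omega> - S k \<omega>))) \<le> (S N \<omega>)\<^sup>2" .
  qed
  finally show ?thesis using l by (simp add: S_def pos_le_divide_eq mult.commute)
qed

text \<open>The half-open intervals are disjoint, so the square of the sum has no mixed
  products.\<close>

lemma elementary_process_square:
  assumes E: "elementary M F n \<tau> \<xi>"
  shows "(elementary_process n \<tau> \<xi> s \<omega>)\<^sup>2 = (\<Sum>j<n. (\<xi> j \<omega>)\<^sup>2 * indicator {\<tau> j<..\<tau> (Suc j)} s)"
  using E
proof (induction n)
  case (Suc n)
  note E' = elementary_Suc[OF Suc.prems]
  show ?case
  proof (cases "s \<in> {\<tau> n<..\<tau> (Suc n)}")
    case True
    have z: "indicat_real {\<tau> j<..\<tau> (Suc j)} s = 0" if "j < n" for j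
      using elementary_mono[OF E', of "Suc j" n] that True by auto
    have "(\<Sum>j<n. \<xi> j \<omega> * indicat_real {\<tau> j<..\<tau> (Suc j)} s) = 0"
      "(\<Sum>j<n. (\<xi> j \<omega>)\<^sup>2 * indicat_real {\<tau> j<..\<tau> (Suc j)} s) = 0"
      by (simp_all add: z del: indicator_simps)
    then show ?thesis using True by (simp add: elementary_process_def)
  next
    case False
    then show ?thesis using Suc.IH[OF E'] by (simp add: elementary_process_def)
  qed
qed (simp add: elementary_process_def)

text \<open>Path by path the time integral is the sum whose expectation appears in
  \<open>elementary_integral_square\<close>. This links the distance between integrands, measured in
  time, to the second moment of the integral.\<close>

lemma integral_elementary_process_square:
  assumes E: "elementary M F n \<tau> \<xi>" and T: "0 \<le> T"
  shows "has_bochner_integral lborel (\<lambda>s. (elementary_process n \<tau> \<xi> s \<omega>)\<^sup>2 * indicator {0..T} s)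
    (\<Sum>j<n. (\<xi> j \<omega>)\<^sup>2 * (min T (\<tau> (Suc j)) - min T (\<tau> j)))"
proof -
  have "(elementary_process n \<tau> \<xi> s \<omega>)\<^sup>2 * indicator {0..T} s =
    (\<Sum>j<n. (\<xi> j \<omega>)\<^sup>2 * indicator {min T (\<tau> j)<..min T (\<tau> (Suc j))} s)" for s
    unfolding elementary_process_square[OF E] sum_distrib_right
  proof (rule sum.cong[OF refl])
    fix j assume "j \<in> {..<n}"
    then have "0 \<le> \<tau> j" using elementary_nonneg[OF E] by auto
    then show "(\<xi> j \<omega>)\<^sup>2 * indicator {\<tau> j<..\<tau> (Suc j)} s * indicator {0..T} s =
        (\<xi> j \<omega>)\<^sup>2 * indicator {min T (\<tau> j)<..min T (\<tau> (Suc j))} s"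
      by (auto simp: indicator_def min_def)
  qed
  moreover have "has_bochner_integral lborel (\<lambda>s. (\<xi> j \<omega>)\<^sup>2 * indicator {min T (\<tau> j)<..min T (\<tau> (Suc j))} s)
      ((\<xi> j \<omega>)\<^sup>2 * (min T (\<tau> (Suc j)) - min T (\<tau> j)))" if "j < n" for j
  proof -
    have le: "min T (\<tau> j) \<le> min T (\<tau> (Suc j))" using elementary_mono[OF E, of j "Suc j"] that by auto
    have "has_bochner_integral lborel (indicat_real {min T (\<tau> j)<..min T (\<tau> (Suc j))})
        (measure lborel {min T (\<tau> j)<..min T (\<tau> (Suc j))})"
      by (rule has_bochner_integral_real_indicator) (use le in auto)
    then show ?thesis using le by (intro has_bochner_integral_mult_right) auto
  qed
  ultimately show ?thesis by (simp only:) (intro has_bochner_integral_sum, simp)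
qed

text \<open>The integrand \<open>H\<close> need not be jointly measurable, so its square must not be split off inside the
  integrals; instead it is bounded by \<open>C\<^sup>2\<close> pointwise.\<close>

lemma elementary_integral_bound:
  assumes E: "elementary M F n \<tau> \<xi>" and T: "0 \<le> T"
    and H: "\<And>s \<omega>. 0 \<le> s \<Longrightarrow> \<omega> \<in> space M \<Longrightarrow> \<bar>H s \<omega>\<bar> \<le> C"
  shows "ennreal (expectation (\<lambda>\<omega>. (elementary_integral W n \<tau> \<xi> T \<omega>)\<^sup>2)) \<le>
    ennreal (2 * C\<^sup>2 * T) + 2 * (\<integral>\<^sup>+\<omega>. (\<integral>\<^sup>+s\<in>{0..T}.
      ennreal ((elementary_process n \<tau> \<xi> s \<omega> - H s \<omega>)\<^sup>2) \<partial>lborel) \<partial>M)"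
proof -
  define A where "A \<omega> = (\<Sum>j<n. (\<xi> j \<omega>)\<^sup>2 * (min T (\<tau> (Suc j)) - min T (\<tau> j)))" for \<omega>
  have int: "integrable M (\<lambda>\<omega>. (\<xi> j \<omega>)\<^sup>2)" if "j < n" for j
    using integrable_mult_coeff[OF E that, of "\<xi> j"] integrable_mult_coeff[OF E that, of "\<lambda>_. 1"]
    by (simp add: power2_eq_square)
  have A: "integrable M A" "expectation A = expectation (\<lambda>\<omega>. (elementary_integral W n \<tau> \<xi> T \<omega>)\<^sup>2)"
    using elementary_integral_square[OF E T] int by (auto simp: A_def[abs_def])
  have [measurable]: "random_variable borel A" using A by simp
  have pt: "ennreal (A \<omega> / 2 - C\<^sup>2 * T) \<le>
      (\<integral>\<^sup>+s\<in>{0..T}. ennreal ((elementary_process n \<tau> \<xi> s \<omega> - H s \<omega>)\<^sup>2) \<partial>lborel)"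
    if \<omega>: "\<omega> \<in> space M" for \<omega>
  proof -
    let ?e = "\<lambda>s. elementary_process n \<tau> \<xi> s \<omega>"
    let ?g = "\<lambda>s. (?e s)\<^sup>2 * indicator {0..T} s / 2 - C\<^sup>2 * indicator {0..T} s"
    have g: "has_bochner_integral lborel ?g (A \<omega> / 2 - C\<^sup>2 * T)"
    proof (rule has_bochner_integral_diff)
      show "has_bochner_integral lborel (\<lambda>s. (?e s)\<^sup>2 * indicator {0..T} s / 2) (A \<omega> / 2)"
        unfolding A_def by (intro has_bochner_integral_divide_zero integral_elementary_process_square[OF E T])
      show "has_bochner_integral lborel (\<lambda>s. C\<^sup>2 * indicator {0..T} s) (C\<^sup>2 * T)"
        using has_bochner_integral_real_indicator[of "{0..T}" lborel] T
        by (intro has_bochner_integral_mult_right) auto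
    qed
    have "A \<omega> / 2 - C\<^sup>2 * T = integral\<^sup>L lborel ?g"
      using g by (simp add: has_bochner_integral_iff)
    also have "\<dots> \<le> integral\<^sup>L lborel (\<lambda>s. max 0 (?g s))"
      using g by (intro integral_mono) (auto simp: has_bochner_integral_iff)
    finally have "ennreal (A \<omega> / 2 - C\<^sup>2 * T) \<le> ennreal (integral\<^sup>L lborel (\<lambda>s. max 0 (?g s)))"
      by (rule ennreal_leI)
    also have "\<dots> = (\<integral>\<^sup>+s. ennreal (max 0 (?g s)) \<partial>lborel)"
      using g by (intro nn_integral_eq_integral[symmetric]) (auto simp: has_bochner_integral_iff)
    also have "\<dots> \<le> (\<integral>\<^sup>+s\<in>{0..T}. ennreal ((?e s - H s \<omega>)\<^sup>2) \<partial>lborel)"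
    proof (rule nn_integral_mono)
      fix s
      show "ennreal (max 0 (?g s)) \<le> ennreal ((?e s - H s \<omega>)\<^sup>2) * indicator {0..T} s"
      proof (cases "s \<in> {0..T}")
        case True
        then have "(H s \<omega>)\<^sup>2 \<le> C\<^sup>2" using H[of s \<omega>] \<omega> by (simp add: abs_le_square_iff[symmetric])
        \<comment> \<open>This is \<open>(?e s - 2 * H s \<omega>)\<^sup>2 \<ge> 0\<close>
          rearranged; it is the origin of the division by 2 in \<open>?g\<close>.\<close>
        moreover have "(?e s)\<^sup>2 \<le> 2 * (?e s - H s \<omega>)\<^sup>2 + 2 * (H s \<omega>)\<^sup>2"
          using zero_le_power2[of "?e s - 2 * H s \<omega>"] by (simp add: power2_eq_square algebra_simps)
        ultimately show ?thesis using True by (auto intro!: ennreal_leI)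
      qed simp
    qed
    finally show ?thesis .
  qed
  have "ennreal (expectation A) \<le> ennreal (2 * C\<^sup>2 * T) + 2 * (\<integral>\<^sup>+\<omega>. ennreal (A \<omega> / 2 - C\<^sup>2 * T) \<partial>M)"
  proof -
    \<comment> \<open>Since \<open>ennreal\<close> cuts off negative values, only the positive part
      of \<open>A \<omega> / 2 - C\<^sup>2 * T\<close> is available; solving for \<open>A\<close>
      produces the factors 2.\<close>
    have "expectation A \<le> expectation (\<lambda>\<omega>. 2 * C\<^sup>2 * T + 2 * max 0 (A \<omega> / 2 - C\<^sup>2 * T))"
    proof (rule integral_mono)
      fix \<omega> show "A \<omega> \<le> 2 * C\<^sup>2 * T + 2 * max 0 (A \<omega> / 2 - C\<^sup>2 * T)"
      proof -
        have "x \<le> 2 * c + 2 * max 0 (x / 2 - c)" for x c :: real by (simp add: max_def)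
        from this[of "A \<omega>" "C\<^sup>2 * T"] show ?thesis by (simp add: mult.assoc)
      qed
    qed (use A in auto)
    also have "\<dots> = 2 * C\<^sup>2 * T + 2 * expectation (\<lambda>\<omega>. max 0 (A \<omega> / 2 - C\<^sup>2 * T))"
      using A by (simp add: prob_space)
    finally have "ennreal (expectation A) \<le> ennreal (2 * C\<^sup>2 * T + 2 * expectation (\<lambda>\<omega>. max 0 (A \<omega> / 2 - C\<^sup>2 * T)))"
      by (rule ennreal_leI)
    also have "\<dots> = ennreal (2 * C\<^sup>2 * T) + 2 * ennreal (expectation (\<lambda>\<omega>. max 0 (A \<omega> / 2 - C\<^sup>2 * T)))"
      using T by (subst ennreal_plus) (auto simp: ennreal_mult intro!: integral_nonneg)
    also have "ennreal (expectation (\<lambda>\<omega>. max 0 (A \<omega> / 2 - C\<^sup>2 * T))) = (\<integral>\<^sup>+\<omega>. ennreal (max 0 (A \<omega> / 2 - C\<^sup>2 * T)) \<partial>M)"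
      using A by (intro nn_integral_eq_integral[symmetric]) auto
    also have "\<dots> = (\<integral>\<^sup>+\<omega>. ennreal (A \<omega> / 2 - C\<^sup>2 * T) \<partial>M)"
      by (intro nn_integral_cong) (simp add: max_def ennreal_neg)
    finally show ?thesis .
  qed
  also have "\<dots> \<le> ennreal (2 * C\<^sup>2 * T) + 2 * (\<integral>\<^sup>+\<omega>. (\<integral>\<^sup>+s\<in>{0..T}.
      ennreal ((elementary_process n \<tau> \<xi> s \<omega> - H s \<omega>)\<^sup>2) \<partial>lborel) \<partial>M)"
    by (intro add_mono mult_left_mono nn_integral_mono pt) auto
  finally show ?thesis using A by simp
qed


text \<open>If \<open>Z\<close> reaches \<open>2 * l\<close> in absolute value, then either the
  approximating integral reaches \<open>l\<close>, which the maximal inequality controls, or the two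
  differ by at least \<open>l\<close>. The probability of the latter vanishes in the limit because
  only finitely many times are involved.\<close>

lemma ito_integral_maximal_finite:
  fixes t :: "nat \<Rightarrow> real"
  assumes ito: "ito_integral M F W H Z"
    and H: "\<And>s \<omega>. 0 \<le> s \<Longrightarrow> \<omega> \<in> space M \<Longrightarrow> \<bar>H s \<omega>\<bar> \<le> C"
    and t: "0 \<le> t 0" "mono t" "t N \<le> T" and l: "0 < l"
  shows "prob {\<omega>\<in>space M. \<exists>k\<le>N. 2 * l \<le> \<bar>Z (t k) \<omega>\<bar>} \<le> 2 * C\<^sup>2 * T / l\<^sup>2"
proof -
  have t0: "0 \<le> t k" for k using t monoD[OF t(2), of 0 k] by simp
  have T: "0 \<le> T" using t0[of N] t by simp
  obtain n \<tau> \<xi> where E: "\<And>m. elementary M F (n m) (\<tau> m) (\<xi> m)"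
    and L1: "\<And>T. 0 \<le> T \<Longrightarrow> (\<lambda>m::nat. \<integral>\<^sup>+\<omega>. (\<integral>\<^sup>+s\<in>{0..T}.
              ennreal ((elementary_process (n m) (\<tau> m) (\<xi> m) s \<omega> - H s \<omega>)\<^sup>2) \<partial>lborel) \<partial>M)
            \<longlonglongrightarrow> 0"
    and L2: "\<And>T. 0 \<le> T \<Longrightarrow> (\<lambda>m. \<integral>\<^sup>+\<omega>.
              ennreal ((elementary_integral W (n m) (\<tau> m) (\<xi> m) T \<omega> - Z T \<omega>)\<^sup>2) \<partial>M)
            \<longlonglongrightarrow> 0"
    using ito unfolding ito_integral_def by blast
  let ?I = "\<lambda>m k \<omega>. elementary_integral W (n m) (\<tau> m) (\<xi> m) (t k) \<omega>"
  let ?a = "\<lambda>m. \<integral>\<^sup>+\<omega>. (\<integral>\<^sup>+s\<in>{0..t N}. ennreal ((elementary_process (n m) (\<tau> m) (\<xi> m) s \<omega> - H s \<omega>)\<^sup>2) \<partial>lborel) \<partial>M"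
  let ?b = "\<lambda>m k. \<integral>\<^sup>+\<omega>. ennreal ((?I m k \<omega> - Z (t k) \<omega>)\<^sup>2) \<partial>M"
  have [measurable]: "random_variable borel (Z (t k))" for k
    using ito t0 by (simp add: ito_integral_def)
  have [measurable]: "random_variable borel (?I m k)" for m k
    by (rule measurable_F_M[OF elementary_integral_measurable[OF E t0]])
  let ?P = "{\<omega>\<in>space M. \<exists>k\<le>N. 2 * l \<le> \<bar>Z (t k) \<omega>\<bar>}"
  have bound: "emeasure M ?P \<le> (ennreal (2 * C\<^sup>2 * T) + 2 * ?a m) / ennreal (l\<^sup>2) + (\<Sum>k\<le>N. ?b m k / ennreal (l\<^sup>2))" for m
  proof -
    have "emeasure M ?P \<le> emeasure M ({\<omega>\<in>space M. \<exists>k\<le>N. l \<le> \<bar>?I m k \<omega>\<bar>} \<union>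
        (\<Union>k\<le>N. {\<omega>\<in>space M. l \<le> \<bar>?I m k \<omega> - Z (t k) \<omega>\<bar>}))"
    proof (rule emeasure_mono)
      have "l \<le> \<bar>x\<bar> \<or> l \<le> \<bar>x - z\<bar>" if "2 * l \<le> \<bar>z\<bar>" for x z :: real using that by linarith
      then show "?P \<subseteq> {\<omega>\<in>space M. \<exists>k\<le>N. l \<le> \<bar>?I m k \<omega>\<bar>} \<union>
        (\<Union>k\<le>N. {\<omega>\<in>space M. l \<le> \<bar>?I m k \<omega> - Z (t k) \<omega>\<bar>})" by blast
    qed measurable
    also have "\<dots> \<le> emeasure M {\<omega>\<in>space M. \<exists>k\<le>N. l \<le> \<bar>?I m k \<omega>\<bar>} +
        emeasure M (\<Union>k\<le>N. {\<omega>\<in>space M. l \<le> \<bar>?I m k \<omega> - Z (t k) \<omega>\<bar>})"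
      by (rule emeasure_subadditive) measurable
    also have "\<dots> \<le> (ennreal (2 * C\<^sup>2 * T) + 2 * ?a m) / ennreal (l\<^sup>2) + (\<Sum>k\<le>N. ?b m k / ennreal (l\<^sup>2))"
    proof (rule add_mono)
      have "emeasure M {\<omega>\<in>space M. \<exists>k\<le>N. l \<le> \<bar>?I m k \<omega>\<bar>} \<le> ennreal (expectation (\<lambda>\<omega>. (?I m N \<omega>)\<^sup>2) / l\<^sup>2)"
        unfolding emeasure_eq_measure using elementary_integral_maximal[OF E t(1,2) l] by (rule ennreal_leI)
      also have "\<dots> = ennreal (expectation (\<lambda>\<omega>. (?I m N \<omega>)\<^sup>2)) / ennreal (l\<^sup>2)"
        using l by (intro divide_ennreal[symmetric]) auto
      also have "\<dots> \<le> (ennreal (2 * C\<^sup>2 * T) + 2 * ?a m) / ennreal (l\<^sup>2)"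
      proof (rule divide_right_mono_ennreal)
        have "ennreal (expectation (\<lambda>\<omega>. (?I m N \<omega>)\<^sup>2)) \<le> ennreal (2 * C\<^sup>2 * t N) + 2 * ?a m"
          by (rule elementary_integral_bound[OF E t0 H])
        also have "\<dots> \<le> ennreal (2 * C\<^sup>2 * T) + 2 * ?a m"
          using t by (intro add_right_mono ennreal_leI mult_left_mono) auto
        finally show "ennreal (expectation (\<lambda>\<omega>. (?I m N \<omega>)\<^sup>2)) \<le> ennreal (2 * C\<^sup>2 * T) + 2 * ?a m" .
      qed
      finally show "emeasure M {\<omega>\<in>space M. \<exists>k\<le>N. l \<le> \<bar>?I m k \<omega>\<bar>} \<le> (ennreal (2 * C\<^sup>2 * T) + 2 * ?a m) / ennreal (l\<^sup>2)" .
      have "emeasure M (\<Union>k\<le>N. {\<omega>\<in>space M. l \<le> \<bar>?I m k \<omega> - Z (t k) \<omega>\<bar>}) \<le>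
          (\<Sum>k\<le>N. emeasure M {\<omega>\<in>space M. l \<le> \<bar>?I m k \<omega> - Z (t k) \<omega>\<bar>})"
        by (intro emeasure_subadditive_finite) auto
      also have "\<dots> \<le> (\<Sum>k\<le>N. ?b m k / ennreal (l\<^sup>2))"
        by (intro sum_mono ennreal_square_chebyshev l) measurable
      finally show "emeasure M (\<Union>k\<le>N. {\<omega>\<in>space M. l \<le> \<bar>?I m k \<omega> - Z (t k) \<omega>\<bar>}) \<le> (\<Sum>k\<le>N. ?b m k / ennreal (l\<^sup>2))" .
    qed
    finally show ?thesis .
  qed
  have "(\<lambda>m. (ennreal (2 * C\<^sup>2 * T) + 2 * ?a m) / ennreal (l\<^sup>2) + (\<Sum>k\<le>N. ?b m k / ennreal (l\<^sup>2)))
      \<longlonglongrightarrow> (ennreal (2 * C\<^sup>2 * T) + 2 * 0) / ennreal (l\<^sup>2) + (\<Sum>k\<le>N. 0 / ennreal (l\<^sup>2))"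
  proof -
    have dv: "x / ennreal (l\<^sup>2) = ennreal (1 / l\<^sup>2) * x" for x
      using l by (simp add: divide_ennreal_def inverse_ennreal inverse_eq_divide mult.commute)
    show ?thesis unfolding dv
      by (intro tendsto_add tendsto_sum ennreal_tendsto_cmult tendsto_const L1 L2 t0) auto
  qed
  then have "emeasure M ?P \<le> (ennreal (2 * C\<^sup>2 * T) + 2 * 0) / ennreal (l\<^sup>2) + (\<Sum>k\<le>N. 0 / ennreal (l\<^sup>2))"
    by (rule LIMSEQ_le_const) (use bound in blast)
  also have "\<dots> = ennreal (2 * C\<^sup>2 * T / l\<^sup>2)"
    using T l by (simp add: divide_ennreal)
  finally show ?thesis
    using T l by (simp add: emeasure_eq_measure)
qed

text \<open>Dyadic grids of \<open>[0, T]\<close> are nested, so the finite bound passes unchanged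
  to the union of the exceptional events, and path continuity extends it to all times. Continuity is
  a premise on \<open>\<omega>\<close>, which keeps \<open>A\<close> an explicit countable union of
  events.\<close>

lemma ito_integral_maximal:
  assumes ito: "ito_integral M F W H Z"
    and H: "\<And>s \<omega>. 0 \<le> s \<Longrightarrow> \<omega> \<in> space M \<Longrightarrow> \<bar>H s \<omega>\<bar> \<le> C"
    and T: "0 < T" and l: "0 < l"
  shows "\<exists>A\<in>events. prob A \<le> 2 * C\<^sup>2 * T / l\<^sup>2 \<and>
    (\<forall>\<omega>\<in>space M - A. continuous_on {0..} (\<lambda>t. Z t \<omega>) \<longrightarrow> (\<forall>t\<in>{0..T}. \<bar>Z t \<omega>\<bar> \<le> 2 * l))"
proof -
  define A where "A n = {\<omega>\<in>space M. \<exists>k\<le>2 ^ n. 2 * l \<le> \<bar>Z (real k * T / 2 ^ n) \<omega>\<bar>}" for n :: nat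
  have [measurable]: "random_variable borel (Z (real k * T / 2 ^ n))" for k n
    using ito T by (simp add: ito_integral_def)
  have [measurable]: "A n \<in> events" for n unfolding A_def by measurable
  have P: "prob (A n) \<le> 2 * C\<^sup>2 * T / l\<^sup>2" for n
    unfolding A_def
    by (rule ito_integral_maximal_finite[OF ito H _ _ _ l])
      (use T in \<open>auto intro!: monoI divide_right_mono mult_right_mono\<close>)
  have "incseq A"
  proof (rule incseq_SucI)
    fix n show "A n \<subseteq> A (Suc n)"
    proof
      fix \<omega> assume "\<omega> \<in> A n"
      then obtain k where k: "\<omega> \<in> space M" "k \<le> 2 ^ n" "2 * l \<le> \<bar>Z (real k * T / 2 ^ n) \<omega>\<bar>"
        by (auto simp: A_def)
      moreover have "real (2 * k) * T / 2 ^ Suc n = real k * T / 2 ^ n" by simp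
      ultimately show "\<omega> \<in> A (Suc n)" unfolding A_def by (auto intro!: exI[of _ "2 * k"])
    qed
  qed
  then have "(\<lambda>n. prob (A n)) \<longlonglongrightarrow> prob (\<Union>n. A n)"
    by (intro finite_Lim_measure_incseq) auto
  then have PU: "prob (\<Union>n. A n) \<le> 2 * C\<^sup>2 * T / l\<^sup>2"
    by (rule LIMSEQ_le_const2) (use P in blast)
  moreover have "\<bar>Z t \<omega>\<bar> \<le> 2 * l" if \<omega>: "\<omega> \<in> space M" "\<omega> \<notin> (\<Union>n. A n)"
    and cont: "continuous_on {0..} (\<lambda>t. Z t \<omega>)" and t: "t \<in> {0..T}" for \<omega> t
  proof -
    \<comment> \<open>Rounding \<open>t\<close> down to the grid of level \<open>n\<close> keeps the
      grid point in \<open>[0, T]\<close> and within \<open>T / 2 ^ n\<close> of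
      \<open>t\<close>.\<close>
    define k where "k n = nat \<lfloor>t / T * 2 ^ n\<rfloor>" for n :: nat
    define r where "r n = real (k n) * T / 2 ^ n" for n
    have k: "real (k n) \<le> t / T * 2 ^ n" "t / T * 2 ^ n < real (k n) + 1" for n
    proof -
      have "0 \<le> t / T * 2 ^ n" using t T by simp
      then have "real (k n) = of_int \<lfloor>t / T * 2 ^ n\<rfloor>" by (simp add: k_def)
      then show "real (k n) \<le> t / T * 2 ^ n" "t / T * 2 ^ n < real (k n) + 1" by linarith+
    qed
    have k_le: "k n \<le> 2 ^ n" for n
    proof -
      have "t / T * 2 ^ n \<le> 1 * 2 ^ n" using t T by (intro mult_right_mono) auto
      then have "real (k n) \<le> real (2 ^ n)" using k(1)[of n] by (simp only: of_nat_power of_nat_numeral mult_1)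
      then show ?thesis by (simp only: of_nat_le_iff)
    qed
    have r: "\<bar>r n - t\<bar> \<le> T * (1 / 2) ^ n" for n
    proof -
      have "r n - t = (real (k n) - t / T * 2 ^ n) * (T / 2 ^ n)" using T by (simp add: r_def field_simps)
      then have "\<bar>r n - t\<bar> = \<bar>real (k n) - t / T * 2 ^ n\<bar> * (T / 2 ^ n)" using T by (simp add: abs_mult)
      also have "\<dots> \<le> 1 * (T / 2 ^ n)" using k[of n] T by (intro mult_right_mono) auto
      finally show ?thesis by (simp add: power_divide)
    qed
    have "(\<lambda>n. T * (1 / 2) ^ n) \<longlonglongrightarrow> T * 0"
      by (intro tendsto_mult tendsto_const LIMSEQ_realpow_zero) auto
    then have "(\<lambda>n. T * (1 / 2) ^ n) \<longlonglongrightarrow> 0" by (simp only: mult_zero_right)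
    then have "(\<lambda>n. r n - t) \<longlonglongrightarrow> 0"
    proof (rule Lim_null_comparison[rotated, of "\<lambda>n. T * (1 / 2) ^ n"])
      show "\<forall>\<^sub>F n in sequentially. norm (r n - t) \<le> T * (1 / 2) ^ n"
        unfolding real_norm_def by (intro always_eventually allI r)
    qed
    then have "r \<longlonglongrightarrow> t" using LIM_zero_cancel by blast
    moreover have "0 \<le> r n" for n using T by (simp add: r_def)
    ultimately have "(\<lambda>n. Z (r n) \<omega>) \<longlonglongrightarrow> Z t \<omega>"
      using t by (intro continuous_on_tendsto_compose[OF cont]) auto
    then have "(\<lambda>n. \<bar>Z (r n) \<omega>\<bar>) \<longlonglongrightarrow> \<bar>Z t \<omega>\<bar>" by (rule tendsto_rabs)
    moreover have "\<bar>Z (r n) \<omega>\<bar> \<le> 2 * l" for n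
      using \<omega> k_le[of n] by (force simp: A_def r_def)
    ultimately show ?thesis by (intro LIMSEQ_le_const2) auto
  qed
  ultimately show ?thesis by (intro bexI[of _ "\<Union>n. A n"]) auto
qed

text \<open>On \<open>[0, 2 ^ n]\<close> the level \<open>e * 2 ^ n\<close> is proportional to the
  length, whereas the integral has the size of the square root of the length in mean square. The
  bounds on the exceptional probabilities therefore decay like \<open>(1 / 2) ^ n\<close>.\<close>

lemma ito_integral_sublinear:
  assumes ito: "ito_integral M F W H Z"
    and H: "\<And>s \<omega>. 0 \<le> s \<Longrightarrow> \<omega> \<in> space M \<Longrightarrow> \<bar>H s \<omega>\<bar> \<le> C"
  shows "AE \<omega> in M. ((\<lambda>t. Z t \<omega> / t) \<longlongrightarrow> 0) at_top"
proof -
  have cont: "AE \<omega> in M. continuous_on {0..} (\<lambda>t. Z t \<omega>)"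
    using ito by (simp add: ito_integral_def continuous_paths_def)
  \<comment> \<open>The 4 is the factor 2 of the maximal inequality times the factor 2 lost when
    \<open>t\<close> is enclosed between consecutive powers of two.\<close>
  have ev: "AE \<omega> in M. \<forall>\<^sub>F t in at_top. \<bar>Z t \<omega> / t\<bar> \<le> 4 * e" if e: "0 < e" for e
  proof -
    have "\<exists>A\<in>events. prob A \<le> 2 * C\<^sup>2 * 2 ^ n / (e * 2 ^ n)\<^sup>2 \<and>
      (\<forall>\<omega>\<in>space M - A. continuous_on {0..} (\<lambda>t. Z t \<omega>) \<longrightarrow> (\<forall>t\<in>{0..2 ^ n}. \<bar>Z t \<omega>\<bar> \<le> 2 * (e * 2 ^ n)))" for n :: nat
      by (rule ito_integral_maximal[OF ito H]) (use e in auto)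
    then obtain A where A: "\<And>n. A n \<in> events" "\<And>n. prob (A n) \<le> 2 * C\<^sup>2 * 2 ^ n / (e * 2 ^ n)\<^sup>2"
      "\<And>n \<omega> t. \<omega> \<in> space M - A n \<Longrightarrow> continuous_on {0..} (\<lambda>t. Z t \<omega>) \<Longrightarrow> t \<in> {0..2 ^ n} \<Longrightarrow> \<bar>Z t \<omega>\<bar> \<le> 2 * (e * 2 ^ n)"
      by metis
    have "summable (\<lambda>n. prob (A n))"
    proof (rule summable_comparison_test')
      show "summable (\<lambda>n. 2 * C\<^sup>2 / e\<^sup>2 * (1 / 2) ^ n)"
        by (intro summable_mult summable_geometric) auto
      fix n :: nat
      have "2 * C\<^sup>2 * 2 ^ n / (e * 2 ^ n)\<^sup>2 = 2 * C\<^sup>2 / e\<^sup>2 * (1 / 2) ^ n"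
        by (simp add: power_mult_distrib power2_eq_square power_divide)
      then show "norm (prob (A n)) \<le> 2 * C\<^sup>2 / e\<^sup>2 * (1 / 2) ^ n" using A(2)[of n] by simp
    qed
    then have "AE \<omega> in M. \<forall>\<^sub>F n in sequentially. \<omega> \<in> space M - A n"
      using A(1) by (intro borel_cantelli_AE1) (auto simp: emeasure_eq_measure)
    with cont show ?thesis
    proof eventually_elim
      case (elim \<omega>)
      from elim(2) obtain n0 where n0: "\<And>n. n0 \<le> n \<Longrightarrow> \<omega> \<in> space M - A n"
        by (auto simp: eventually_sequentially)
      have "\<bar>Z t \<omega> / t\<bar> \<le> 4 * e" if t: "2 ^ n0 \<le> t" for t :: real
      proof -
        have "1 \<le> t" using t one_le_power[of 2 n0] by (meson order_trans one_le_numeral)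
        define n where "n = nat \<lfloor>log 2 t\<rfloor>"
        have "0 \<le> log 2 t" using \<open>1 \<le> t\<close> by simp
        then have n: "real n \<le> log 2 t" "log 2 t < real (Suc n)" unfolding n_def by linarith+
        have n': "2 ^ n \<le> t" "t \<le> 2 ^ Suc n"
        proof -
          have "2 powr real n \<le> t" "t < 2 powr real (Suc n)"
            using n \<open>1 \<le> t\<close> by (simp_all only: le_log_iff log_less_iff)
          then show "2 ^ n \<le> t" "t \<le> 2 ^ Suc n" by (simp_all add: powr_realpow del: of_nat_Suc power_Suc)
        qed
        have "n0 \<le> n"
        proof (rule ccontr)
          assume "\<not> n0 \<le> n"
          then have "real (Suc n) \<le> real n0" by simp
          moreover have "real n0 \<le> log 2 t" using t \<open>1 \<le> t\<close> by (simp add: le_log_iff powr_realpow)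
          ultimately show False using n(2) by linarith
        qed
        then have "\<bar>Z t \<omega>\<bar> \<le> 2 * (e * 2 ^ Suc n)"
          using A(3)[of \<omega> "Suc n" t] n0[of "Suc n"] elim(1) n' \<open>1 \<le> t\<close> by auto
        also have "\<dots> = 4 * e * 2 ^ n" by simp
        also have "\<dots> \<le> 4 * e * t" using n' e by (intro mult_left_mono) auto
        finally show ?thesis using \<open>1 \<le> t\<close> by (simp add: pos_divide_le_eq)
      qed
      then show ?case by (auto simp: eventually_at_top_linorder)
    qed
  qed
  have "AE \<omega> in M. \<forall>i::nat. \<forall>\<^sub>F t in at_top. \<bar>Z t \<omega> / t\<bar> \<le> 4 * (1 / real (Suc i))"
    by (subst AE_all_countable) (intro allI ev, simp)
  then show ?thesis
  proof eventually_elim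
    case (elim \<omega>)
    show ?case
    proof (rule tendstoI)
      fix \<epsilon> :: real assume "0 < \<epsilon>"
      then obtain i where i: "1 / real (Suc i) < \<epsilon> / 4" using nat_approx_posE[of "\<epsilon> / 4"] by auto
      from elim have "\<forall>\<^sub>F t in at_top. \<bar>Z t \<omega> / t\<bar> \<le> 4 * (1 / real (Suc i))" by blast
      then show "\<forall>\<^sub>F t in at_top. dist (Z t \<omega> / t) 0 < \<epsilon>"
        by eventually_elim (use i in \<open>simp add: dist_real_def\<close>)
    qed
  qed
qed

end

section \<open>Limits of translates of a curve\<close>

lemma lipschitz_AE_has_vector_derivative:
  fixes f :: "real \<Rightarrow> 'v::euclidean_space"
  assumes L: "L-lipschitz_on UNIV f"
  shows "AE x in lborel. \<exists>D. (f has_vector_derivative D) (at x)"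
proof -
  have "AE x in lborel. \<exists>D. ((\<lambda>x. f x \<bullet> b) has_real_derivative D) (at x)" if "b \<in> Basis" for b
  proof (rule lipschitz_AE_differentiable_real)
    show "L-lipschitz_on UNIV (\<lambda>x. f x \<bullet> b)"
    proof (rule lipschitz_onI)
      fix x y
      have "dist (f x \<bullet> b) (f y \<bullet> b) = \<bar>(f x - f y) \<bullet> b\<bar>" by (simp add: dist_real_def inner_diff_left)
      also have "\<dots> \<le> dist (f x) (f y)" using Basis_le_norm[OF that] by (simp add: dist_norm)
      also have "\<dots> \<le> L * dist x y" using lipschitz_onD[OF L] by simp
      finally show "dist (f x \<bullet> b) (f y \<bullet> b) \<le> L * dist x y" .
    qed (rule lipschitz_on_nonneg[OF L])
  qed
  then have "AE x in lborel. \<forall>b\<in>Basis. \<exists>D. ((\<lambda>x. f x \<bullet> b) has_real_derivative D) (at x)"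
    by (intro AE_finite_allI) auto
  then show ?thesis
  proof eventually_elim
    case (elim x)
    then obtain D where D: "\<And>b. b \<in> Basis \<Longrightarrow> ((\<lambda>x. f x \<bullet> b) has_real_derivative D b) (at x)" by metis
    have "((\<lambda>x. \<Sum>b\<in>Basis. (f x \<bullet> b) *\<^sub>R b) has_vector_derivative (\<Sum>b\<in>Basis. D b *\<^sub>R b)) (at x)"
    proof (rule has_vector_derivative_sum)
      fix b :: 'v assume "b \<in> Basis"
      from D[OF this] show "((\<lambda>x. (f x \<bullet> b) *\<^sub>R b) has_vector_derivative D b *\<^sub>R b) (at x)"
        by (auto intro!: derivative_eq_intros)
    qed
    then show ?case by (auto simp: euclidean_representation)
  qed
qed

lemma lipschitz_abs_continuous_on:
  assumes L: "L-lipschitz_on I f"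
  shows "abs_continuous_on I f"
  unfolding abs_continuous_on_def
proof (intro allI impI)
  fix e :: real assume "0 < e"
  have L0: "0 \<le> L" by (rule lipschitz_on_nonneg[OF L])
  show "\<exists>\<delta>>0. \<forall>D S. D division_of S \<and> S \<subseteq> I \<and> (\<Sum>K\<in>D. Sup K - Inf K) < \<delta> \<longrightarrow>
        (\<Sum>K\<in>D. norm (f (Sup K) - f (Inf K))) < e"
  proof (intro exI[of _ "e / (L + 1)"] conjI allI impI; (elim conjE)?)
    \<comment> \<open>\<open>L + 1\<close> in place of \<open>L\<close> keeps the quotient
      meaningful when \<open>L = 0\<close>.\<close>
    show "0 < e / (L + 1)" using \<open>0 < e\<close> L0 by simp
    fix D S assume D: "D division_of S" "S \<subseteq> I" "(\<Sum>K\<in>D. Sup K - Inf K) < e / (L + 1)"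
    have K: "Inf K \<in> I \<and> Sup K \<in> I \<and> Inf K \<le> Sup K" if KD: "K \<in> D" for K
    proof -
      obtain a b where ab: "K = cbox a b" using division_ofD(4)[OF D(1) KD] by blast
      moreover have "K \<noteq> {}" "K \<subseteq> I" using division_ofD(2,3)[OF D(1) KD] D(2) by auto
      ultimately show ?thesis by auto
    qed
    have "(\<Sum>K\<in>D. norm (f (Sup K) - f (Inf K))) \<le> (\<Sum>K\<in>D. L * (Sup K - Inf K))"
      by (rule sum_mono) (use K lipschitz_onD[OF L] in \<open>fastforce simp: dist_norm\<close>)
    also have "\<dots> \<le> (L + 1) * (\<Sum>K\<in>D. Sup K - Inf K)"
      unfolding sum_distrib_left using K L0 by (intro sum_mono mult_right_mono) auto
    also have "\<dots> < e" using D(3) L0 by (simp add: pos_less_divide_eq mult.commute)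
    finally show "(\<Sum>K\<in>D. norm (f (Sup K) - f (Inf K))) < e" .
  qed
qed

text \<open>The Arzela-Ascoli argument on the whole line: a subsequence converges at all rational
  shifts, and the common Lipschitz constant carries the Cauchy property to real shifts.\<close>

lemma convergent_translates:
  fixes z :: "real \<Rightarrow> 'v::euclidean_space" and \<tau> :: "nat \<Rightarrow> real"
  assumes L: "L-lipschitz_on UNIV z" and b: "\<And>s. norm (z s) \<le> C"
  obtains k w where "strict_mono (k :: nat \<Rightarrow> nat)" "\<And>s. (\<lambda>n. z (\<tau> (k n) + s)) \<longlonglongrightarrow> w s"
proof -
  obtain k where k: "strict_mono (k :: nat \<Rightarrow> nat)"
    "\<And>x. x \<in> \<rat> \<Longrightarrow> \<exists>l. (\<lambda>n. z (\<tau> (k n) + x)) \<longlonglongrightarrow> l"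
    by (rule function_convergent_subsequence[of "\<rat>" "\<lambda>n x. z (\<tau> n + x)" C]) (use b countable_rat in auto)
  have "convergent (\<lambda>n. z (\<tau> (k n) + s))" for s
  proof (rule Cauchy_convergent, rule metric_CauchyI)
    fix e :: real assume "0 < e"
    have L0: "0 \<le> L" by (rule lipschitz_on_nonneg[OF L])
    define d where "d = e / 3 / (L + 1)"
    have "0 < d" using \<open>0 < e\<close> L0 by (simp add: d_def)
    then obtain q where q: "q \<in> \<rat>" "s < q" "q < s + d" using Rats_dense_in_real[of s "s + d"] by auto
    have zq: "dist (z (r + s)) (z (r + q)) < e / 3" for r
    proof -
      have "dist (z (r + s)) (z (r + q)) \<le> L * \<bar>s - q\<bar>"
        using lipschitz_onD[OF L, of "r + s" "r + q"] by (simp add: dist_real_def)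
      also have "\<dots> \<le> (L + 1) * \<bar>s - q\<bar>" by (intro mult_right_mono) auto
      also have "\<dots> < (L + 1) * d" using q L0 by (intro mult_strict_left_mono) auto
      also have "\<dots> = e / 3" unfolding d_def using L0 by (intro nonzero_mult_div_cancel_left[of "L + 1", unfolded times_divide_eq_right[symmetric]]) auto
      finally show ?thesis .
    qed
    from k(2)[OF q(1)] have "Cauchy (\<lambda>n. z (\<tau> (k n) + q))" using convergent_Cauchy convergent_def by blast
    then obtain N where N: "\<And>m n. N \<le> m \<Longrightarrow> N \<le> n \<Longrightarrow> dist (z (\<tau> (k m) + q)) (z (\<tau> (k n) + q)) < e / 3"
      using \<open>0 < e\<close> unfolding Cauchy_def by (meson divide_pos_pos zero_less_numeral)
    show "\<exists>N. \<forall>m\<ge>N. \<forall>n\<ge>N. dist (z (\<tau> (k m) + s)) (z (\<tau> (k n) + s)) < e"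
    proof (intro exI allI impI)
      fix m n assume "N \<le> m" "N \<le> n"
      show "dist (z (\<tau> (k m) + s)) (z (\<tau> (k n) + s)) < e"
        by (rule dist_triangle_third[OF zq N zq[unfolded dist_commute[of "z (_ + s)"]]]) fact+
    qed
  qed
  then show thesis using that[OF k(1)] unfolding convergent_def by metis
qed

lemma lipschitz_pointwise_limit:
  fixes f :: "nat \<Rightarrow> 'a::metric_space \<Rightarrow> 'b::metric_space"
  assumes "\<And>n. L-lipschitz_on S (f n)" and "\<And>s. s \<in> S \<Longrightarrow> (\<lambda>n. f n s) \<longlonglongrightarrow> w s"
  shows "L-lipschitz_on S w"
proof (rule lipschitz_onI)
  show "0 \<le> L" by (rule lipschitz_on_nonneg[OF assms(1)])
  fix x y assume xy: "x \<in> S" "y \<in> S"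
  have "(\<lambda>n. dist (f n x) (f n y)) \<longlonglongrightarrow> dist (w x) (w y)" by (intro tendsto_dist assms xy)
  then show "dist (w x) (w y) \<le> L * dist x y"
    by (rule LIMSEQ_le_const2) (use lipschitz_onD[OF assms(1) xy] in blast)
qed

text \<open>Convergence at the finitely many multiples of \<open>r\<close> controls the whole
  window, because all functions involved move by less than \<open>e / 3\<close> over a distance
  below \<open>r\<close>.\<close>

lemma lipschitz_pointwise_limit_uniform:
  fixes f :: "nat \<Rightarrow> real \<Rightarrow> 'b::metric_space"
  assumes L: "\<And>n. L-lipschitz_on UNIV (f n)" and lim: "\<And>s. (\<lambda>n. f n s) \<longlonglongrightarrow> w s" and e: "0 < e"
  shows "\<forall>\<^sub>F n in sequentially. \<forall>s\<in>{0..T}. dist (f n s) (w s) < e"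
proof -
  have Lw: "L-lipschitz_on UNIV w" by (rule lipschitz_pointwise_limit[OF L lim])
  have L0: "0 \<le> L" by (rule lipschitz_on_nonneg[OF Lw])
  define r where "r = e / 3 / (L + 1)"
  have r: "0 < r" using e L0 by (simp add: r_def)
  have near: "dist (g s) (g t) < e / 3" if "L-lipschitz_on UNIV g" "\<bar>s - t\<bar> < r" for g :: "real \<Rightarrow> 'b" and s t
  proof -
    have "dist (g s) (g t) \<le> L * \<bar>s - t\<bar>"
      using lipschitz_onD[OF that(1)] by (simp add: dist_real_def)
    also have "\<dots> \<le> (L + 1) * \<bar>s - t\<bar>" by (intro mult_right_mono) auto
    also have "\<dots> < (L + 1) * r" using that L0 by (intro mult_strict_left_mono) auto
    also have "\<dots> = e / 3" unfolding r_def using L0 by (intro nonzero_mult_div_cancel_left[of "L + 1", unfolded times_divide_eq_right[symmetric]]) auto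
    finally show ?thesis .
  qed
  define N where "N = nat \<lfloor>T / r\<rfloor>"
  have "\<forall>\<^sub>F n in sequentially. \<forall>k\<in>{..N}. dist (f n (real k * r)) (w (real k * r)) < e / 3"
    by (intro eventually_ball_finite ballI tendstoD[OF lim]) (use e in auto)
  then show ?thesis
  proof eventually_elim
    case (elim n)
    show ?case
    proof
      fix s assume s: "s \<in> {0..T}"
      define k where "k = nat \<lfloor>s / r\<rfloor>"
      have "0 \<le> s / r" using s r by simp
      then have k: "real k \<le> s / r" "s / r < real k + 1" unfolding k_def by linarith+
      have "k \<le> N" unfolding k_def N_def using s r by (intro nat_mono floor_mono divide_right_mono) auto
      have "\<bar>s - real k * r\<bar> < r" using k r by (simp add: pos_le_divide_eq pos_divide_less_eq algebra_simps abs_less_iff)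
      then have *: "dist (g s) (g (real k * r)) < e / 3" if "L-lipschitz_on UNIV g" for g :: "real \<Rightarrow> 'b"
        using near[OF that] by blast
      have "dist (f n (real k * r)) (w (real k * r)) < e / 3" using elim \<open>k \<le> N\<close> by simp
      then show "dist (f n s) (w s) < e"
        by (rule dist_triangle_third[OF *[OF L] _ *[OF Lw, unfolded dist_commute[of "w s"]]])
    qed
  qed
qed

text \<open>The limit of translates of a curve inherits at every point of differentiability each linear
  inequality that holds asymptotically for the velocities; no weak compactness is needed.\<close>

lemma limit_velocity_ge:
  fixes z \<xi> :: "real \<Rightarrow> 'v::euclidean_space"
  assumes z: "\<And>s. (z has_vector_derivative \<xi> s - z s) (at s)" and L: "L-lipschitz_on UNIV z"
    and lim: "\<And>s. (\<lambda>n. z (\<tau> n + s)) \<longlonglongrightarrow> w s"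
    and d: "(w has_vector_derivative d) (at t)"
    and ge: "\<And>\<kappa>. 0 < \<kappa> \<Longrightarrow> \<exists>\<rho>>0. \<forall>\<^sub>F n in sequentially. \<forall>r\<in>{t<..<t+\<rho>}. m - \<kappa> \<le> c \<bullet> \<xi> (\<tau> n + r)"
  shows "m \<le> c \<bullet> (d + w t)"
proof (rule field_le_epsilon)
  fix \<kappa> :: real assume "0 < \<kappa>"
  then obtain \<rho> where \<rho>: "0 < \<rho>"
    and ev: "\<forall>\<^sub>F n in sequentially. \<forall>r\<in>{t<..<t+\<rho>}. m - \<kappa> \<le> c \<bullet> \<xi> (\<tau> n + r)"
    using ge by blast
  \<comment> \<open>The mean value theorem applies to the scalar function
    \<open>c \<bullet> z\<close>; the error \<open>norm c * L * h\<close> covers the motion of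
    \<open>z\<close> up to the intermediate point. Only \<open>z\<close> is passed to the limit,
    never \<open>\<xi>\<close>.\<close>
  have quot: "m - \<kappa> - c \<bullet> w t - norm c * L * h \<le> (c \<bullet> w (t + h) - c \<bullet> w t) / h" if h: "0 < h" "h < \<rho>" for h
  proof -
    have "\<forall>\<^sub>F n in sequentially. m - \<kappa> - c \<bullet> z (\<tau> n + t) - norm c * L * h \<le> (c \<bullet> z (\<tau> n + (t + h)) - c \<bullet> z (\<tau> n + t)) / h"
      using ev
    proof eventually_elim
      case (elim n)
      have "((\<lambda>r. c \<bullet> z r) has_real_derivative c \<bullet> (\<xi> x - z x)) (at x)" for x
        using has_derivative_inner_right[OF z[of x, unfolded has_vector_derivative_def], of c]
        by (simp add: has_field_derivative_def mult_commute_abs)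
      then have "\<exists>x>\<tau> n + t. x < \<tau> n + (t + h) \<and>
          c \<bullet> z (\<tau> n + (t + h)) - c \<bullet> z (\<tau> n + t) = (\<tau> n + (t + h) - (\<tau> n + t)) * (c \<bullet> (\<xi> x - z x))"
        using h by (intro MVT2) auto
      then obtain x where x: "\<tau> n + t < x" "x < \<tau> n + (t + h)"
        "c \<bullet> z (\<tau> n + (t + h)) - c \<bullet> z (\<tau> n + t) = h * (c \<bullet> (\<xi> x - z x))"
        by auto
      define r where "r = x - \<tau> n"
      have "r \<in> {t<..<t+\<rho>}" using x h by (auto simp: r_def)
      then have "m - \<kappa> \<le> c \<bullet> \<xi> x" using elim by (force simp: r_def)
      moreover have "c \<bullet> z x - c \<bullet> z (\<tau> n + t) \<le> norm c * L * h"
      proof -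
        have "c \<bullet> z x - c \<bullet> z (\<tau> n + t) \<le> norm c * norm (z x - z (\<tau> n + t))"
          unfolding inner_diff_right[symmetric] by (rule norm_cauchy_schwarz)
        also have "\<dots> \<le> norm c * (L * dist x (\<tau> n + t))"
          using lipschitz_onD[OF L, of x "\<tau> n + t"] by (intro mult_left_mono) (auto simp: dist_norm)
        also have "\<dots> \<le> norm c * (L * h)"
          using x lipschitz_on_nonneg[OF L] by (intro mult_left_mono) (auto simp: dist_real_def)
        finally show ?thesis by simp
      qed
      ultimately have "m - \<kappa> - c \<bullet> z (\<tau> n + t) - norm c * L * h \<le> c \<bullet> (\<xi> x - z x)"
        by (simp add: inner_diff_right)
      also have "\<dots> = (c \<bullet> z (\<tau> n + (t + h)) - c \<bullet> z (\<tau> n + t)) / h" using x(3) h by simp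
      finally show ?case .
    qed
    then show ?thesis
      by (rule tendsto_le[OF sequentially_bot, rotated 2]) (use h in \<open>auto intro!: tendsto_intros lim\<close>)
  qed
  have "((\<lambda>r. c \<bullet> w r) has_real_derivative c \<bullet> d) (at t)"
    using has_derivative_inner_right[OF d[unfolded has_vector_derivative_def], of c]
    by (simp add: has_field_derivative_def mult_commute_abs)
  \<comment> \<open>The derivative exists by assumption, so it may be computed from the right only,
    where the inequality for the velocities is available.\<close>
  then have "((\<lambda>h. (c \<bullet> w (t + h) - c \<bullet> w t) / h) \<longlongrightarrow> c \<bullet> d) (at_right 0)"
    unfolding DERIV_def by (rule filterlim_mono) (auto simp: at_le)
  moreover have "((\<lambda>h. m - \<kappa> - c \<bullet> w t - norm c * L * h) \<longlongrightarrow> m - \<kappa> - c \<bullet> w t - norm c * L * 0) (at_right 0)"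
    by (intro tendsto_intros)
  moreover have "\<forall>\<^sub>F h in at_right 0. m - \<kappa> - c \<bullet> w t - norm c * L * h \<le> (c \<bullet> w (t + h) - c \<bullet> w t) / h"
    unfolding eventually_at_right_field using \<rho> quot by auto
  ultimately have "m - \<kappa> - c \<bullet> w t - norm c * L * 0 \<le> c \<bullet> d"
    by (intro tendsto_le[OF trivial_limit_at_right_real])
  then show "m \<le> c \<bullet> (d + w t) + \<kappa>" by (simp add: inner_add_right)
qed

section \<open>Perturbed best response dynamics\<close>

lemma mixed_component_le_1: "x \<in> mixed \<Longrightarrow> x $ i \<le> 1"
  using sum_nonneg_leq_bound[of UNIV "\<lambda>i. x $ i" 1 i] by (simp add: mixed_def)

lemma compact_mixed: "compact (mixed :: (real^'a::finite) set)"
proof -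
  have "closed (mixed :: (real^'a) set)"
    unfolding mixed_def
    by (intro closed_Collect_conj closed_Collect_all closed_Collect_le closed_Collect_eq continuous_intros)
  moreover have "norm x \<le> real CARD('a)" if "x \<in> mixed" for x :: "real^'a"
  proof -
    have "norm x \<le> (\<Sum>i\<in>UNIV. \<bar>x $ i\<bar>)" by (rule norm_le_l1_cart)
    also have "\<dots> \<le> (\<Sum>i\<in>(UNIV::'a set). 1)"
      using that mixed_component_le_1[OF that] by (intro sum_mono) (auto simp: mixed_def)
    finally show ?thesis by simp
  qed
  ultimately show ?thesis by (auto simp: compact_eq_bounded_closed bounded_iff)
qed

lemma axis_mixed: "axis i 1 \<in> (mixed :: (real^'a::finite) set)"
  by (simp add: mixed_def axis_def)

lemma convex_mixed: "convex (mixed :: (real^'a::finite) set)"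
  by (auto simp: convex_def mixed_def sum.distrib sum_distrib_left[symmetric])

lemma compact_profiles: "compact (profiles :: ('a::finite, 'b::finite) profile set)"
  unfolding profiles_def by (intro compact_Times compact_mixed)

lemma convex_profiles: "convex (profiles :: ('a::finite, 'b::finite) profile set)"
  unfolding profiles_def by (intro convex_Times convex_mixed)

text \<open>If the average were outside \<open>S\<close>, a hyperplane would separate it from
  \<open>S\<close>; integrating the separating inequality along \<open>f\<close> is
  contradictory.\<close>

lemma average_mem_closed_convex:
  fixes f :: "real \<Rightarrow> 'v::euclidean_space"
  assumes S: "closed S" "convex S" and t: "0 < t" and f: "continuous_on {0..t} f"
    and fS: "\<And>s. s \<in> {0..t} \<Longrightarrow> f s \<in> S"
  shows "(1 / t) *\<^sub>R integral {0..t} f \<in> S"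
proof (rule ccontr)
  assume "\<not> ?thesis"
  then obtain c b where cb: "c \<bullet> ((1 / t) *\<^sub>R integral {0..t} f) < b" "\<And>x. x \<in> S \<Longrightarrow> b < c \<bullet> x"
    using separating_hyperplane_closed_point[OF S(2,1)] by blast
  have int: "f integrable_on {0..t}" by (rule integrable_continuous_interval[OF f])
  have "integral {0..t} (\<lambda>_. b) \<le> integral {0..t} (\<lambda>s. c \<bullet> f s)"
    using cb(2) fS by (intro integral_le integrable_continuous_interval continuous_intros f) (auto intro: less_imp_le)
  also have "\<dots> = c \<bullet> integral {0..t} f"
    using integral_linear[OF int bounded_linear_inner_right[of c]] by (simp add: o_def)
  finally show False using cb(1) t by (simp add: field_simps)
qed

lemma expected_payoff_axis:
  fixes u :: "'a::finite \<times> 'b::finite \<Rightarrow> real"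
  shows "expected_payoff u (axis \<alpha> 1, y) = (\<Sum>\<beta>\<in>UNIV. y $ \<beta> * u (\<alpha>, \<beta>))"
    "expected_payoff u (x, axis \<beta> 1) = (\<Sum>\<alpha>\<in>UNIV. x $ \<alpha> * u (\<alpha>, \<beta>))"
proof -
  have "(\<Sum>\<beta>\<in>UNIV. axis \<alpha> 1 $ \<alpha>' * y $ \<beta> * u (\<alpha>', \<beta>)) =
      (if \<alpha>' = \<alpha> then \<Sum>\<beta>\<in>UNIV. y $ \<beta> * u (\<alpha>, \<beta>) else 0)" for \<alpha>'
    by (simp add: axis_def)
  then show "expected_payoff u (axis \<alpha> 1, y) = (\<Sum>\<beta>\<in>UNIV. y $ \<beta> * u (\<alpha>, \<beta>))"
    by (simp add: expected_payoff_def)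
  have "x $ \<alpha>' * axis \<beta> 1 $ \<beta>' * u (\<alpha>', \<beta>') = (if \<beta>' = \<beta> then x $ \<alpha>' * u (\<alpha>', \<beta>) else 0)" for \<alpha>' \<beta>'
    by (simp add: axis_def)
  then show "expected_payoff u (x, axis \<beta> 1) = (\<Sum>\<alpha>\<in>UNIV. x $ \<alpha> * u (\<alpha>, \<beta>))"
    by (simp add: expected_payoff_def)
qed

text \<open>Each component involves the strategy of one player only, so the map is jointly linear in
  the pair and commutes with integration in time. Products of strategies, as they occur with three
  or more players, would not.\<close>

lemma bounded_linear_payoff_vec: "bounded_linear (payoff_vec u1 u2)"
proof -
  have "linear (payoff_vec u1 u2)"
    by (rule linearI) (simp_all add: payoff_vec_def expected_payoff_axis vec_eq_iff sum.distrib
        distrib_right sum_distrib_left mult.assoc)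
  then show ?thesis by (simp add: linear_conv_bounded_linear)
qed

text \<open>The payoff vector of one player, padded with zeros, is a linear map on profiles, so both
  players' best response conditions take the same form.\<close>

definition near_best :: "(('a::finite, 'b::finite) profile \<Rightarrow> ('a, 'b) profile) \<Rightarrow> real \<Rightarrow>
    ('a, 'b) profile \<Rightarrow> ('a, 'b) profile \<Rightarrow> bool" where
  "near_best V e x b \<longleftrightarrow> (\<forall>y\<in>profiles. V x \<bullet> y - e \<le> V x \<bullet> b)"

definition payoff1 :: "('a::finite \<times> 'b::finite \<Rightarrow> real) \<Rightarrow> ('a \<times> 'b \<Rightarrow> real) \<Rightarrow> ('a, 'b) profile \<Rightarrow> ('a, 'b) profile" where
  "payoff1 u1 u2 x = (fst (payoff_vec u1 u2 x), 0)"

definition payoff2 :: "('a::finite \<times> 'b::finite \<Rightarrow> real) \<Rightarrow> ('a \<times> 'b \<Rightarrow> real) \<Rightarrow> ('a, 'b) profile \<Rightarrow> ('a, 'b) profile" where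
  "payoff2 u1 u2 x = (0, snd (payoff_vec u1 u2 x))"

lemma bounded_linear_payoff12: "bounded_linear (payoff1 u1 u2)" "bounded_linear (payoff2 u1 u2)"
  unfolding payoff1_def[abs_def] payoff2_def[abs_def]
  by (intro bounded_linear_Pair bounded_linear_zero
      bounded_linear_compose[OF bounded_linear_fst bounded_linear_payoff_vec]
      bounded_linear_compose[OF bounded_linear_snd bounded_linear_payoff_vec])+

lemma best_responses_if_near_best:
  assumes "b \<in> profiles" "near_best (payoff1 u1 u2) 0 x b" "near_best (payoff2 u1 u2) 0 x b"
  shows "b \<in> best_responses u1 u2 x"
proof -
  have b: "fst b \<in> mixed" "snd b \<in> mixed" using assms(1) by (auto simp: profiles_def)
  \<comment> \<open>The padded zero makes the second component of a test profile irrelevant, so any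
    profile with first component \<open>y\<close> will do.\<close>
  have "fst (payoff_vec u1 u2 x) \<bullet> y \<le> fst (payoff_vec u1 u2 x) \<bullet> fst b" if "y \<in> mixed" for y
    using assms(2) that b by (force simp: near_best_def payoff1_def profiles_def inner_prod_def)
  moreover have "snd (payoff_vec u1 u2 x) \<bullet> y \<le> snd (payoff_vec u1 u2 x) \<bullet> snd b" if "y \<in> mixed" for y
    using assms(3) that b by (force simp: near_best_def payoff2_def profiles_def inner_prod_def)
  ultimately show ?thesis
    using b by (auto simp: best_responses_def is_arg_max_def mem_Times_iff not_less)
qed

text \<open>\<open>z\<close> stands for the average in logarithmic time and \<open>\<xi>\<close> for
  the strategy played. Both live on the whole line, because \<open>exp\<close> maps it onto the
  positive times, so translates are total functions without boundary cases.\<close>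

locale perturbed_brd =
  fixes u1 u2 :: "'a::finite \<times> 'b::finite \<Rightarrow> real" and z \<xi> :: "real \<Rightarrow> ('a, 'b) profile"
  assumes z: "(z has_vector_derivative \<xi> s - z s) (at s)"
    and z_mem: "z s \<in> profiles" and \<xi>_mem: "\<xi> s \<in> profiles"
    and near1: "0 < e \<Longrightarrow> \<forall>\<^sub>F s in at_top. near_best (payoff1 u1 u2) e (z s) (\<xi> s)"
    and near2: "0 < e \<Longrightarrow> \<forall>\<^sub>F s in at_top. near_best (payoff2 u1 u2) e (z s) (\<xi> s)"
begin

text \<open>A diameter bound for the profiles is also a Lipschitz constant of \<open>z\<close>,
  because the velocity \<open>\<xi> s - z s\<close> is a difference of two profiles.\<close>

lemma bounds:
  obtains B where "0 < B" "\<And>x y. x \<in> profiles \<Longrightarrow> y \<in> profiles \<Longrightarrow> norm (x - y :: ('a, 'b) profile) \<le> B"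
    "\<And>x. x \<in> profiles \<Longrightarrow> norm (x :: ('a, 'b) profile) \<le> B" "B-lipschitz_on UNIV z"
proof -
  obtain C where C: "0 < C" "\<And>x. x \<in> profiles \<Longrightarrow> norm (x :: ('a, 'b) profile) \<le> C"
    using compact_imp_bounded[OF compact_profiles] unfolding bounded_pos by blast
  have B: "norm (x - y :: ('a, 'b) profile) \<le> 2 * C" if "x \<in> profiles" "y \<in> profiles" for x y
    using norm_triangle_ineq4[of x y] C(2)[OF that(1)] C(2)[OF that(2)] by linarith
  have "(2 * C)-lipschitz_on UNIV z"
  proof (rule bounded_derivative_imp_lipschitz)
    show "(z has_derivative (\<lambda>h. h *\<^sub>R (\<xi> s - z s))) (at s within UNIV)" for s
      using z[of s] by (simp add: has_vector_derivative_def)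
    show "onorm (\<lambda>h. h *\<^sub>R (\<xi> s - z s)) \<le> 2 * C" for s
      by (rule onorm_le) (use B[OF \<xi>_mem z_mem] in \<open>simp add: mult.commute mult_left_mono\<close>)
  qed (use C in auto)
  then show thesis using C B by (intro that[of "2 * C"]) fastforce+
qed

text \<open>Freezing the payoff vector at \<open>w t\<close> turns the best response condition into
  a linear inequality for the velocities with fixed coefficients. Shortly after \<open>t\<close> and
  for late translates, freezing costs \<open>\<kappa> / 2\<close> and approximate optimality another
  \<open>\<kappa> / 2\<close>.\<close>

lemma limit_near_best:
  assumes \<tau>: "filterlim \<tau> at_top sequentially" and lim: "\<And>s. (\<lambda>n. z (\<tau> n + s)) \<longlonglongrightarrow> w s"
    and d: "(w has_vector_derivative d) (at t)"
    and V: "bounded_linear V" and near: "\<And>e. 0 < e \<Longrightarrow> \<forall>\<^sub>F s in at_top. near_best V e (z s) (\<xi> s)"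
  shows "near_best V 0 (w t) (d + w t)"
  unfolding near_best_def
proof
  fix y :: "('a, 'b) profile" assume y: "y \<in> profiles"
  obtain B where B: "0 < B" "\<And>x y. x \<in> profiles \<Longrightarrow> y \<in> profiles \<Longrightarrow> norm (x - y :: ('a, 'b) profile) \<le> B"
    "B-lipschitz_on UNIV z" by (rule bounds) blast
  obtain K where K: "0 < K" "\<And>x. norm (V x) \<le> norm x * K" using bounded_linear.pos_bounded[OF V] by blast
  show "V (w t) \<bullet> y - 0 \<le> V (w t) \<bullet> (d + w t)"
    unfolding diff_0_right
  proof (rule limit_velocity_ge[OF z B(3) lim d])
    fix \<kappa> :: real assume \<kappa>: "0 < \<kappa>"
    \<comment> \<open>The curve stays within \<open>2 * \<delta>\<close> of \<open>w t\<close>: one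
      \<open>\<delta>\<close> for the convergence at \<open>t\<close>, one for moving at speed at
      most \<open>B\<close> during time \<open>\<delta> / B\<close>. With \<open>K\<close> bounding
      \<open>V\<close> and \<open>B\<close> the diameter,
      \<open>2 * \<delta> * K * B = \<kappa> / 2\<close>.\<close>
    define \<delta> where "\<delta> = \<kappa> / (4 * K * B)"
    have \<delta>: "0 < \<delta>" using \<kappa> K B by (simp add: \<delta>_def)
    obtain S where S: "\<And>s. S \<le> s \<Longrightarrow> near_best V (\<kappa> / 2) (z s) (\<xi> s)"
      using near[of "\<kappa> / 2"] \<kappa> by (auto simp: eventually_at_top_linorder)
    have "\<forall>\<^sub>F n in sequentially. S - t \<le> \<tau> n" using \<tau> by (simp add: filterlim_at_top)
    moreover have "\<forall>\<^sub>F n in sequentially. dist (z (\<tau> n + t)) (w t) < \<delta>" by (rule tendstoD[OF lim \<delta>])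
    ultimately have "\<forall>\<^sub>F n in sequentially. \<forall>r\<in>{t<..<t+\<delta>/B}. V (w t) \<bullet> y - \<kappa> \<le> V (w t) \<bullet> \<xi> (\<tau> n + r)"
    proof eventually_elim
      case (elim n)
      show ?case
      proof
        fix r assume r: "r \<in> {t<..<t+\<delta>/B}"
        let ?x = "z (\<tau> n + r)" and ?b = "\<xi> (\<tau> n + r)"
        have "norm (w t - ?x) \<le> 2 * \<delta>"
        proof -
          have "dist (z (\<tau> n + t)) ?x \<le> B * \<bar>t - r\<bar>"
            using lipschitz_onD[OF B(3), of "\<tau> n + t" "\<tau> n + r"] by (simp add: dist_real_def)
          also have "\<dots> \<le> B * (\<delta> / B)" using r B(1) by (intro mult_left_mono) auto
          also have "\<dots> = \<delta>" using B(1) by simp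
          finally have "dist (w t) ?x \<le> 2 * \<delta>"
            using elim(2) dist_triangle[of "w t" ?x "z (\<tau> n + t)"] by (simp add: dist_commute)
          then show ?thesis by (simp add: dist_norm)
        qed
        then have "norm (V (w t - ?x)) \<le> 2 * \<delta> * K"
          using K(2)[of "w t - ?x"] K(1) by (meson mult_right_mono order_trans less_imp_le)
        then have "norm (V (w t - ?x)) * norm (y - ?b) \<le> (2 * \<delta> * K) * B"
          using B(2)[OF y \<xi>_mem, of "\<tau> n + r"] \<delta> K by (intro mult_mono) auto
        also have "\<dots> = \<kappa> / 2" using K B by (simp add: \<delta>_def)
        finally have "V (w t - ?x) \<bullet> (y - ?b) \<le> \<kappa> / 2"
          using norm_cauchy_schwarz[of "V (w t - ?x)" "y - ?b"] by linarith
        moreover have "V ?x \<bullet> y - \<kappa> / 2 \<le> V ?x \<bullet> ?b"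
          using S[of "\<tau> n + r"] elim(1) r y by (auto simp: near_best_def)
        ultimately show "V (w t) \<bullet> y - \<kappa> \<le> V (w t) \<bullet> ?b"
          by (simp add: bounded_linear.linear[OF V, THEN linear_diff] inner_diff_left inner_diff_right)
      qed
    qed
    then show "\<exists>\<rho>>0. \<forall>\<^sub>F n in sequentially. \<forall>r\<in>{t<..<t+\<rho>}. V (w t) \<bullet> y - \<kappa> \<le> V (w t) \<bullet> \<xi> (\<tau> n + r)"
      using \<delta> B(1) by (intro exI[of _ "\<delta> / B"]) auto
  qed
qed

lemma limit_brd_solution:
  assumes \<tau>: "filterlim \<tau> at_top sequentially" and lim: "\<And>s. (\<lambda>n. z (\<tau> n + s)) \<longlonglongrightarrow> w s"
  shows "brd_solution u1 u2 w"
proof -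
  obtain B where B: "B-lipschitz_on UNIV z" by (rule bounds) blast
  have "B-lipschitz_on UNIV (\<lambda>s. z (\<tau> n + s))" for n
    using lipschitz_on_compose2[of 1 UNIV "\<lambda>s. \<tau> n + s" B z] B
    by (simp add: lipschitz_on_def)
  then have L: "B-lipschitz_on UNIV w" by (rule lipschitz_pointwise_limit[OF _ lim])
  have w_mem: "w s \<in> profiles" for s
    by (rule closed_sequentially[OF compact_imp_closed[OF compact_profiles] _ lim]) (rule z_mem)
  have br: "d \<in> (\<lambda>b. b - w t) ` best_responses u1 u2 (w t)" if d: "(w has_vector_derivative d) (at t)" for t d
  proof -
    \<comment> \<open>The values of \<open>\<xi>\<close> need not converge, but a half-space
      containing all profiles contains each of them, and such a linear inequality survives for
      \<open>d + w t\<close>.\<close>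
    have "d + w t \<in> profiles"
    proof (rule ccontr)
      assume "d + w t \<notin> profiles"
      then obtain c b where cb: "c \<bullet> (d + w t) < b" "\<And>x. x \<in> profiles \<Longrightarrow> b < c \<bullet> x"
        using separating_hyperplane_closed_point[OF convex_profiles compact_imp_closed[OF compact_profiles]] by blast
      have "b \<le> c \<bullet> (d + w t)"
      proof (rule limit_velocity_ge[OF z B lim d])
        fix \<kappa> :: real assume "0 < \<kappa>"
        then have "b - \<kappa> \<le> c \<bullet> \<xi> s" for s using cb(2)[OF \<xi>_mem, of s] by linarith
        then show "\<exists>\<rho>>0. \<forall>\<^sub>F n in sequentially. \<forall>r\<in>{t<..<t+\<rho>}. b - \<kappa> \<le> c \<bullet> \<xi> (\<tau> n + r)"
          by (intro exI[of _ 1]) simp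
      qed
      then show False using cb by simp
    qed
    then have "d + w t \<in> best_responses u1 u2 (w t)"
      using limit_near_best[OF \<tau> lim d bounded_linear_payoff12(1) near1]
        limit_near_best[OF \<tau> lim d bounded_linear_payoff12(2) near2]
      by (rule best_responses_if_near_best)
    then show ?thesis by (intro image_eqI[of _ _ "d + w t"]) auto
  qed
  have "AE t in lborel. \<exists>d. (w has_vector_derivative d) (at t)"
    by (rule lipschitz_AE_has_vector_derivative[OF L])
  then have "AE t in lborel. 0 \<le> t \<longrightarrow> (\<exists>d. (w has_vector_derivative d) (at t) \<and>
      d \<in> (\<lambda>b. b - w t) ` best_responses u1 u2 (w t))"
    by (rule eventually_mono) (use br in blast)
  moreover have "abs_continuous_on {0..T} w" for T
    by (rule lipschitz_abs_continuous_on[OF lipschitz_on_subset[OF L]]) simp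
  ultimately show ?thesis unfolding brd_solution_def using w_mem by blast
qed

text \<open>\<open>in_L\<close> and \<open>of_L\<close> are the two halves of being the limit set:
  limits along late times belong to it, and each of its points is approached at arbitrarily late
  times.\<close>

lemma internally_chain_transitive_limit_set:
  assumes L: "closed L"
    and in_L: "\<And>\<tau> p. filterlim \<tau> at_top sequentially \<Longrightarrow> (\<lambda>n. z (\<tau> n)) \<longlonglongrightarrow> p \<Longrightarrow> p \<in> L"
    and of_L: "\<And>p S e. p \<in> L \<Longrightarrow> 0 < e \<Longrightarrow> \<exists>s\<ge>S. norm (z s - p) < e"
  shows "internally_chain_transitive u1 u2 L"
proof -
  obtain B where B: "B-lipschitz_on UNIV z" "\<And>x. x \<in> profiles \<Longrightarrow> norm (x :: ('a, 'b) profile) \<le> B"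
    by (rule bounds) blast
  have sub: "L \<subseteq> profiles"
  proof
    fix p assume "p \<in> L"
    have "p \<in> closure profiles"
      unfolding closure_approachable
    proof (intro allI impI)
      fix e :: real assume "0 < e"
      then obtain s where "norm (z s - p) < e" using of_L[OF \<open>p \<in> L\<close>] by blast
      then show "\<exists>y\<in>profiles. dist y p < e" using z_mem by (auto simp: dist_norm)
    qed
    then show "p \<in> profiles" by (simp add: closure_closed[OF compact_imp_closed[OF compact_profiles]])
  qed
  \<comment> \<open>If this failed at arbitrarily late times, a subsequence of the corresponding
    translates would converge, uniformly on the window, to a solution inside \<open>L\<close>, which
    then shadows one of them.\<close>
  have shadow: "\<exists>\<tau>0. \<forall>\<tau>\<ge>\<tau>0. \<exists>w. brd_solution u1 u2 w \<and> (\<forall>s. w s \<in> L) \<and> (\<forall>s\<in>{0..T}. norm (z (\<tau> + s) - w s) < e)"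
    if e: "0 < e" for e T :: real
  proof (rule ccontr)
    assume "\<not> ?thesis"
    then have "\<forall>n. \<exists>\<tau>\<ge>real n. \<not> (\<exists>w. brd_solution u1 u2 w \<and> (\<forall>s. w s \<in> L) \<and> (\<forall>s\<in>{0..T}. norm (z (\<tau> + s) - w s) < e))"
      by blast
    then obtain \<tau> where \<tau>: "\<And>n. real n \<le> \<tau> n"
      "\<And>n. \<not> (\<exists>w. brd_solution u1 u2 w \<and> (\<forall>s. w s \<in> L) \<and> (\<forall>s\<in>{0..T}. norm (z (\<tau> n + s) - w s) < e))"
      by metis
    obtain k w where k: "strict_mono k" and lim: "\<And>s. (\<lambda>n. z (\<tau> (k n) + s)) \<longlonglongrightarrow> w s"
      by (rule convergent_translates[OF B(1), of B \<tau>]) (use B(2) z_mem in auto)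
    have "filterlim \<tau> at_top sequentially"
      by (rule filterlim_at_top_mono[OF filterlim_real_sequentially]) (use \<tau>(1) in auto)
    then have \<tau>k: "filterlim (\<lambda>n. \<tau> (k n)) at_top sequentially"
      by (rule filterlim_compose) (rule filterlim_subseq[OF k])
    have "w s \<in> L" for s
    proof (rule in_L[OF _ lim])
      show "filterlim (\<lambda>n. \<tau> (k n) + s) at_top sequentially"
        using filterlim_tendsto_add_at_top[OF tendsto_const \<tau>k, of s] by (simp add: add.commute)
    qed
    moreover have "brd_solution u1 u2 w" by (rule limit_brd_solution[OF \<tau>k lim])
    moreover have "\<forall>\<^sub>F n in sequentially. \<forall>s\<in>{0..T}. dist (z (\<tau> (k n) + s)) (w s) < e"
    proof (rule lipschitz_pointwise_limit_uniform[OF _ lim e])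
      show "B-lipschitz_on UNIV (\<lambda>s. z (\<tau> (k n) + s))" for n
        using B(1) lipschitz_on_compose2[of 1 UNIV "\<lambda>s. \<tau> (k n) + s" B z] by (simp add: lipschitz_on_def)
    qed
    then obtain n where "\<forall>s\<in>{0..T}. dist (z (\<tau> (k n) + s)) (w s) < e"
      by (auto dest: eventually_happens)
    ultimately show False using \<tau>(2)[of "k n"] by (auto simp: dist_norm)
  qed
  show ?thesis
    unfolding internally_chain_transitive_def
  proof (intro conjI ballI allI impI)
    show "compact L" using compact_Int_closed[OF compact_profiles L] sub by (simp add: Int_absorb1)
    show "L \<subseteq> profiles" by (rule sub)
    fix x y :: "('a, 'b) profile" and e T :: real
    assume xy: "x \<in> L" "y \<in> L" and e: "0 < e" and T: "0 < T"
    obtain \<tau>0 where \<tau>0: "\<And>\<tau>. \<tau>0 \<le> \<tau> \<Longrightarrow> \<exists>w. brd_solution u1 u2 w \<and> (\<forall>s. w s \<in> L) \<and>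
        (\<forall>s\<in>{0..2 * (T + 1)}. norm (z (\<tau> + s) - w s) < e / 2)"
      using shadow[of "e / 2" "2 * (T + 1)"] e by auto
    obtain a where a: "\<tau>0 \<le> a" "norm (z a - x) < e / 2" using of_L[OF xy(1), of "e/2" \<tau>0] e by auto
    obtain b where b: "a + (T + 1) \<le> b" "norm (z b - y) < e / 2" using of_L[OF xy(2), of "e/2" "a + (T + 1)"] e by auto
    \<comment> \<open>\<open>n\<close> is the largest number of equal pieces of length at least
      \<open>T + 1\<close>. As \<open>n \<ge> 1\<close>, their length is at most
      \<open>2 * (T + 1)\<close>, so one shadowing threshold serves every piece. The added 1 gives
      \<open>t > T\<close> strictly.\<close>
    define n where "n = nat \<lfloor>(b - a) / (T + 1)\<rfloor>"
    define t where "t = (b - a) / real n"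
    have "1 \<le> (b - a) / (T + 1)" using b T by simp
    then have n: "1 \<le> n" "real n \<le> (b - a) / (T + 1)" "(b - a) / (T + 1) < real n + 1"
      unfolding n_def by linarith+
    have t: "T + 1 \<le> t" "t \<le> 2 * (T + 1)"
    proof -
      show "T + 1 \<le> t" using n T by (simp add: t_def field_simps)
      have "b - a < (real n + 1) * (T + 1)" using n(3) T by (simp add: pos_divide_less_eq)
      also have "\<dots> \<le> (2 * real n) * (T + 1)" using n(1) T by (intro mult_right_mono) auto
      finally show "t \<le> 2 * (T + 1)" using n(1) by (simp add: t_def pos_divide_le_eq mult.commute mult.left_commute)
    qed
    \<comment> \<open>Pieces are numbered from 1, hence \<open>real i - 1\<close>.\<close>
    define start where "start i = a + (real i - 1) * t" for i :: nat
    have "real n * t = b - a" using n(1) by (simp add: t_def)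
    then have start: "start 1 = a" "start (Suc i) = start i + t" "start n + t = b" for i
      by (simp_all add: start_def algebra_simps)
    have "\<exists>w. brd_solution u1 u2 w \<and> (\<forall>s. w s \<in> L) \<and> (\<forall>s\<in>{0..2 * (T + 1)}. norm (z (start i + s) - w s) < e / 2)"
      if "1 \<le> i" for i
    proof (rule \<tau>0)
      have "0 \<le> (real i - 1) * t" using that t T by simp
      then show "\<tau>0 \<le> start i" using a by (simp add: start_def)
    qed
    then obtain c where c: "\<And>i. 1 \<le> i \<Longrightarrow> brd_solution u1 u2 (c i)" "\<And>i s. 1 \<le> i \<Longrightarrow> c i s \<in> L"
      "\<And>i s. 1 \<le> i \<Longrightarrow> s \<in> {0..2 * (T + 1)} \<Longrightarrow> norm (z (start i + s) - c i s) < e / 2"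
      by metis
    \<comment> \<open>At a junction consecutive solutions shadow the same point of \<open>z\<close>,
      each within \<open>e / 2\<close>; the same estimate handles both ends.\<close>
    have two: "norm (p - q) \<le> e" if "norm (r - p) < e / 2" "norm (r - q) < e / 2" for p q r :: "('a, 'b) profile"
      using norm_triangle_ineq4[of "r - q" "r - p"] that by simp
    show "\<exists>n c t. n \<ge> 1 \<and>
          (\<forall>i\<in>{1..n}. brd_solution u1 u2 (c i) \<and> t i > T \<and> (\<forall>s\<in>{0..t i}. c i s \<in> L)) \<and>
          (\<forall>i\<in>{1..<n}. norm (c i (t i) - c (Suc i) 0) \<le> e) \<and>
          norm (c 1 0 - x) \<le> e \<and> norm (c n (t n) - y) \<le> e"
    proof (intro exI[of _ n] exI[of _ c] exI[of _ "\<lambda>_. t"] conjI ballI)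
      fix i assume "i \<in> {1..<n}"
      then show "norm (c i t - c (Suc i) 0) \<le> e"
        using c(3)[of i t] c(3)[of "Suc i" 0] t T start(2)[of i] by (intro two[of "z (start i + t)"]) auto
    next
      show "norm (c 1 0 - x) \<le> e"
        using c(3)[of 1 0] T start(1) a by (intro two[of "z a"]) auto
      show "norm (c n t - y) \<le> e"
        using c(3)[of n t] T t n start(3) b by (intro two[of "z b"]) auto
    qed (use n c t in auto)
  qed
qed

end

section \<open>Time averages of reinforcement learning\<close>

text \<open>\<open>arg_max_on\<close> is a choice operator, so its value is a maximiser only once
  one exists; compactness of the simplex supplies it.\<close>

lemma choice_map_max:
  assumes h: "continuous_on mixed h"
  shows "choice_map h y \<in> mixed" "x \<in> mixed \<Longrightarrow> y \<bullet> x - h x \<le> y \<bullet> choice_map h y - h (choice_map h y)"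
proof -
  have "continuous_on mixed (\<lambda>x. y \<bullet> x - h x)" by (intro continuous_intros h)
  then obtain x0 where "x0 \<in> mixed" "\<And>x'. x' \<in> mixed \<Longrightarrow> y \<bullet> x' - h x' \<le> y \<bullet> x0 - h x0"
    using continuous_attains_sup[OF compact_mixed, of "\<lambda>x. y \<bullet> x - h x"] axis_mixed by auto
  then have "is_arg_max (\<lambda>x. y \<bullet> x - h x) (\<lambda>x. x \<in> mixed) x0"
    by (auto simp: is_arg_max_def not_less)
  then have "is_arg_max (\<lambda>x. y \<bullet> x - h x) (\<lambda>x. x \<in> mixed) (choice_map h y)"
    unfolding choice_map_def arg_max_on_def arg_max_def by (rule someI)
  then show "choice_map h y \<in> mixed" "x \<in> mixed \<Longrightarrow> y \<bullet> x - h x \<le> y \<bullet> choice_map h y - h (choice_map h y)"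
    by (auto simp: is_arg_max_def not_less)
qed

text \<open>Strong convexity gives the Lipschitz constant \<open>2 / K\<close>: each maximiser is
  compared with the midpoint \<open>m\<close> of the two, and adding the inequalities bounds the
  squared distance of the maximisers by their inner product with \<open>y' - y\<close>.\<close>

lemma continuous_choice_map:
  assumes "penalty h"
  shows "continuous_on UNIV (choice_map h)"
proof -
  have h: "continuous_on mixed h" using assms by (simp add: penalty_def)
  obtain K where K: "0 < K" and conv: "\<And>x x' t. x \<in> mixed \<Longrightarrow> x' \<in> mixed \<Longrightarrow> t \<in> {0..1} \<Longrightarrow>
      h (t *\<^sub>R x + (1 - t) *\<^sub>R x') \<le> t * h x + (1 - t) * h x' - 1/2 * K * t * (1 - t) * (norm (x' - x))\<^sup>2"
    using assms unfolding penalty_def strongly_convex_on_def by blast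
  have "(2 / K)-lipschitz_on UNIV (choice_map h)"
  proof (rule lipschitz_onI)
    fix y y'
    let ?x = "choice_map h y" and ?x' = "choice_map h y'"
    define m where "m = (1/2) *\<^sub>R ?x + (1 - 1/2) *\<^sub>R ?x'"
    note mem = choice_map_max(1)[OF h]
    have "m \<in> mixed" unfolding m_def by (rule convexD[OF convex_mixed mem mem]) auto
    have hm: "h m \<le> h ?x / 2 + h ?x' / 2 - K / 8 * (norm (?x' - ?x))\<^sup>2"
      using conv[OF mem mem, of "1/2" y y'] by (simp add: m_def)
    have "y \<bullet> m - h m \<le> y \<bullet> ?x - h ?x" "y' \<bullet> m - h m \<le> y' \<bullet> ?x' - h ?x'"
      by (rule choice_map_max(2)[OF h \<open>m \<in> mixed\<close>])+
    moreover have "y \<bullet> ?x - y \<bullet> m = (y \<bullet> ?x - y \<bullet> ?x') / 2" "y' \<bullet> ?x' - y' \<bullet> m = (y' \<bullet> ?x' - y' \<bullet> ?x) / 2"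
      by (simp_all add: m_def inner_add_right)
    ultimately have "K / 4 * (norm (?x' - ?x))\<^sup>2 \<le> ((y \<bullet> ?x - y \<bullet> ?x') + (y' \<bullet> ?x' - y' \<bullet> ?x)) / 2"
      using hm by argo
    also have "\<dots> = ((y' - y) \<bullet> (?x' - ?x)) / 2" by (simp add: inner_diff_left inner_diff_right)
    also have "\<dots> \<le> norm (y' - y) * norm (?x' - ?x) / 2"
      by (intro divide_right_mono norm_cauchy_schwarz) simp
    finally have *: "norm (?x' - ?x) * (K / 2 * norm (?x' - ?x)) \<le> norm (?x' - ?x) * norm (y' - y)"
      by (simp add: power2_eq_square algebra_simps)
    have "K / 2 * norm (?x' - ?x) \<le> norm (y' - y)"
    proof (cases "?x' = ?x")
      case False
      then have "0 < norm (?x' - ?x)" by simp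
      with * show ?thesis by (rule mult_left_le_imp_le)
    qed simp
    then show "dist ?x ?x' \<le> 2 / K * dist y y'"
      using K by (simp add: dist_norm norm_minus_commute field_simps)
  qed (use K in simp)
  then show ?thesis by (rule lipschitz_on_continuous_on)
qed

text \<open>The penalty is bounded on the simplex, so a maximiser of the penalised payoff loses at
  most twice that bound in the scaled linear payoff; dividing by \<open>a\<close> gives the rate. It
  is applied with \<open>a = t * \<eta> t\<close> and \<open>y\<close> a component of
  \<open>Y t / t\<close>.\<close>

lemma choice_map_near_best:
  assumes h: "continuous_on mixed h"
  obtains C where "0 \<le> C" "\<And>y x a. 0 < a \<Longrightarrow> x \<in> mixed \<Longrightarrow> y \<bullet> x - C / a \<le> y \<bullet> choice_map h (a *\<^sub>R y)"
proof -
  have "bounded (h ` mixed)" by (intro compact_imp_bounded compact_continuous_image h compact_mixed)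
  then obtain C where C: "\<And>x. x \<in> mixed \<Longrightarrow> \<bar>h x\<bar> \<le> C" by (auto simp: bounded_iff)
  have "y \<bullet> x - 2 * C / a \<le> y \<bullet> choice_map h (a *\<^sub>R y)" if "0 < a" "x \<in> mixed" for y x a
  proof -
    let ?b = "choice_map h (a *\<^sub>R y)"
    have "(a *\<^sub>R y) \<bullet> x - h x \<le> (a *\<^sub>R y) \<bullet> ?b - h ?b" by (rule choice_map_max(2)[OF h that(2)])
    moreover have "\<bar>h x\<bar> \<le> C" "\<bar>h ?b\<bar> \<le> C" using C that choice_map_max(1)[OF h] by auto
    ultimately have "a * (y \<bullet> x) - 2 * C \<le> a * (y \<bullet> ?b)" by simp
    then show ?thesis using that by (simp add: field_simps)
  qed
  moreover have "0 \<le> 2 * C" using C[OF axis_mixed] by (meson abs_ge_zero order_trans mult_nonneg_nonneg zero_le_numeral)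
  ultimately show thesis by (rule that[rotated])
qed

lemma learning_paramD:
  assumes "learning_param \<eta>"
  shows "continuous_on {0..} \<eta>" "0 \<le> t \<Longrightarrow> 0 < \<eta> t" "((\<lambda>t. C / (t * \<eta> t)) \<longlongrightarrow> 0) at_top"
proof -
  obtain \<eta>' where "\<And>t. 0 \<le> t \<Longrightarrow> (\<eta> has_real_derivative \<eta>' t) (at t within {0..})"
    using assms unfolding learning_param_def by blast
  then show "continuous_on {0..} \<eta>" by (intro DERIV_continuous_on) auto
  show "0 \<le> t \<Longrightarrow> 0 < \<eta> t" using assms by (simp add: learning_param_def)
  have "filterlim (\<lambda>t. t * \<eta> t) at_infinity at_top"
    using assms by (auto simp: learning_param_def intro: filterlim_at_top_imp_at_infinity)
  then show "((\<lambda>t. C / (t * \<eta> t)) \<longlongrightarrow> 0) at_top" by (intro tendsto_divide_0[OF tendsto_const])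
qed

lemma coord_bounded_linear: "bounded_linear (coord i)"
proof (cases i)
  case (Inl \<alpha>)
  then show ?thesis unfolding coord_def[abs_def]
    using bounded_linear_compose[OF bounded_linear_vec_nth bounded_linear_fst] by simp
next
  case (Inr \<beta>)
  then show ?thesis unfolding coord_def[abs_def]
    using bounded_linear_compose[OF bounded_linear_vec_nth bounded_linear_snd] by simp
qed

lemma tendsto_profile_coord:
  fixes f :: "_ \<Rightarrow> ('a::finite, 'b::finite) profile"
  assumes "\<And>i. ((\<lambda>t. coord i (f t)) \<longlongrightarrow> coord i l) G"
  shows "(f \<longlongrightarrow> l) G"
proof -
  have "((\<lambda>t. (fst (f t), snd (f t))) \<longlongrightarrow> (fst l, snd l)) G"
    using assms[of "Inl _"] assms[of "Inr _"]
    by (intro tendsto_Pair vec_tendstoI) (auto simp: coord_def)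
  then show ?thesis by simp
qed

lemma time_average_has_vector_derivative:
  fixes x :: "real \<Rightarrow> 'v::euclidean_space"
  assumes x: "continuous_on {0..} x"
  shows "((\<lambda>s. time_average x (exp s)) has_vector_derivative x (exp s) - time_average x (exp s)) (at s)"
proof -
  let ?t = "exp s"
  \<comment> \<open>The interval reaches beyond \<open>exp s\<close>, so that \<open>exp s\<close>
    is interior and the derivative is two-sided.\<close>
  have "((\<lambda>u. integral {0..u} x) has_vector_derivative x ?t) (at ?t within {0..?t + 1})"
    by (rule integral_has_vector_derivative) (use x in \<open>auto intro: continuous_on_subset\<close>)
  moreover have "at ?t within {0..?t + 1} = at ?t" by (rule at_within_interior) simp
  ultimately have "((\<lambda>u. integral {0..u} x) has_vector_derivative x ?t) (at ?t)" by simp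
  then have "((\<lambda>u. integral {0..u} x) \<circ> exp has_vector_derivative exp s *\<^sub>R x ?t) (at s)"
    by (intro vector_diff_chain_at) (auto intro!: derivative_eq_intros simp: has_real_derivative_iff_has_vector_derivative[symmetric])
  then have I: "((\<lambda>s. integral {0..exp s} x) has_vector_derivative exp s *\<^sub>R x ?t) (at s)" by (simp add: o_def)
  have "((\<lambda>s. exp (- s) *\<^sub>R integral {0..exp s} x) has_vector_derivative
      exp (- s) *\<^sub>R (exp s *\<^sub>R x ?t) + (- exp (- s)) *\<^sub>R integral {0..exp s} x) (at s)"
    by (rule has_vector_derivative_scaleR[OF _ I]) (auto intro!: derivative_eq_intros)
  moreover have "exp (- s) *\<^sub>R (exp s *\<^sub>R x ?t) = x ?t" by (simp add: exp_minus)
  ultimately show ?thesis by (simp add: time_average_def exp_minus inverse_eq_divide)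
qed

text \<open>Perturbing the objective by \<open>R t\<close> changes the comparison of two points of
  \<open>S\<close> by at most \<open>norm (R t) * (2 * C)\<close>. The threshold
  \<open>e / (4 * C)\<close> spends half of \<open>e\<close> on this and leaves the other half for
  \<open>D t\<close>.\<close>

lemma near_best_vanishing:
  fixes p :: "real \<Rightarrow> ('v::euclidean_space)"
  assumes R: "(R \<longlongrightarrow> 0) at_top" and D: "(D \<longlongrightarrow> 0) at_top" and S: "bounded S" and e: "0 < e"
    and near: "\<And>t y. 0 < t \<Longrightarrow> y \<in> S \<Longrightarrow> b t \<in> S \<and> (p t + R t) \<bullet> y - D t \<le> (p t + R t) \<bullet> b t"
  shows "\<forall>\<^sub>F t in at_top. \<forall>y\<in>S. p t \<bullet> y - e \<le> p t \<bullet> b t"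
proof -
  obtain C where C: "0 < C" "\<And>x. x \<in> S \<Longrightarrow> norm x \<le> C" using S unfolding bounded_pos by blast
  have "\<forall>\<^sub>F t in at_top. dist (R t) 0 < e / (4 * C)" using R C e by (intro tendstoD) auto
  moreover have "\<forall>\<^sub>F t in at_top. dist (D t) 0 < e / 2" using D e by (intro tendstoD) auto
  moreover have "\<forall>\<^sub>F t in at_top. 0 < (t::real)" by (rule eventually_gt_at_top)
  ultimately show ?thesis
  proof eventually_elim
    case (elim t)
    show ?case
    proof
      fix y assume y: "y \<in> S"
      note nb = near[OF elim(3) y]
      have "norm (b t - y) \<le> 2 * C"
        using norm_triangle_ineq4[of "b t" y] C(2)[OF y] C(2)[of "b t"] nb by linarith
      then have "norm (R t) * norm (b t - y) \<le> e / (4 * C) * (2 * C)"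
        using elim(1) C e by (intro mult_mono) auto
      also have "\<dots> = e / 2" using C by simp
      finally have "R t \<bullet> (b t - y) \<le> e / 2" using norm_cauchy_schwarz[of "R t" "b t - y"] by linarith
      moreover have "(p t + R t) \<bullet> y - D t \<le> (p t + R t) \<bullet> b t" "D t < e / 2" using nb elim(2) by (auto simp: dist_real_def)
      ultimately show "p t \<bullet> y - e \<le> p t \<bullet> b t" by (simp add: inner_add_left inner_diff_right)
    qed
  qed
qed

text \<open>The deterministic core, for one fixed path: all that remains of the noise is that it is
  negligible against \<open>t\<close>.\<close>

lemma reinforcement_path_chain_transitive:
  fixes X Y N :: "real \<Rightarrow> ('a::finite, 'b::finite) profile"
  assumes h: "penalty h1" "penalty h2" and \<eta>: "learning_param \<eta>1" "learning_param \<eta>2"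
    and Y: "continuous_on {0..} Y"
    and X: "\<And>t. 0 \<le> t \<Longrightarrow> X t = (choice_map h1 (\<eta>1 t *\<^sub>R fst (Y t)), choice_map h2 (\<eta>2 t *\<^sub>R snd (Y t)))"
    and scores: "\<And>t i. 0 \<le> t \<Longrightarrow> coord i (Y t) =
        coord i (Y 0) + integral {0..t} (\<lambda>s. coord i (payoff_vec u1 u2 (X s))) + Z i t"
    and Z: "\<And>i. ((\<lambda>t. Z i t / t) \<longlongrightarrow> 0) at_top"
  shows "internally_chain_transitive u1 u2 (omega_limit_set (time_average X))"
proof -
  note hc = h(1)[unfolded penalty_def, THEN conjunct1] h(2)[unfolded penalty_def, THEN conjunct1]
  have Xc: "continuous_on {0..} X"
  proof -
    have "continuous_on {0..} (\<lambda>t. (choice_map h1 (\<eta>1 t *\<^sub>R fst (Y t)), choice_map h2 (\<eta>2 t *\<^sub>R snd (Y t))))"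
      by (intro continuous_intros continuous_on_compose2[OF continuous_choice_map] h
          learning_paramD(1)[OF \<eta>(1)] learning_paramD(1)[OF \<eta>(2)] Y) auto
    then show ?thesis by (rule continuous_on_eq) (use X in auto)
  qed
  have Xm: "X t \<in> profiles" if "0 \<le> t" for t
    using X[OF that] choice_map_max(1)[OF hc(1)] choice_map_max(1)[OF hc(2)] by (simp add: profiles_def)
  let ?x = "time_average X"
  have xm: "?x t \<in> profiles" if "0 < t" for t
    unfolding time_average_def
    by (rule average_mem_closed_convex[OF compact_imp_closed[OF compact_profiles] convex_profiles that])
      (use Xc Xm in \<open>auto intro: continuous_on_subset\<close>)
  \<comment> \<open>By linearity the integrated payoffs divided by \<open>t\<close> are the payoff
    vector at the average, so \<open>R t\<close> consists of the initial score and the noise, both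
    divided by \<open>t\<close>.\<close>
  define R where "R t = (1 / t) *\<^sub>R Y t - payoff_vec u1 u2 (?x t)" for t
  have R: "(R \<longlongrightarrow> 0) at_top"
  proof (rule tendsto_profile_coord)
    fix i :: "'a + 'b"
    interpret c: bounded_linear "coord i :: ('a, 'b) profile \<Rightarrow> real" by (rule coord_bounded_linear)
    have ev: "\<forall>\<^sub>F t in at_top. coord i (Y 0) / t + Z i t / t = coord i (R t)"
      using eventually_gt_at_top[of 0]
    proof eventually_elim
      case (elim t)
      have "X integrable_on {0..t}"
        by (rule integrable_continuous_interval[OF continuous_on_subset[OF Xc]]) auto
      from integral_linear[OF this bounded_linear_compose[OF coord_bounded_linear bounded_linear_payoff_vec]]
      have "integral {0..t} (\<lambda>s. coord i (payoff_vec u1 u2 (X s))) = coord i (payoff_vec u1 u2 (integral {0..t} X))"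
        by (simp add: o_def)
      moreover have "coord i (payoff_vec u1 u2 (?x t)) = coord i (payoff_vec u1 u2 (integral {0..t} X)) / t"
        by (simp add: time_average_def c.scaleR linear_scale[OF bounded_linear.linear[OF bounded_linear_payoff_vec]])
      ultimately show ?case using scores[of t i] elim
        by (simp add: R_def c.diff c.scaleR add_divide_distrib)
    qed
    have "((\<lambda>t. coord i (Y 0) / t + Z i t / t) \<longlongrightarrow> 0 + 0) at_top"
      by (intro tendsto_add Z tendsto_divide_0[OF tendsto_const] filterlim_at_top_imp_at_infinity filterlim_ident)
    then have "((\<lambda>t. coord i (R t)) \<longlongrightarrow> 0 + 0) at_top" by (rule Lim_transform_eventually[OF _ ev])
    then show "((\<lambda>t. coord i (R t)) \<longlongrightarrow> coord i 0) at_top" by (simp add: c.zero)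
  qed
  have Ydec: "(1 / t) *\<^sub>R Y t = payoff_vec u1 u2 (?x t) + R t" for t by (simp add: R_def)
  have at_exp: "filterlim (exp :: real \<Rightarrow> real) at_top at_top" by (rule exp_at_top)
  interpret perturbed_brd u1 u2 "\<lambda>s. ?x (exp s)" "\<lambda>s. X (exp s)"
  proof
    show "((\<lambda>s. ?x (exp s)) has_vector_derivative X (exp s) - ?x (exp s)) (at s)" for s
      by (rule time_average_has_vector_derivative[OF Xc])
    show "?x (exp s) \<in> profiles" "X (exp s) \<in> profiles" for s by (auto intro: xm Xm)
    fix e :: real assume e: "0 < e"
    obtain C1 where C1: "\<And>y x a. 0 < a \<Longrightarrow> x \<in> mixed \<Longrightarrow> y \<bullet> x - C1 / a \<le> y \<bullet> choice_map h1 (a *\<^sub>R y)"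
      by (rule choice_map_near_best[OF hc(1)]) blast
    obtain C2 where C2: "\<And>y x a. 0 < a \<Longrightarrow> x \<in> mixed \<Longrightarrow> y \<bullet> x - C2 / a \<le> y \<bullet> choice_map h2 (a *\<^sub>R y)"
      by (rule choice_map_near_best[OF hc(2)]) blast
    have "\<forall>\<^sub>F t in at_top. \<forall>y\<in>mixed. fst (payoff_vec u1 u2 (?x t)) \<bullet> y - e \<le> fst (payoff_vec u1 u2 (?x t)) \<bullet> fst (X t)"
    proof (rule near_best_vanishing[OF _ learning_paramD(3)[OF \<eta>(1), of C1] compact_imp_bounded[OF compact_mixed] e])
      show "((\<lambda>t. fst (R t)) \<longlongrightarrow> 0) at_top" using tendsto_fst[OF R] by simp
      fix t y assume t: "0 < (t::real)" and y: "(y :: real^'a) \<in> mixed"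
      \<comment> \<open>With \<open>a = t * \<eta>1 t\<close> and the score divided by
        \<open>t\<close>, the vector \<open>a *\<^sub>R y\<close> is exactly the argument
        \<open>\<eta>1 t *\<^sub>R fst (Y t)\<close> of the choice map.\<close>
      have "0 < t * \<eta>1 t" using t learning_paramD(2)[OF \<eta>(1), of t] by simp
      from C1[OF this y, of "fst ((1 / t) *\<^sub>R Y t)"]
      show "fst (X t) \<in> mixed \<and> (fst (payoff_vec u1 u2 (?x t)) + fst (R t)) \<bullet> y - C1 / (t * \<eta>1 t)
          \<le> (fst (payoff_vec u1 u2 (?x t)) + fst (R t)) \<bullet> fst (X t)"
        using t X[of t] choice_map_max(1)[OF hc(1)] by (simp add: Ydec[symmetric] fst_add[symmetric] del: fst_add)
    qed
    then have "\<forall>\<^sub>F t in at_top. near_best (payoff1 u1 u2) e (?x t) (X t)"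
      by eventually_elim (auto simp: near_best_def payoff1_def profiles_def inner_prod_def)
    then show "\<forall>\<^sub>F s in at_top. near_best (payoff1 u1 u2) e (?x (exp s)) (X (exp s))"
      by (rule eventually_compose_filterlim[OF _ at_exp])
    have "\<forall>\<^sub>F t in at_top. \<forall>y\<in>mixed. snd (payoff_vec u1 u2 (?x t)) \<bullet> y - e \<le> snd (payoff_vec u1 u2 (?x t)) \<bullet> snd (X t)"
    proof (rule near_best_vanishing[OF _ learning_paramD(3)[OF \<eta>(2), of C2] compact_imp_bounded[OF compact_mixed] e])
      show "((\<lambda>t. snd (R t)) \<longlongrightarrow> 0) at_top" using tendsto_snd[OF R] by simp
      fix t y assume t: "0 < (t::real)" and y: "(y :: real^'b) \<in> mixed"
      have "0 < t * \<eta>2 t" using t learning_paramD(2)[OF \<eta>(2), of t] by simp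
      from C2[OF this y, of "snd ((1 / t) *\<^sub>R Y t)"]
      show "snd (X t) \<in> mixed \<and> (snd (payoff_vec u1 u2 (?x t)) + snd (R t)) \<bullet> y - C2 / (t * \<eta>2 t)
          \<le> (snd (payoff_vec u1 u2 (?x t)) + snd (R t)) \<bullet> snd (X t)"
        using t X[of t] choice_map_max(1)[OF hc(2)] by (simp add: Ydec[symmetric] snd_add[symmetric] del: snd_add)
    qed
    then have "\<forall>\<^sub>F t in at_top. near_best (payoff2 u1 u2) e (?x t) (X t)"
      by eventually_elim (auto simp: near_best_def payoff2_def profiles_def inner_prod_def)
    then show "\<forall>\<^sub>F s in at_top. near_best (payoff2 u1 u2) e (?x (exp s)) (X (exp s))"
      by (rule eventually_compose_filterlim[OF _ at_exp])
  qed
  show ?thesis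
  proof (rule internally_chain_transitive_limit_set)
    show "closed (omega_limit_set ?x)" by (auto simp: omega_limit_set_def)
  next
    fix \<tau> p assume \<tau>: "filterlim \<tau> at_top sequentially" and lim: "(\<lambda>n. ?x (exp (\<tau> n))) \<longlonglongrightarrow> p"
    show "p \<in> omega_limit_set ?x"
      unfolding omega_limit_set_def
    proof (rule INT_I)
      fix t :: real
      have "filterlim (\<lambda>n. exp (\<tau> n)) at_top sequentially" by (rule filterlim_compose[OF exp_at_top \<tau>])
      then have "\<forall>\<^sub>F n in sequentially. t \<le> exp (\<tau> n)" by (simp add: filterlim_at_top)
      then have "\<forall>\<^sub>F n in sequentially. ?x (exp (\<tau> n)) \<in> closure (?x ` {t..})"
        by eventually_elim (auto intro: subsetD[OF closure_subset])
      then show "p \<in> closure (?x ` {t..})" by (intro Lim_in_closed_set[OF closed_closure _ _ lim]) auto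
    qed
  next
    fix p S and e :: real assume p: "p \<in> omega_limit_set ?x" and "0 < e"
    have "p \<in> closure (?x ` {exp S..})" using p by (auto simp: omega_limit_set_def)
    then obtain t where t: "exp S \<le> t" "dist (?x t) p < e"
      using \<open>0 < e\<close> unfolding closure_approachable by blast
    then have "0 < t" by (meson exp_gt_zero less_le_trans)
    then show "\<exists>s\<ge>S. norm (?x (exp s) - p) < e"
      using t by (intro exI[of _ "ln t"]) (auto simp: ln_ge_iff dist_norm)
  qed
qed

theorem theorem6p3:
  fixes M :: "'w measure"
    and F :: "real \<Rightarrow> 'w measure"
    and W :: "'a::finite + 'b::finite \<Rightarrow> real \<Rightarrow> 'w \<Rightarrow> real"
    and u1 u2 :: "'a \<times> 'b \<Rightarrow> real"
    and \<sigma> :: "'a + 'b \<Rightarrow> ('a, 'b) profile \<Rightarrow> real"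
    and h1 :: "real^'a \<Rightarrow> real"
    and h2 :: "real^'b \<Rightarrow> real"
    and \<eta>1 \<eta>2 :: "real \<Rightarrow> real"
    and X Y :: "real \<Rightarrow> 'w \<Rightarrow> ('a, 'b) profile"
  assumes "filtered_prob_space M F"
    and "wiener_family M F W"
    and "\<And>i. \<exists>C. C-lipschitz_on profiles (\<sigma> i)"
    and "penalty h1" and "penalty h2"
    and "learning_param \<eta>1" and "learning_param \<eta>2"
    and "srl_solution M F W u1 u2 \<sigma> h1 h2 \<eta>1 \<eta>2 X Y"
  shows "AE \<omega> in M. internally_chain_transitive u1 u2
           (omega_limit_set (time_average (\<lambda>t. X t \<omega>)))"
proof -
  have hc: "continuous_on mixed h1" "continuous_on mixed h2"
    using assms(4,5) by (auto simp: penalty_def)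
  have sol: "continuous_paths M Y"
    "\<And>i. \<exists>Z. ito_integral M F (W i) (\<lambda>t \<omega>. \<sigma> i (X t \<omega>)) Z \<and>
        (AE \<omega> in M. \<forall>t\<ge>0. coord i (Y t \<omega>) =
           coord i (Y 0 \<omega>) + integral {0..t} (\<lambda>s. coord i (payoff_vec u1 u2 (X s \<omega>))) + Z t \<omega>)"
    "\<And>t \<omega>. 0 \<le> t \<Longrightarrow> \<omega> \<in> space M \<Longrightarrow> X t \<omega> =
        (choice_map h1 (\<eta>1 t *\<^sub>R fst (Y t \<omega>)), choice_map h2 (\<eta>2 t *\<^sub>R snd (Y t \<omega>)))"
    using assms(8) unfolding srl_solution_def by blast+
  have "\<exists>Z. \<forall>i. ito_integral M F (W i) (\<lambda>t \<omega>. \<sigma> i (X t \<omega>)) (Z i) \<and>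
        (AE \<omega> in M. \<forall>t\<ge>0. coord i (Y t \<omega>) =
           coord i (Y 0 \<omega>) + integral {0..t} (\<lambda>s. coord i (payoff_vec u1 u2 (X s \<omega>))) + Z i t \<omega>)"
    by (intro choice allI sol(2))
  then obtain Z where ito: "\<And>i. ito_integral M F (W i) (\<lambda>t \<omega>. \<sigma> i (X t \<omega>)) (Z i)"
    and scores: "\<And>i. AE \<omega> in M. \<forall>t\<ge>0. coord i (Y t \<omega>) =
           coord i (Y 0 \<omega>) + integral {0..t} (\<lambda>s. coord i (payoff_vec u1 u2 (X s \<omega>))) + Z i t \<omega>"
    by blast
  have Z: "AE \<omega> in M. ((\<lambda>t. Z i t \<omega> / t) \<longlongrightarrow> 0) at_top" for i
  proof -
    interpret wiener M F "W i" by (rule wiener_familyD[OF assms(1,2)])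
    \<comment> \<open>A Lipschitz coefficient is bounded on the compact set of profiles, and
      \<open>X\<close> takes its values there; this yields the constant \<open>C\<close> of the
      growth estimate.\<close>
    obtain L where "L-lipschitz_on profiles (\<sigma> i)" using assms(3) by blast
    then have "bounded (\<sigma> i ` profiles)"
      by (intro compact_imp_bounded compact_continuous_image lipschitz_on_continuous_on compact_profiles)
    then obtain C where C: "\<And>x. x \<in> profiles \<Longrightarrow> \<bar>\<sigma> i x\<bar> \<le> C" by (auto simp: bounded_iff)
    show ?thesis
    proof (rule ito_integral_sublinear[OF ito])
      fix t \<omega> assume t: "0 \<le> (t :: real)" "\<omega> \<in> space M"
      have "X t \<omega> \<in> profiles"
        using sol(3)[OF t] choice_map_max(1)[OF hc(1)] choice_map_max(1)[OF hc(2)] by (simp add: profiles_def)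
      then show "\<bar>\<sigma> i (X t \<omega>)\<bar> \<le> C" by (rule C)
    qed
  qed
  have "AE \<omega> in M. continuous_on {0..} (\<lambda>t. Y t \<omega>)" using sol(1) by (simp add: continuous_paths_def)
  moreover have "AE \<omega> in M. \<forall>i\<in>UNIV. \<forall>t\<ge>0. coord i (Y t \<omega>) =
      coord i (Y 0 \<omega>) + integral {0..t} (\<lambda>s. coord i (payoff_vec u1 u2 (X s \<omega>))) + Z i t \<omega>"
    by (intro AE_finite_allI scores) simp
  moreover have "AE \<omega> in M. \<forall>i\<in>UNIV. ((\<lambda>t. Z i t \<omega> / t) \<longlongrightarrow> 0) at_top"
    by (intro AE_finite_allI Z) simp
  moreover have "AE \<omega> in M. \<omega> \<in> space M" by simp
  ultimately show ?thesis
  proof eventually_elim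
    case (elim \<omega>)
    show ?case
    proof (rule reinforcement_path_chain_transitive[OF assms(4-7) elim(1)])
      show "X t \<omega> = (choice_map h1 (\<eta>1 t *\<^sub>R fst (Y t \<omega>)), choice_map h2 (\<eta>2 t *\<^sub>R snd (Y t \<omega>)))"
        if "0 \<le> t" for t
        by (rule sol(3)[OF that elim(4)])
      show "coord i (Y t \<omega>) = coord i (Y 0 \<omega>) +
          integral {0..t} (\<lambda>s. coord i (payoff_vec u1 u2 (X s \<omega>))) + Z i t \<omega>" if "0 \<le> t" for t i
        using elim(2) that by blast
      show "((\<lambda>t. Z i t \<omega> / t) \<longlongrightarrow> 0) at_top" for i using elim(3) by blast
    qed
  qed
qed

end
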